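(* The mapping $$\varphi: h_i'\mapsto b\cdot g_i,\qquad i=1,\dots,2^{mn}$$ (extended to a right $G$-linear map $W_{\lambda_h}\to b\cdot W_{\lambda_g}$) determines an isomorphism of the $GL\,V$-modules $W_{\lambda_h}$ and $b\cdot W_{\lambda_g}$; that is, for every $\mathcal A\in GL\,V$ one has $$\mathcal A\varphi=\varphi\mathcal A .$$
   Context: **Setting.** $K$ is a field of characteristic zero and $G=G_0\oplus G_1$ is the Grassmann algebra over $K$ with a countable (infinite) set of generators, with its even part $G_0$ and odd part $G_1$. $V$ is a free $\mathbb Z_2$-graded $G$-module of dimension $m|n$, with a basis $e_1,\dots,e_m$ of even elements and $\varepsilon_1,\dots,\varepsilon_n$ of odd elements. It is a $G$-bimodule with compatible left and right structures: $av=(-1)^{|a||v|}va$ for homogeneous $a\in G$, $v\in V$. Put $\Omega=\{e_1,\dots,e_m,\varepsilon_1,\dots,\varepsilon_n\}$. $GL\,V$ is the group of invertible even (right) $G$-linear operators on $V$. It is identified with the group $GL_{m,n}$ of invertible block matrices $A=\begin{pmatrix}A_{11}&A_{12}\\ A_{21}&A_{22}\end{pmatrix}$, where $A_{11}$ ($m\times m$) and $A_{22}$ ($n\times n$) have entries in $G_0$ and $A_{12},A_{21}$ have entries in $G_1$: writing $(\vartheta_1,\dots,\vartheta_{m+n})=(e_1,\dots,e_m,\varepsilon_1,\dots,\varepsilon_n)$, the matrix $A=(a_{ij})$ of $\mathcal A$ is given by $\mathcal A(\vartheta_j)=\sum_i\vartheta_i a_{ij}$. The Berezinian is $\mathrm{Ber}\,A=\det(A_{11}-A_{12}A_{22}^{-1}A_{21})\det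 A_{22}^{-1}$; it is multiplicative. **Tensors.** $T_l(V)=V\otimes\cdots\otimes V$ ($l$ factors, over $G$; $T_0(V)=G$), the tensor sign being omitted. $GL\,V$ acts by $\mathcal A(v_1\cdots v_l)=\mathcal A(v_1)\cdots\mathcal A(v_l)$. The symmetric group $S_l$ acts on the left: for homogeneous $v_i$, $\sigma(v_1\cdots v_l)=(-1)^N v_{\sigma^{-1}(1)}\cdots v_{\sigma^{-1}(l)}$, where $N$ is the number of pairs $i<j$ with $\sigma(i)>\sigma(j)$ and $v_i,v_j$ both odd. For a partition $\lambda$ of $l$, $T=T_\lambda$ is the Young tableau of shape $\lambda$ filled with $1,\dots,l$ row by row, left to right and top to bottom. $R(T)$, $C(T)\subset S_l$ are its row and column stabilizers. The Young symmetrizer is $e_T=\sum_{\sigma\in C(T),\,\tau\in R(T)}\mathrm{sgn}(\sigma)\,\tau\sigma$, and $W_\lambda=e_{T_\lambda}T_l(V)$, a $GL\,V$-module. Put $\lambda_h=(n+1,\dots,n+1)$ ($m$ rows) and $\lambda_g=(n,\dots,n)$ ($m+1$ rows). **Canonical tensors.** A filling of $\lambda_h$ or $\lambda_g$ by elements of $\Omega$ defines the tensor $e_Tv_1\cdots v_l$, where $v_1,\dots,v_l$ is the filling read row by row. The filling is canonical if each $e_i$ occurs only in row $i$ and each $\varepsilon_j$ occurs only in column $j$. Thus each box $(i,j)$ of the small rectangle ($1\le i\le m$, $1\le j\le n$) contains $e_i$ or $\varepsilon_j$; box $(i,n+1)$ of $\lambda_h$ contains $e_i$; box $(m+1,j)$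 of $\lambda_g$ contains $\varepsilon_j$. Let $h_1,\dots,h_{2^{mn}}$ and $g_1,\dots,g_{2^{mn}}$ be the tensors of the canonical fillings of $\lambda_h$ and $\lambda_g$, numbered so that $h_i$ and $g_i$ have the same filling of the small rectangle. It is known that $\{h_i\}$ and $\{g_i\}$ are bases of the $G$-modules $W_{\lambda_h}$ and $W_{\lambda_g}$. For a canonical tensor $f$, let $\kappa(f)$ be the cardinality of the group of permutations of the odd elements preserving the filling, i.e. the product over the columns $j\le n$ of $(\text{number of }\varepsilon_j\text{ in column }j)!$ (columns with no odd elements contribute $1$). Let $\rho(f)$ be the number of odd basis elements in the small rectangle. Put $$\alpha(h_i)=\frac{(-1)^{n\rho(h_i)}\kappa(h_i)}{\kappa(g_i)},\qquad h_i'=\frac{h_i}{\alpha(h_i)} .$$ **The element $b$.** $b$ is a formal homogeneous element on which $GL\,V$ acts by $\mathcal A(b)=\mathrm{Ber}\,A\cdot b$, where $A$ is the matrix of $\mathcal A$. The module $b\cdot W_{\lambda_g}$ is the free $G$-module with basis $b\cdot g_i$, with action $\mathcal A(b\cdot w)=\mathcal A(b)\,\mathcal A(w)=\mathrm{Ber}\,A\cdot b\cdot\mathcal A(w)$. *)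

theory Defs
  imports
    "Jordan_Normal_Form.Determinant"
    "HOL-Combinatorics.Permutations"
    "HOL-Library.FuncSet"
    "HOL-Library.Poly_Mapping"
begin

section \<open>The Grassmann algebra on generators \<open>\<xi>\<^sub>0, \<xi>\<^sub>1, \<dots>\<close>\<close>

text \<open>An element is its family of coefficients with respect to the monomials
  \<open>\<xi>\<^sub>S = \<xi>\<^sub>s\<^sub>1 \<cdots> \<xi>\<^sub>s\<^sub>k\<close>, where \<open>S = {s\<^sub>1 < \<dots> < s\<^sub>k}\<close> is a finite set of naturals.\<close>

typedef (overloaded) ('a::zero) grassmann =
  "{f :: nat set \<Rightarrow> 'a. finite {S. f S \<noteq> 0} \<and> (\<forall>S. f S \<noteq> 0 \<longrightarrow> finite S)}"
  morphisms gcoeff Abs_grassmann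
  by (rule exI[of _ "\<lambda>_. 0"]) auto

setup_lifting type_definition_grassmann

lemma grassmann_eqI: "(\<And>S. gcoeff x S = gcoeff y S) \<Longrightarrow> x = y"
  by (subst gcoeff_inject[symmetric]) (rule ext)

lemma finite_gcoeff: "finite {S. gcoeff x S \<noteq> 0}"
  and gcoeff_infinite: "infinite S \<Longrightarrow> gcoeff x S = 0"
  using gcoeff[of x] by auto

text \<open>For disjoint \<open>S\<close>, \<open>T\<close> one has \<open>\<xi>\<^sub>S \<xi>\<^sub>T = gsign S T \<xi>\<^sub>S\<^sub>\<union>\<^sub>T\<close>; otherwise the product is 0.\<close>

definition gsign :: "nat set \<Rightarrow> nat set \<Rightarrow> 'a::comm_ring_1" where
  "gsign S T = (- 1) ^ card {(s, t). s \<in> S \<and> t \<in> T \<and> t < s}"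

lemma gsign_fin: "finite S \<Longrightarrow> finite T \<Longrightarrow> finite {(s, t). s \<in> S \<and> t \<in> T \<and> t < (s::nat)}"
  by (rule finite_subset[of _ "S \<times> T"]) auto

lemma gsign_empty [simp]: "gsign {} T = 1" "gsign S {} = 1"
  by (simp_all add: gsign_def)

lemma gsign_Un_left:
  assumes "finite A" "finite B" "finite C" "A \<inter> B = {}"
  shows "gsign (A \<union> B) C = gsign A C * gsign B C"
proof -
  have "{(s, t). s \<in> A \<union> B \<and> t \<in> C \<and> t < s} =
    {(s, t). s \<in> A \<and> t \<in> C \<and> t < s} \<union> {(s, t). s \<in> B \<and> t \<in> C \<and> t < s}" by auto
  moreover have "{(s, t). s \<in> A \<and> t \<in> C \<and> t < s} \<inter> {(s, t). s \<in> B \<and> t \<in> C \<and> t < s} = {}"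
    using assms by auto
  ultimately show ?thesis
    using assms by (simp add: gsign_def card_Un_disjoint gsign_fin power_add)
qed

lemma gsign_Un_right:
  assumes "finite A" "finite B" "finite C" "B \<inter> C = {}"
  shows "gsign A (B \<union> C) = gsign A B * gsign A C"
proof -
  have "{(s, t). s \<in> A \<and> t \<in> B \<union> C \<and> t < s} =
    {(s, t). s \<in> A \<and> t \<in> B \<and> t < s} \<union> {(s, t). s \<in> A \<and> t \<in> C \<and> t < s}" by auto
  moreover have "{(s, t). s \<in> A \<and> t \<in> B \<and> t < s} \<inter> {(s, t). s \<in> A \<and> t \<in> C \<and> t < s} = {}"
    using assms by auto
  ultimately show ?thesis
    using assms by (simp add: gsign_def card_Un_disjoint gsign_fin power_add)
qed

lemma gsign_swap:
  assumes "finite A" "finite B" "A \<inter> B = {}"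
  shows "(gsign A B :: 'a::comm_ring_1) = (- 1) ^ (card A * card B) * gsign B A"
proof -
  let ?X = "{(s, t). s \<in> A \<and> t \<in> B \<and> t < s}"
  let ?Y = "{(s, t). s \<in> B \<and> t \<in> A \<and> t < s}"
  have eq: "A \<times> B = ?X \<union> prod.swap ` ?Y"
  proof (rule subset_antisym; rule subsetI)
    fix z assume "z \<in> A \<times> B"
    then obtain s t where z: "z = (s, t)" "s \<in> A" "t \<in> B" by blast
    then have "s \<noteq> t" using assms(3) by auto
    then consider "t < s" | "s < t" by linarith
    then show "z \<in> ?X \<union> prod.swap ` ?Y"
    proof cases
      case 2
      with z have "(t, s) \<in> ?Y" by simp
      then have "prod.swap (t, s) \<in> prod.swap ` ?Y" by (rule imageI)
      with z show ?thesis by simp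
    qed (use z in simp)
  qed auto
  have "finite ?X" "finite (prod.swap ` ?Y)"
    using assms gsign_fin by blast+
  moreover have "?X \<inter> prod.swap ` ?Y = {}" by auto
  ultimately have "card (A \<times> B) = card ?X + card (prod.swap ` ?Y)"
    unfolding eq by (rule card_Un_disjoint)
  moreover have "card (prod.swap ` ?Y) = card ?Y" by (rule card_image) auto
  ultimately have "card A * card B = card ?X + card ?Y"
    by (simp only: card_cartesian_product)
  then have "(- 1 :: 'a) ^ (card A * card B) * gsign B A
      = (- 1) ^ card ?X * ((- 1) ^ card ?Y * (- 1) ^ card ?Y)"
    by (simp add: gsign_def power_add mult.assoc)
  then show ?thesis by (simp add: gsign_def flip: power_add mult_2)
qed

instantiation grassmann :: (comm_ring_1) ring_1
begin

lift_definition zero_grassmann :: "'a grassmann" is "\<lambda>_. 0" by simp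

lift_definition one_grassmann :: "'a grassmann" is "\<lambda>S. if S = {} then 1 else 0"
  by (auto split: if_splits)

lift_definition plus_grassmann :: "'a grassmann \<Rightarrow> 'a grassmann \<Rightarrow> 'a grassmann"
  is "\<lambda>f g S. f S + g S"
proof -
  fix f g :: "nat set \<Rightarrow> 'a"
  assume f: "finite {S. f S \<noteq> 0} \<and> (\<forall>S. f S \<noteq> 0 \<longrightarrow> finite S)"
    and g: "finite {S. g S \<noteq> 0} \<and> (\<forall>S. g S \<noteq> 0 \<longrightarrow> finite S)"
  have "{S. f S + g S \<noteq> 0} \<subseteq> {S. f S \<noteq> 0} \<union> {S. g S \<noteq> 0}" by auto
  with f g show "finite {S. f S + g S \<noteq> 0} \<and> (\<forall>S. f S + g S \<noteq> 0 \<longrightarrow> finite S)"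
    by (metis (no_types, lifting) add.right_neutral finite_UnI finite_subset)
qed

lift_definition uminus_grassmann :: "'a grassmann \<Rightarrow> 'a grassmann" is "\<lambda>f S. - f S" by simp

definition minus_grassmann :: "'a grassmann \<Rightarrow> 'a grassmann \<Rightarrow> 'a grassmann" where
  "minus_grassmann x y = x + - y"

lift_definition times_grassmann :: "'a grassmann \<Rightarrow> 'a grassmann \<Rightarrow> 'a grassmann"
  is "\<lambda>f g U. \<Sum>S\<in>Pow U. gsign S (U - S) * f S * g (U - S)"
proof -
  fix f g :: "nat set \<Rightarrow> 'a"
  let ?h = "\<lambda>U. \<Sum>S\<in>Pow U. gsign S (U - S) * f S * g (U - S)"
  assume f: "finite {S. f S \<noteq> 0} \<and> (\<forall>S. f S \<noteq> 0 \<longrightarrow> finite S)"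
    and g: "finite {S. g S \<noteq> 0} \<and> (\<forall>S. g S \<noteq> 0 \<longrightarrow> finite S)"
  have *: "\<exists>S\<subseteq>U. f S \<noteq> 0 \<and> g (U - S) \<noteq> 0" if U: "?h U \<noteq> 0" for U
  proof (rule ccontr)
    assume "\<not> ?thesis"
    then have "?h U = 0" by (intro sum.neutral) auto
    with U show False by simp
  qed
  have "{U. ?h U \<noteq> 0} \<subseteq> (\<lambda>(S, T). S \<union> T) ` ({S. f S \<noteq> 0} \<times> {S. g S \<noteq> 0})"
  proof
    fix U assume "U \<in> {U. ?h U \<noteq> 0}"
    then obtain S where "S \<subseteq> U" "f S \<noteq> 0" "g (U - S) \<noteq> 0" using * by auto
    then show "U \<in> (\<lambda>(S, T). S \<union> T) ` ({S. f S \<noteq> 0} \<times> {S. g S \<noteq> 0})"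
      by (intro image_eqI[of _ _ "(S, U - S)"]) auto
  qed
  moreover have "finite U" if "?h U \<noteq> 0" for U
    using *[OF that] f g by (metis finite_Diff2)
  ultimately show "finite {U. ?h U \<noteq> 0} \<and> (\<forall>U. ?h U \<noteq> 0 \<longrightarrow> finite U)"
    using f g by (meson finite_SigmaI finite_imageI finite_subset)
qed

instance
proof
  fix a b c :: "'a grassmann"
  show "a * b * c = a * (b * c)"
  proof (rule grassmann_eqI)
    fix U
    show "gcoeff (a * b * c) U = gcoeff (a * (b * c)) U"
    proof (cases "finite U")
      case False
      then show ?thesis by (simp add: gcoeff_infinite)
    next
      case fin: True
      let ?I = "SIGMA S:Pow U. Pow S" and ?J = "SIGMA R:Pow U. Pow (U - R)"
      have "gcoeff (a * b * c) U =
          (\<Sum>S\<in>Pow U. \<Sum>R\<in>Pow S. gsign S (U - S) * (gsign R (S - R) * gcoeff a R * gcoeff b (S - R))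
            * gcoeff c (U - S))"
        by (simp add: times_grassmann.rep_eq sum_distrib_left sum_distrib_right)
      also have "\<dots> = (\<Sum>(S, R)\<in>?I. gsign S (U - S) * (gsign R (S - R) * gcoeff a R * gcoeff b (S - R))
            * gcoeff c (U - S))"
        using fin by (intro sum.Sigma) (auto intro: finite_subset)
      also have "\<dots> = (\<Sum>(R, P)\<in>?J. gsign R (U - R) * gcoeff a R *
            (gsign P (U - R - P) * gcoeff b P * gcoeff c (U - R - P)))"
      proof (rule sum.reindex_bij_witness[of _ "\<lambda>(R, P). (R \<union> P, R)" "\<lambda>(S, R). (R, S - R)"], goal_cases)
        case (5 z)
        then obtain S R where z: "z = (S, R)" and SR: "S \<subseteq> U" "R \<subseteq> S" by auto
        have f: "finite S" "finite R" "finite (S - R)" "finite (U - S)"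
          using fin SR by (auto intro: finite_subset)
        have e1: "U - R = (S - R) \<union> (U - S)" "U - R - (S - R) = U - S" "S = R \<union> (S - R)"
          using SR by auto
        have "gsign S (U - S) = (gsign R (U - S) * gsign (S - R) (U - S) :: 'a)"
          using gsign_Un_left[of R "S - R" "U - S"] f e1(3) by auto
        moreover have "gsign R (U - R) = (gsign R (S - R) * gsign R (U - S) :: 'a)"
          using gsign_Un_right[of R "S - R" "U - S"] f e1(1) by auto
        ultimately show ?case by (simp add: z e1(2) mult_ac)
      qed auto
      also have "\<dots> = (\<Sum>R\<in>Pow U. \<Sum>P\<in>Pow (U - R). gsign R (U - R) * gcoeff a R *
            (gsign P (U - R - P) * gcoeff b P * gcoeff c (U - R - P)))"
        using fin by (intro sum.Sigma[symmetric]) (auto intro: finite_subset)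
      also have "\<dots> = gcoeff (a * (b * c)) U"
        by (simp add: times_grassmann.rep_eq sum_distrib_left)
      finally show ?thesis .
    qed
  qed
  show "1 * a = a"
  proof (rule grassmann_eqI)
    fix U
    show "gcoeff (1 * a) U = gcoeff a U"
    proof (cases "finite U")
      case True
      then have "gcoeff (1 * a) U = (\<Sum>S\<in>Pow U. if S = {} then gcoeff a U else 0)"
        unfolding times_grassmann.rep_eq by (intro sum.cong) (auto simp: one_grassmann.rep_eq)
      with True show ?thesis by simp
    qed (simp add: gcoeff_infinite)
  qed
  show "a * 1 = a"
  proof (rule grassmann_eqI)
    fix U
    show "gcoeff (a * 1) U = gcoeff a U"
    proof (cases "finite U")
      case True
      then have "gcoeff (a * 1) U = (\<Sum>S\<in>Pow U. if S = U then gcoeff a U else 0)"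
        unfolding times_grassmann.rep_eq by (intro sum.cong) (auto simp: one_grassmann.rep_eq)
      with True show ?thesis by simp
    qed (simp add: gcoeff_infinite)
  qed
  show "(a + b) * c = a * c + b * c" "a * (b + c) = a * b + a * c"
    by (rule grassmann_eqI;
        simp add: times_grassmann.rep_eq plus_grassmann.rep_eq algebra_simps sum.distrib)+
  show "a + b + c = a + (b + c)" "a + b = b + a" "0 + a = a" "- a + a = 0"
    by (rule grassmann_eqI;
        simp add: plus_grassmann.rep_eq zero_grassmann.rep_eq uminus_grassmann.rep_eq add_ac)+
  show "a - b = a + - b" by (simp add: minus_grassmann_def)
  have "gcoeff (0::'a grassmann) {} \<noteq> gcoeff 1 {}"
    by (simp add: zero_grassmann.rep_eq one_grassmann.rep_eq)
  then show "(0::'a grassmann) \<noteq> 1" by metis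
qed

end

text \<open>The embedding of the ground ring.\<close>

lift_definition gconst :: "'a::comm_ring_1 \<Rightarrow> 'a grassmann" is "\<lambda>a S. if S = {} then a else 0"
  by (auto split: if_splits)

text \<open>Parities are truth values, \<open>True\<close> standing for odd; \<open>0\<close> has both parities.\<close>

definition gparity :: "bool \<Rightarrow> 'a::comm_ring_1 grassmann \<Rightarrow> bool" where
  "gparity p x \<longleftrightarrow> (\<forall>S. gcoeff x S \<noteq> 0 \<longrightarrow> (odd (card S) \<longleftrightarrow> p))"

text \<open>The parity involution: \<open>gbar x = (-1)\<^sup>|\<^sup>x\<^sup>| x\<close> for homogeneous \<open>x\<close>.\<close>

lift_definition gbar :: "'a::comm_ring_1 grassmann \<Rightarrow> 'a grassmann" is
  "\<lambda>f S. (- 1) ^ card S * f S"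
proof -
  fix f :: "nat set \<Rightarrow> 'a"
  assume f: "finite {S. f S \<noteq> 0} \<and> (\<forall>S. f S \<noteq> 0 \<longrightarrow> finite S)"
  have "{S. (- 1) ^ card S * f S \<noteq> 0} \<subseteq> {S. f S \<noteq> 0}" by auto
  with f show "finite {S. (- 1) ^ card S * f S \<noteq> 0} \<and> (\<forall>S. (- 1) ^ card S * f S \<noteq> 0 \<longrightarrow> finite S)"
    by (auto intro: finite_subset)
qed

lemma gparity_add:
  assumes "gparity p x" "gparity p y"
  shows "gparity p (x + y)"
  unfolding gparity_def
proof (intro allI impI)
  fix S assume "gcoeff (x + y) S \<noteq> 0"
  then have "gcoeff x S \<noteq> 0 \<or> gcoeff y S \<noteq> 0" by (auto simp: plus_grassmann.rep_eq)
  with assms show "odd (card S) = p" unfolding gparity_def by blast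
qed

lemma gparity_uminus: "gparity p x \<Longrightarrow> gparity p (- x)"
  by (simp add: gparity_def uminus_grassmann.rep_eq)

lemma gparity_mult:
  assumes "gparity p x" "gparity q y"
  shows "gparity (p \<noteq> q) (x * y)"
  unfolding gparity_def
proof (intro allI impI)
  fix U assume nz: "gcoeff (x * y) U \<noteq> 0"
  then have fin: "finite U" using gcoeff_infinite by blast
  have "\<exists>S\<subseteq>U. gcoeff x S \<noteq> 0 \<and> gcoeff y (U - S) \<noteq> 0"
  proof (rule ccontr)
    assume "\<not> ?thesis"
    then have "gcoeff (x * y) U = 0" unfolding times_grassmann.rep_eq by (intro sum.neutral) auto
    with nz show False by simp
  qed
  then obtain S where S: "S \<subseteq> U" "gcoeff x S \<noteq> 0" "gcoeff y (U - S) \<noteq> 0" by auto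
  have "card U = card S + card (U - S)"
    using S(1) fin by (metis card_Diff_subset card_mono finite_subset le_add_diff_inverse)
  with S assms show "odd (card U) = (p \<noteq> q)" unfolding gparity_def by auto
qed

text \<open>The even part \<open>G\<^sub>0\<close> as a commutative ring, so that library determinants apply to it.\<close>

typedef (overloaded) ('a::comm_ring_1) geven = "{x :: 'a grassmann. gparity False x}"
  morphisms of_geven to_geven
  by (rule exI[of _ 0]) (simp add: gparity_def zero_grassmann.rep_eq)

setup_lifting type_definition_geven

instantiation geven :: (comm_ring_1) comm_ring_1
begin

lift_definition zero_geven :: "'a geven" is 0
  by (simp add: gparity_def zero_grassmann.rep_eq)

lift_definition one_geven :: "'a geven" is 1
  by (simp add: gparity_def one_grassmann.rep_eq)

lift_definition plus_geven :: "'a geven \<Rightarrow> 'a geven \<Rightarrow> 'a geven" is "(+)"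
  by (rule gparity_add)

lift_definition uminus_geven :: "'a geven \<Rightarrow> 'a geven" is uminus
  by (rule gparity_uminus)

lift_definition minus_geven :: "'a geven \<Rightarrow> 'a geven \<Rightarrow> 'a geven" is "(-)"
  unfolding minus_grassmann_def by (intro gparity_add gparity_uminus)

lift_definition times_geven :: "'a geven \<Rightarrow> 'a geven \<Rightarrow> 'a geven" is "(*)"
  using gparity_mult[of False _ False] by simp

lemma geven_commute:
  assumes x: "gparity False x"
  shows "x * y = y * (x :: 'a::comm_ring_1 grassmann)"
proof (rule grassmann_eqI)
  fix U
  show "gcoeff (x * y) U = gcoeff (y * x) U"
  proof (cases "finite U")
    case fin: True
    have "gcoeff (x * y) U = (\<Sum>S\<in>Pow U. gsign S (U - S) * gcoeff x S * gcoeff y (U - S))"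
      by (simp add: times_grassmann.rep_eq)
    also have "\<dots> = (\<Sum>S\<in>Pow U. gsign S (U - S) * gcoeff y S * gcoeff x (U - S))"
    proof (rule sum.reindex_bij_witness[of _ "\<lambda>S. U - S" "\<lambda>S. U - S"], goal_cases)
      case (5 S)
      then have S: "S \<subseteq> U" "U - (U - S) = S" by auto
      show ?case
      proof (cases "gcoeff x S = 0")
        case False
        then have "even (card S)" using x by (auto simp: gparity_def)
        moreover have "finite S" using fin S finite_subset by blast
        ultimately have "gsign S (U - S) = (gsign (U - S) S :: 'a)"
          using gsign_swap[of S "U - S", where 'a = 'a] fin
          by (metis Diff_disjoint even_mult_iff finite_Diff mult_1 neg_one_even_power)
        then show ?thesis by (simp only: S(2)) (simp only: mult_ac)
      qed (simp add: S(2))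
    qed auto
    also have "\<dots> = gcoeff (y * x) U" by (simp add: times_grassmann.rep_eq)
    finally show ?thesis .
  qed (simp add: gcoeff_infinite)
qed

instance
proof
  fix a b c :: "'a geven"
  show "a * b * c = a * (b * c)" by transfer (simp add: mult.assoc)
  show "a * b = b * a" by transfer (simp add: geven_commute)
  show "1 * a = a" by transfer simp
  show "(a + b) * c = a * c + b * c" by transfer (simp add: algebra_simps)
  show "a + b + c = a + (b + c)" by transfer (simp add: add.assoc)
  show "a + b = b + a" by transfer (simp add: add.commute)
  show "0 + a = a" by transfer simp
  show "- a + a = 0" by transfer simp
  show "a - b = a + - b" by transfer simp
  show "(0::'a geven) \<noteq> 1" by transfer simp
qed

end

section \<open>The module \<open>V\<close>, the group \<open>GL V\<close> and the Berezinian\<close>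

text \<open>Everything is indexed from 0.  The basis \<open>e\<^sub>1, \<dots>, e\<^sub>m, \<epsilon>\<^sub>1, \<dots>, \<epsilon>\<^sub>n\<close> of \<open>V\<close> is numbered
  \<open>\<theta>\<^sub>0, \<dots>, \<theta>\<^sub>m\<^sub>+\<^sub>n\<^sub>-\<^sub>1\<close>, so that the letter \<open>i\<close> is odd iff \<open>m \<le> i\<close>.
  The vector \<open>\<Sum>\<^sub>i \<theta>\<^sub>i v\<^sub>i\<close> (coefficients on the right) is the column vector \<open>v\<close> in
  \<open>carrier_vec (m + n)\<close>.\<close>

definition vparity :: "nat \<Rightarrow> bool \<Rightarrow> 'a::comm_ring_1 grassmann vec \<Rightarrow> bool" where
  "vparity m p v \<longleftrightarrow> (\<forall>i<dim_vec v. gparity (p \<noteq> (m \<le> i)) (v $ i))"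

definition vec_rscale :: "'a::comm_ring_1 grassmann vec \<Rightarrow> 'a grassmann \<Rightarrow> 'a grassmann vec" where
  "vec_rscale v a = map_vec (\<lambda>x. x * a) v"

definition GL :: "nat \<Rightarrow> nat \<Rightarrow> ('a::comm_ring_1 grassmann vec \<Rightarrow> 'a grassmann vec) set" where
  "GL m n = {F. bij_betw F (carrier_vec (m + n)) (carrier_vec (m + n))
    \<and> (\<forall>v\<in>carrier_vec (m + n). \<forall>w\<in>carrier_vec (m + n). F (v + w) = F v + F w)
    \<and> (\<forall>v\<in>carrier_vec (m + n). \<forall>a. F (vec_rscale v a) = vec_rscale (F v) a)
    \<and> (\<forall>p. \<forall>v\<in>carrier_vec (m + n). vparity m p v \<longrightarrow> vparity m p (F v))}"

text \<open>\<open>F(\<theta>\<^sub>j) = \<Sum>\<^sub>i \<theta>\<^sub>i a\<^sub>i\<^sub>j\<close>\<close>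

definition matrix_of :: "nat \<Rightarrow> ('a::comm_ring_1 grassmann vec \<Rightarrow> 'a grassmann vec) \<Rightarrow> 'a grassmann mat"
  where "matrix_of d F = mat d d (\<lambda>(i, j). F (unit_vec d j) $ i)"

definition inverse_mat :: "'a::semiring_1 mat \<Rightarrow> 'a mat" where
  "inverse_mat A = (THE B. B \<in> carrier_mat (dim_row A) (dim_row A) \<and> inverts_mat A B \<and> inverts_mat B A)"

text \<open>\<open>to_geven\<close> is unspecified on elements that are not even; for the matrix of an element of
  \<open>GL\<close> it is applied to even entries only.\<close>

definition berezinian :: "nat \<Rightarrow> 'a::comm_ring_1 grassmann mat \<Rightarrow> 'a geven" where
  "berezinian m A = (case split_block A m m of (A11, A12, A21, A22) \<Rightarrow>
     det (map_mat to_geven (A11 - A12 * inverse_mat A22 * A21))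
     * det (map_mat to_geven (inverse_mat A22)))"

section \<open>Tensors\<close>

text \<open>\<open>T\<^sub>l(V)\<close> is the free right \<open>G\<close>-module on the words of length \<open>l\<close> in the basis of \<open>V\<close>;
  \<open>t\<close> stands for \<open>\<Sum>\<^sub>w w (lookup t w)\<close>.\<close>

type_synonym 'a tensor = "nat list \<Rightarrow>\<^sub>0 'a grassmann"

definition tensor_power :: "nat \<Rightarrow> nat \<Rightarrow> nat \<Rightarrow> 'a::comm_ring_1 tensor set" where
  "tensor_power m n l = {t. \<forall>w\<in>Poly_Mapping.keys t. length w = l \<and> set w \<subseteq> {..<m + n}}"

definition rscale :: "'a::comm_ring_1 tensor \<Rightarrow> 'a grassmann \<Rightarrow> 'a tensor" where
  "rscale t a = Poly_Mapping.map (\<lambda>x. x * a) t"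

text \<open>Right \<open>G\<close>-linear extension of a map given on words.\<close>

definition rlinear_ext :: "(nat list \<Rightarrow> 'a tensor) \<Rightarrow> 'a::comm_ring_1 tensor \<Rightarrow> 'a tensor" where
  "rlinear_ext F t = (\<Sum>w\<in>Poly_Mapping.keys t. rscale (F w) (Poly_Mapping.lookup t w))"

definition nodd :: "nat \<Rightarrow> nat list \<Rightarrow> nat" where
  "nodd m w = length (filter (\<lambda>i. m \<le> i) w)"

text \<open>The product \<open>v t\<close> of a vector and a tensor.  Moving the coefficient of \<open>\<theta>\<^sub>i\<close> to the right past
  the word \<open>w\<close> gives \<open>\<theta>\<^sub>i v\<^sub>i w = \<theta>\<^sub>i w v\<^sub>i'\<close>, where \<open>v\<^sub>i'\<close> results from \<open>v\<^sub>i\<close> by applying the parity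
  involution once for each odd letter of \<open>w\<close>.\<close>

definition vec_tensor :: "nat \<Rightarrow> 'a::comm_ring_1 grassmann vec \<Rightarrow> 'a tensor \<Rightarrow> 'a tensor" where
  "vec_tensor m v t = (\<Sum>i<dim_vec v. \<Sum>w\<in>Poly_Mapping.keys t.
     Poly_Mapping.single (i # w) ((gbar ^^ nodd m w) (v $ i) * Poly_Mapping.lookup t w))"

fun pure_tensor :: "nat \<Rightarrow> 'a::comm_ring_1 grassmann vec list \<Rightarrow> 'a tensor" where
  "pure_tensor m [] = Poly_Mapping.single [] 1"
| "pure_tensor m (v # vs) = vec_tensor m v (pure_tensor m vs)"

definition gl_act :: "nat \<Rightarrow> nat \<Rightarrow> ('a::comm_ring_1 grassmann vec \<Rightarrow> 'a grassmann vec)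
    \<Rightarrow> 'a tensor \<Rightarrow> 'a tensor" where
  "gl_act m n F = rlinear_ext (\<lambda>w. pure_tensor m (map (\<lambda>j. F (unit_vec (m + n) j)) w))"

definition koszul_sign :: "nat \<Rightarrow> (nat \<Rightarrow> nat) \<Rightarrow> nat list \<Rightarrow> 'a::comm_ring_1 grassmann" where
  "koszul_sign m \<sigma> w = (- 1) ^ card {(i, j). i < j \<and> j < length w \<and> \<sigma> i > \<sigma> j \<and> m \<le> w ! i \<and> m \<le> w ! j}"

text \<open>\<open>permute_list (Hilbert_Choice.inv \<sigma>) w\<close> has the letter \<open>w ! (\<sigma>\<^sup>-\<^sup>1 k)\<close> in position \<open>k\<close>.\<close>

definition sym_act :: "nat \<Rightarrow> (nat \<Rightarrow> nat) \<Rightarrow> 'a::comm_ring_1 tensor \<Rightarrow> 'a tensor" where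
  "sym_act m \<sigma> = rlinear_ext (\<lambda>w. Poly_Mapping.single (permute_list (Hilbert_Choice.inv \<sigma>) w) (koszul_sign m \<sigma> w))"

section \<open>Young symmetrizers\<close>

text \<open>A partition is the list of its row lengths; \<open>boxes\<close> lists the boxes \<open>(row, column)\<close> of its
  diagram row by row, so that the tableau \<open>T\<^sub>\<lambda>\<close> has the entry \<open>k\<close> in the box \<open>boxes \<lambda> ! k\<close>.\<close>

definition boxes :: "nat list \<Rightarrow> (nat \<times> nat) list" where
  "boxes lam = concat (map (\<lambda>i. map (Pair i) [0..<lam ! i]) [0..<length lam])"

definition row_stabilizer :: "nat list \<Rightarrow> (nat \<Rightarrow> nat) set" where
  "row_stabilizer lam = {\<sigma>. \<sigma> permutes {..<sum_list lam} \<and>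
     (\<forall>k<sum_list lam. fst (boxes lam ! \<sigma> k) = fst (boxes lam ! k))}"

definition column_stabilizer :: "nat list \<Rightarrow> (nat \<Rightarrow> nat) set" where
  "column_stabilizer lam = {\<sigma>. \<sigma> permutes {..<sum_list lam} \<and>
     (\<forall>k<sum_list lam. snd (boxes lam ! \<sigma> k) = snd (boxes lam ! k))}"

definition young_act :: "nat \<Rightarrow> nat list \<Rightarrow> 'a::comm_ring_1 tensor \<Rightarrow> 'a tensor" where
  "young_act m lam t = (\<Sum>\<sigma>\<in>column_stabilizer lam. \<Sum>\<tau>\<in>row_stabilizer lam.
     rscale (sym_act m \<tau> (sym_act m \<sigma> t)) (of_int (sign \<sigma>)))"

definition W :: "nat \<Rightarrow> nat \<Rightarrow> nat list \<Rightarrow> 'a::comm_ring_1 tensor set" where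
  "W m n lam = young_act m lam ` tensor_power m n (sum_list lam)"

definition lam_h :: "nat \<Rightarrow> nat \<Rightarrow> nat list" where
  "lam_h m n = replicate m (n + 1)"

definition lam_g :: "nat \<Rightarrow> nat \<Rightarrow> nat list" where
  "lam_g m n = replicate (m + 1) n"

lemma length_boxes: "length (boxes lam) = sum_list lam"
proof -
  have "map ((!) lam) [0..<length lam] = lam" by (rule map_nth)
  then show ?thesis by (simp add: boxes_def length_concat comp_def)
qed

lemma set_boxes: "set (boxes lam) = {(i, j). i < length lam \<and> j < lam ! i}"
  by (auto simp: boxes_def)

section \<open>Canonical tensors\<close>

text \<open>A filling maps boxes to letters; its values outside the diagram are irrelevant.\<close>

definition canonical :: "nat \<Rightarrow> nat \<Rightarrow> nat list \<Rightarrow> (nat \<times> nat \<Rightarrow> nat) \<Rightarrow> bool" where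
  "canonical m n lam f \<longleftrightarrow> (\<forall>(i, j)\<in>set (boxes lam). f (i, j) < m + n
     \<and> (\<forall>k<m. f (i, j) = k \<longrightarrow> i = k) \<and> (\<forall>k<n. f (i, j) = m + k \<longrightarrow> j = k))"

definition same_rectangle :: "nat \<Rightarrow> nat \<Rightarrow> (nat \<times> nat \<Rightarrow> nat) \<Rightarrow> (nat \<times> nat \<Rightarrow> nat) \<Rightarrow> bool" where
  "same_rectangle m n p q \<longleftrightarrow> (\<forall>i<m. \<forall>j<n. p (i, j) = q (i, j))"

lemma canonical_iff:
  "canonical m n lam f \<longleftrightarrow> (\<forall>(i, j)\<in>set (boxes lam).
     i < m \<and> f (i, j) = i \<or> j < n \<and> f (i, j) = m + j)"
proof -
  have "(x < m + n \<and> (\<forall>k<m. x = k \<longrightarrow> i = k) \<and> (\<forall>k<n. x = m + k \<longrightarrow> j = k))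
      \<longleftrightarrow> (i < m \<and> x = i \<or> j < n \<and> x = m + j)" (is "?L \<longleftrightarrow> ?R") for x i j
  proof
    assume L: ?L
    show ?R
    proof (cases "x < m")
      case False
      then obtain k where "x = m + k" by (metis le_Suc_ex not_less)
      with L show ?thesis by simp
    qed (use L in simp)
  qed auto
  then show ?thesis unfolding canonical_def by (simp only:)
qed

lemma canonical_lam_h:
  "canonical m n (lam_h m n) f \<longleftrightarrow>
    (\<forall>i<m. (\<forall>j<n. f (i, j) = i \<or> f (i, j) = m + j) \<and> f (i, n) = i)"
proof -
  have "set (boxes (lam_h m n)) = {(i, j). i < m \<and> (j < n \<or> j = n)}"
    by (auto simp: set_boxes lam_h_def)
  then show ?thesis unfolding canonical_iff by auto
qed

lemma canonical_lam_g:
  "canonical m n (lam_g m n) f \<longleftrightarrow>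
    (\<forall>j<n. (\<forall>i<m. f (i, j) = i \<or> f (i, j) = m + j) \<and> f (m, j) = m + j)"
proof -
  have "set (boxes (lam_g m n)) = {(i, j). (i < m \<or> i = m) \<and> j < n}"
    by (auto simp: set_boxes lam_g_def less_Suc_eq simp del: replicate_Suc)
  then show ?thesis unfolding canonical_iff by auto
qed

definition filling_tensor :: "nat \<Rightarrow> nat list \<Rightarrow> (nat \<times> nat \<Rightarrow> nat) \<Rightarrow> 'a::comm_ring_1 tensor" where
  "filling_tensor m lam f = young_act m lam (Poly_Mapping.single (map f (boxes lam)) 1)"

definition kappa :: "nat \<Rightarrow> nat \<Rightarrow> nat list \<Rightarrow> (nat \<times> nat \<Rightarrow> nat) \<Rightarrow> nat" where
  "kappa m n lam f = (\<Prod>j<n. fact (card {i. (i, j) \<in> set (boxes lam) \<and> f (i, j) = m + j}))"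

definition rho :: "nat \<Rightarrow> nat \<Rightarrow> (nat \<times> nat \<Rightarrow> nat) \<Rightarrow> nat" where
  "rho m n f = card {(i, j). i < m \<and> j < n \<and> m \<le> f (i, j)}"

text \<open>\<open>p\<close> and \<open>q\<close> are the canonical fillings of \<open>\<lambda>\<^sub>h\<close> and \<open>\<lambda>\<^sub>g\<close> belonging to \<open>h\<^sub>i\<close> and \<open>g\<^sub>i\<close>.\<close>

definition alpha :: "nat \<Rightarrow> nat \<Rightarrow> (nat \<times> nat \<Rightarrow> nat) \<Rightarrow> (nat \<times> nat \<Rightarrow> nat) \<Rightarrow> 'a::field_char_0" where
  "alpha m n p q = (- 1) ^ (n * rho m n p) * of_nat (kappa m n (lam_h m n) p)
     / of_nat (kappa m n (lam_g m n) q)"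

definition h' :: "nat \<Rightarrow> nat \<Rightarrow> (nat \<times> nat \<Rightarrow> nat) \<Rightarrow> (nat \<times> nat \<Rightarrow> nat) \<Rightarrow> 'a::field_char_0 tensor" where
  "h' m n p q = rscale (filling_tensor m (lam_h m n) p) (gconst (1 / alpha m n p q))"

section \<open>The module \<open>b \<cdot> W\<close>\<close>

text \<open>\<open>B t\<close> is the formal product \<open>b \<cdot> t\<close>.\<close>

datatype 'a bprod = B 'a

instantiation bprod :: (ab_group_add) ab_group_add
begin

definition zero_bprod :: "'a bprod" where "0 = B 0"

fun plus_bprod :: "'a bprod \<Rightarrow> 'a bprod \<Rightarrow> 'a bprod" where "B s + B t = B (s + t)"

fun uminus_bprod :: "'a bprod \<Rightarrow> 'a bprod" where "- B s = B (- s)"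

fun minus_bprod :: "'a bprod \<Rightarrow> 'a bprod \<Rightarrow> 'a bprod" where "B s - B t = B (s - t)"

instance
proof
  fix a b c :: "'a bprod"
  show "a + b + c = a + (b + c)" by (cases a; cases b; cases c) (simp add: add.assoc)
  show "a + b = b + a" by (cases a; cases b) (simp add: add.commute)
  show "0 + a = a" "- a + a = 0" by (cases a; simp add: zero_bprod_def)+
  show "a - b = a + - b" by (cases a; cases b) simp
qed

end

fun b_rscale :: "'a::comm_ring_1 tensor bprod \<Rightarrow> 'a grassmann \<Rightarrow> 'a tensor bprod" where
  "b_rscale (B t) a = B (rscale t a)"

text \<open>\<open>F(b \<cdot> t) = Ber \<cdot> b \<cdot> F(t)\<close>.  As \<open>Ber\<close> is even it may be moved to the right without a sign,
  whatever the parity of \<open>b\<close>.\<close>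

fun b_act :: "nat \<Rightarrow> nat \<Rightarrow> ('a::comm_ring_1 grassmann vec \<Rightarrow> 'a grassmann vec)
    \<Rightarrow> 'a tensor bprod \<Rightarrow> 'a tensor bprod" where
  "b_act m n F (B t) =
     B (rscale (gl_act m n F t) (of_geven (berezinian m (matrix_of (m + n) F))))"

text \<open>\<open>\<phi>\<close> is a right \<open>G\<close>-linear map \<open>W\<^sub>\<lambda>\<^sub>h \<rightarrow> b \<cdot> W\<^sub>\<lambda>\<^sub>g\<close> with \<open>\<phi>(h\<^sub>i') = b \<cdot> g\<^sub>i\<close> for all \<open>i\<close>.\<close>

definition extends_basis_map ::
  "nat \<Rightarrow> nat \<Rightarrow> ('a::field_char_0 tensor \<Rightarrow> 'a tensor bprod) \<Rightarrow> bool" where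
  "extends_basis_map m n \<phi> \<longleftrightarrow>
     \<phi> \<in> W m n (lam_h m n) \<rightarrow>\<^sub>E B ` W m n (lam_g m n)
     \<and> (\<forall>x\<in>W m n (lam_h m n). \<forall>y\<in>W m n (lam_h m n). \<phi> (x + y) = \<phi> x + \<phi> y)
     \<and> (\<forall>x\<in>W m n (lam_h m n). \<forall>a. \<phi> (rscale x a) = b_rscale (\<phi> x) a)
     \<and> (\<forall>p q. canonical m n (lam_h m n) p \<and> canonical m n (lam_g m n) q \<and> same_rectangle m n p q
          \<longrightarrow> \<phi> (h' m n p q) = B (filling_tensor m (lam_g m n) q))"

end

theory Submission
  imports Defs "HOL-Library.Nat_Bijection"
begin

text \<open>Tensors are studied through their evaluations: substituting elements of \<open>G\<close> of the right parity
  for the letters, with a separate value for every position, turns the actions of \<open>GL V\<close> and of \<open>S\<^sub>l\<close>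
  into substitutions, and a tensor is determined by its values.  At points that depend only on the
  row of a position the Young symmetrizer acts, up to a factor, as the alternating sum over the column
  stabilizer.  Hence the value of an element of \<open>W\<^sub>\<lambda>\<close>, for a rectangle \<open>\<lambda>\<close> with \<open>r\<close> rows and \<open>q\<close>
  columns, is multiplied by \<open>(det g)\<^sup>q\<close> when the row index is transformed by \<open>g\<close> in \<open>GL\<^sub>r(G\<^sub>0)\<close>, and it
  suffices to know the values at normalized points, where the even letters form an identity matrix
  and the odd ones an odd matrix \<open>\<xi>\<close>.  There the canonical tensors become multiples of distinct
  monomials in the \<open>\<xi>\<close>, which makes them a basis, and the map of the theorem becomes multiplication
  by the product of the last row of \<open>\<xi>\<close>.  An element of \<open>GL V\<close> moves a normalized point to another one
  after a row transformation with some determinant \<open>x\<close>, which contributes \<open>x\<^sup>n\<^sup>+\<^sup>1\<close> for \<open>\<lambda>\<^sub>h\<close> and \<open>x\<^sup>n\<close> for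
  \<open>\<lambda>\<^sub>g\<close>; the last row of \<open>\<xi>\<close> contributes a determinant \<open>\<mu>\<close>, and \<open>Ber \<mu> = x\<close>.\<close>

section \<open>The Grassmann algebra\<close>

text \<open>The symmetrizer applies row sums after column antisymmetrization. A tensor is killed by
  the row sums as soon as it vanishes at row-constant points whose even letters have the identity as
  body, because polarization only adds nilpotent terms to the identity; exactly these points can be
  normalized. Cancellation in a ring with zero divisors is obtained from generators absent from the
  given coefficients, so the infinite supply of generators is used throughout. The constants are
  forced. The number kappa counts the column permutations of a canonical filling that survive at a
  normalized point, so kappa(h_i) / kappa(g_i) compares the two diagrams, and (-1)^(n rho) is the
  sign of passing n odd factors across rho others. Equivariance becomes the identity Ber x^n mu =
  x^(n+1), proved for every element of GL V at once, without choosing generators of the group. The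
  relation Ber mu = x compares the Schur complements of the two diagonal blocks, through an odd form
  of Sylvester's identity in which the two determinants are inverse to each other instead of
  equal.\<close>

lemma gparity_0 [simp]: "gparity p 0"
  by (simp add: gparity_def zero_grassmann.rep_eq)

lemma gparity_1 [simp]: "gparity False 1"
  by (simp add: gparity_def one_grassmann.rep_eq)

lemma gparity_sum: "(\<And>i. i \<in> I \<Longrightarrow> gparity p (f i)) \<Longrightarrow> gparity p (sum f I)"
  by (induction I rule: infinite_finite_induct) (auto intro: gparity_add)

lemma gparity_of_geven [simp]: "gparity False (of_geven x)"
  using of_geven by blast

lemma of_geven_hom [simp]:
  "of_geven 0 = 0" "of_geven 1 = 1" "of_geven (x + y) = of_geven x + of_geven y"
  "of_geven (x * y) = of_geven x * of_geven y" "of_geven (- x) = - of_geven x"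
  "of_geven (x - y) = of_geven x - of_geven y"
  by (simp_all add: zero_geven.rep_eq one_geven.rep_eq plus_geven.rep_eq times_geven.rep_eq
      uminus_geven.rep_eq minus_geven.rep_eq)

lemma of_geven_sum: "of_geven (sum f I) = (\<Sum>i\<in>I. of_geven (f i))"
  by (induction I rule: infinite_finite_induct) auto

lemma of_geven_power: "of_geven (x ^ k) = of_geven x ^ k"
  by (induction k) auto

lemma of_geven_of_nat: "of_geven (of_nat k) = of_nat k"
  by (induction k) auto

lemma of_geven_of_int: "of_geven (of_int k) = of_int k"
  by (cases k) (auto simp: of_geven_of_nat)

lemma of_geven_commute: "of_geven a * x = x * of_geven a"
  by (rule geven_commute) simp

lemma of_geven_to_geven: "gparity False x \<Longrightarrow> of_geven (to_geven x) = x"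
  by (simp add: to_geven_inverse)

lemma gbar_homogeneous: "gparity p x \<Longrightarrow> gbar x = (if p then - x else x)"
proof (rule grassmann_eqI)
  fix S
  assume "gparity p x"
  then show "gcoeff (gbar x) S = gcoeff (if p then - x else x) S"
    by (cases "gcoeff x S = 0") (auto simp: gbar.rep_eq gparity_def uminus_grassmann.rep_eq)
qed

text \<open>For monomials the sign is (-1)^(|S| |T|); with |T| odd it depends on S alone and is the
  one built into \<open>gbar\<close>. The element \<open>a\<close> is arbitrary because coefficients
  of tensors are not homogeneous in general.\<close>

lemma mult_commute_gbar:
  fixes x :: "'a::comm_ring_1 grassmann"
  assumes x: "gparity p x"
  shows "a * x = x * (if p then gbar a else a)"
proof (cases p)
  case False
  then show ?thesis using geven_commute[of x a] x by simp
next
  case p: True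
  have "gcoeff (a * x) U = gcoeff (x * gbar a) U" for U
  proof (cases "finite U")
    case fin: True
    have "gcoeff (a * x) U = (\<Sum>S\<in>Pow U. gsign S (U - S) * gcoeff a S * gcoeff x (U - S))"
      by (simp add: times_grassmann.rep_eq)
    also have "\<dots> = (\<Sum>S\<in>Pow U. gsign S (U - S) * gcoeff x S * ((- 1) ^ card (U - S) * gcoeff a (U - S)))"
    proof (rule sum.reindex_bij_witness[of _ "\<lambda>S. U - S" "\<lambda>S. U - S"], goal_cases)
      case (5 S)
      then have S: "S \<subseteq> U" "U - (U - S) = S" by auto
      show ?case
      proof (cases "gcoeff x (U - S) = 0")
        case False
        then have "odd (card (U - S))" using x p by (auto simp: gparity_def)
        moreover have "finite S" using fin S finite_subset by blast
        ultimately have "gsign S (U - S) = ((- 1) ^ card S * gsign (U - S) S :: 'a)"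
          using gsign_swap[of S "U - S", where 'a = 'a] fin
          by (metis Diff_disjoint finite_Diff power_minus_mult power_mult odd_pos power_one_right
              mult.commute minus_one_power_iff)
        then show ?thesis by (simp add: S(2) mult_ac)
      qed simp
    qed auto
    also have "\<dots> = gcoeff (x * gbar a) U" by (simp add: times_grassmann.rep_eq gbar.rep_eq)
    finally show ?thesis .
  qed (simp add: gcoeff_infinite)
  with p show ?thesis by (auto intro: grassmann_eqI)
qed

lemma supercommute:
  assumes "gparity p x" "gparity q y"
  shows "y * x = (if p \<and> q then - (x * y) else x * y)"
  using mult_commute_gbar[OF assms(1), of y] gbar_homogeneous[OF assms(2)] by auto

lemma grassmann_eq_uminus_self:
  fixes x :: "'a::field_char_0 grassmann"
  assumes "x = - x"
  shows "x = 0"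
proof (rule grassmann_eqI)
  fix S
  have "gcoeff x S = - gcoeff x S" using assms by (metis uminus_grassmann.rep_eq)
  then show "gcoeff x S = gcoeff 0 S" by (simp add: zero_grassmann.rep_eq)
qed

lemma odd_square_zero:
  fixes x :: "'a::field_char_0 grassmann"
  assumes "gparity True x"
  shows "x * x = 0"
  by (rule grassmann_eq_uminus_self) (use supercommute[OF assms assms] in simp)

lemma gcoeff_gconst_mult: "gcoeff (gconst a * x) U = a * gcoeff x U"
proof (cases "finite U")
  case True
  then have "gcoeff (gconst a * x) U = (\<Sum>S\<in>Pow U. if S = {} then a * gcoeff x U else 0)"
    unfolding times_grassmann.rep_eq by (intro sum.cong) (auto simp: gconst.rep_eq)
  with True show ?thesis by simp
qed (simp add: gcoeff_infinite)

lemma gconst_mult: "gconst (a * b) = gconst a * gconst b"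
  by (rule grassmann_eqI) (simp add: gcoeff_gconst_mult gconst.rep_eq)

lemma gconst_1: "gconst 1 = 1"
  by (rule grassmann_eqI) (simp add: gconst.rep_eq one_grassmann.rep_eq)

lemma gconst_add: "gconst (a + b) = gconst a + gconst b"
  by (rule grassmann_eqI) (simp add: gconst.rep_eq plus_grassmann.rep_eq)

lemma gconst_uminus: "gconst (- a) = - gconst a"
  by (rule grassmann_eqI) (simp add: gconst.rep_eq uminus_grassmann.rep_eq)

lemma gconst_of_nat: "gconst (of_nat k) = of_nat k"
proof (induction k)
  case 0
  show ?case by (rule grassmann_eqI) (simp add: gconst.rep_eq zero_grassmann.rep_eq)
qed (simp add: gconst_add gconst_1)

lemma gparity_gconst [simp]: "gparity False (gconst a)"
  by (simp add: gparity_def gconst.rep_eq)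

lemma gconst_commute: "gconst a * x = x * gconst a"
  by (rule geven_commute) simp

lemma of_nat_grassmann_cancel:
  fixes x :: "'a::field_char_0 grassmann"
  assumes "of_nat k * x = of_nat k * y" "k > 0"
  shows "x = y"
proof (rule grassmann_eqI)
  fix S
  have "gcoeff (gconst (of_nat k) * x) S = gcoeff (gconst (of_nat k) * y) S"
    using assms by (simp add: gconst_of_nat)
  then show "gcoeff x S = gcoeff y S" using assms(2) by (simp add: gcoeff_gconst_mult)
qed

section \<open>Body, nilpotent elements and units\<close>

definition gbody :: "'a::comm_ring_1 grassmann \<Rightarrow> 'a" where
  "gbody x = gcoeff x {}"

lemma gbody_hom [simp]:
  "gbody 0 = 0" "gbody 1 = 1" "gbody (x + y) = gbody x + gbody y"
  "gbody (x * y) = gbody x * gbody y"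
  by (simp_all add: gbody_def zero_grassmann.rep_eq one_grassmann.rep_eq plus_grassmann.rep_eq
      times_grassmann.rep_eq)

lemma gbody_uminus [simp]: "gbody (- x) = - gbody x"
  by (simp add: gbody_def uminus_grassmann.rep_eq)

lemma gbody_diff [simp]: "gbody (x - y) = gbody x - gbody y"
  using gbody_hom(3)[of x "- y"] by simp

lemma gbody_sum: "gbody (sum f I) = (\<Sum>i\<in>I. gbody (f i))"
  by (induction I rule: infinite_finite_induct) auto

lemma gbody_odd: "gparity True x \<Longrightarrow> gbody x = 0"
  by (auto simp: gbody_def gparity_def)

lemma gcoeff_mult_nonzero:
  assumes "gcoeff (x * y) U \<noteq> 0"
  obtains S where "S \<subseteq> U" "gcoeff x S \<noteq> 0" "gcoeff y (U - S) \<noteq> 0"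
proof -
  have "\<exists>R\<in>Pow U. gsign R (U - R) * gcoeff x R * gcoeff y (U - R) \<noteq> 0"
    using assms unfolding times_grassmann.rep_eq by (rule contrapos_np) (auto intro!: sum.neutral)
  then obtain R where R: "R \<subseteq> U" "gsign R (U - R) * gcoeff x R * gcoeff y (U - R) \<noteq> 0" by auto
  then have "gcoeff x R \<noteq> 0" "gcoeff y (U - R) \<noteq> 0" by auto
  with R(1) that show ?thesis by blast
qed

text \<open>Only the finitely many generators in \<open>V\<close> occur in \<open>x\<close>. A
  nonvanishing product of k nonempty monomials involves at least k generators, so the power
  \<open>Suc (card V)\<close> leaves no monomial.\<close>

lemma gbody_zero_nilpotent:
  fixes x :: "'a::comm_ring_1 grassmann"
  assumes "gbody x = 0"
  obtains k where "x ^ k = 0"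
proof -
  define V where "V = \<Union> {S. gcoeff x S \<noteq> 0}"
  have V: "finite V"
    unfolding V_def using finite_gcoeff[of x] gcoeff_infinite[of _ x] by (intro finite_Union) auto
  have *: "S \<subseteq> V \<and> k \<le> card S" if "gcoeff (x ^ k) S \<noteq> 0" for k S
    using that
  proof (induction k arbitrary: S)
    case 0
    then show ?case by (auto simp: one_grassmann.rep_eq split: if_splits)
  next
    case (Suc k)
    have fS: "finite S" using Suc.prems gcoeff_infinite by blast
    from Suc.prems obtain R where R: "R \<subseteq> S" "gcoeff x R \<noteq> 0" "gcoeff (x ^ k) (S - R) \<noteq> 0"
      unfolding power_Suc by (rule gcoeff_mult_nonzero)
    from Suc.IH[OF R(3)] have IH: "S - R \<subseteq> V" "k \<le> card (S - R)" by auto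
    have "R \<noteq> {}" using R(2) assms by (auto simp: gbody_def)
    then have "card R > 0" using R(1) fS by (meson card_gt_0_iff finite_subset)
    moreover have "card S = card R + card (S - R)"
      using R(1) fS by (metis card_Diff_subset card_mono finite_subset le_add_diff_inverse)
    moreover have "R \<subseteq> V" using R(2) by (auto simp: V_def)
    ultimately show ?case using IH by auto
  qed
  have "x ^ Suc (card V) = 0"
  proof (rule grassmann_eqI, rule ccontr)
    fix S assume "gcoeff (x ^ Suc (card V)) S \<noteq> gcoeff 0 S"
    then have "gcoeff (x ^ Suc (card V)) S \<noteq> 0" by (simp add: zero_grassmann.rep_eq)
    from *[OF this] V show False using card_mono[of V S] by auto
  qed
  then show ?thesis using that by blast
qed

text \<open>Division by the body gives 1 minus a nilpotent element \<open>\<nu>\<close>, which a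
  finite geometric series inverts.\<close>

lemma geven_unit:
  fixes x :: "'a::field geven"
  assumes "gbody (of_geven x) \<noteq> 0"
  obtains y where "x * y = 1"
proof -
  define c where "c = gbody (of_geven x)"
  define d where "d = to_geven (gconst (1 / c))"
  have d: "of_geven d = gconst (1 / c)" unfolding d_def by (rule of_geven_to_geven) simp
  define \<nu> where "\<nu> = 1 - d * x"
  have "gbody (gconst (1 / c)) = 1 / c" by (simp add: gbody_def gconst.rep_eq)
  then have "gbody (of_geven (d * x)) = 1" using assms by (simp add: d c_def)
  then have "gbody (of_geven \<nu>) = 0" by (simp add: \<nu>_def)
  from gbody_zero_nilpotent[OF this] obtain k where "of_geven \<nu> ^ k = 0" .
  then have "\<nu> ^ k = 0" by (metis of_geven_hom(1) of_geven_inject of_geven_power)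
  then have "(1 - \<nu>) * (\<Sum>i<k. \<nu> ^ i) = 1"
    using one_diff_power_eq[of \<nu> k] by simp
  moreover have "1 - \<nu> = x * d" by (simp add: \<nu>_def mult.commute)
  ultimately have "x * (d * (\<Sum>i<k. \<nu> ^ i)) = 1" by (simp add: mult.assoc)
  then show ?thesis using that by blast
qed

section \<open>Generators as independent test values\<close>

lift_definition gen :: "nat \<Rightarrow> 'a::comm_ring_1 grassmann" is "\<lambda>s S. if S = {s} then 1 else 0"
  by (auto split: if_splits)

lemma gparity_gen: "gparity True (gen s)"
  by (simp add: gparity_def gen.rep_eq)

definition avoids :: "nat \<Rightarrow> 'a::comm_ring_1 grassmann \<Rightarrow> bool" where
  "avoids s x \<longleftrightarrow> (\<forall>S. gcoeff x S \<noteq> 0 \<longrightarrow> s \<notin> S)"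

text \<open>Counterpart of \<open>avoids\<close>: a coefficient at a monomial that involves
  \<open>s\<close> cannot come from an element that avoids \<open>s\<close>. The element 0 satisfies
  both conditions.\<close>

definition contains :: "nat \<Rightarrow> 'a::comm_ring_1 grassmann \<Rightarrow> bool" where
  "contains s x \<longleftrightarrow> (\<forall>S. gcoeff x S \<noteq> 0 \<longrightarrow> s \<in> S)"

lemma avoids_0 [simp]: "avoids s 0" and avoids_1 [simp]: "avoids s 1"
  and avoids_gen [simp]: "s \<noteq> t \<Longrightarrow> avoids s (gen t)"
  by (auto simp: avoids_def zero_grassmann.rep_eq one_grassmann.rep_eq gen.rep_eq)

lemma avoids_mult: "avoids s x \<Longrightarrow> avoids s y \<Longrightarrow> avoids s (x * y)"
  unfolding avoids_def by (metis DiffI gcoeff_mult_nonzero)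

lemma avoids_add: "avoids s x \<Longrightarrow> avoids s y \<Longrightarrow> avoids s (x + y)"
  unfolding avoids_def by (metis add_0 plus_grassmann.rep_eq)

lemma avoids_uminus: "avoids s x \<Longrightarrow> avoids s (- x)"
  by (simp add: avoids_def uminus_grassmann.rep_eq)

lemma avoids_sum: "(\<And>i. i \<in> I \<Longrightarrow> avoids s (f i)) \<Longrightarrow> avoids s (sum f I)"
  by (induction I rule: infinite_finite_induct) (auto intro: avoids_add)

lemma avoids_prod_list: "(\<And>x. x \<in> set xs \<Longrightarrow> avoids s x) \<Longrightarrow> avoids s (prod_list xs)"
  by (induction xs) (auto intro: avoids_mult)

lemma contains_gen: "contains s (gen s)"
  by (simp add: contains_def gen.rep_eq)

lemma contains_mult: "contains s x \<or> contains s y \<Longrightarrow> contains s (x * y)"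
  unfolding contains_def by (metis Diff_iff gcoeff_mult_nonzero subset_iff)

lemma contains_prod_list: "x \<in> set xs \<Longrightarrow> contains s x \<Longrightarrow> contains s (prod_list xs)"
  by (induction xs) (auto intro: contains_mult)

text \<open>For \<open>S\<close> without \<open>s\<close>, the coefficient of
  \<open>gen s * a\<close> at \<open>insert s S\<close> is, up to sign, that of \<open>a\<close> at
  \<open>S\<close>: only one splitting of the set has \<open>{s}\<close> as its left part.\<close>

lemma gen_mult_eq_0:
  fixes a :: "'a::comm_ring_1 grassmann"
  assumes "gen s * a = 0" "avoids s a"
  shows "a = 0"
proof (rule grassmann_eqI)
  fix S
  show "gcoeff a S = gcoeff 0 S"
  proof (cases "s \<in> S \<or> infinite S")
    case True
    then show ?thesis
      using assms(2) gcoeff_infinite by (auto simp: avoids_def zero_grassmann.rep_eq)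
  next
    case False
    have "0 = gcoeff (gen s * a) (insert s S)" using assms(1) by (simp add: zero_grassmann.rep_eq)
    also have "\<dots> = (\<Sum>R\<in>Pow (insert s S). if R = {s} then gsign {s} S * gcoeff a S else 0)"
      unfolding times_grassmann.rep_eq using False by (intro sum.cong) (auto simp: gen.rep_eq)
    also have "\<dots> = gsign {s} S * gcoeff a S" using False by simp
    finally have "gsign {s} S * (gsign {s} S * gcoeff a S) = 0" by simp
    then show ?thesis
      by (simp add: gsign_def zero_grassmann.rep_eq flip: mult.assoc power_add mult_2)
  qed
qed

lemma finite_not_avoids: "\<exists>N. \<forall>s\<ge>N. avoids s x"
proof -
  have "finite (\<Union> {S. gcoeff x S \<noteq> 0})"
    using finite_gcoeff[of x] gcoeff_infinite[of _ x] by (intro finite_Union) auto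
  then obtain N where N: "\<And>s. s \<in> \<Union> {S. gcoeff x S \<noteq> 0} \<Longrightarrow> s < N"
    by (metis finite_nat_set_iff_bounded)
  have "avoids s x" if "N \<le> s" for s
    unfolding avoids_def using N[of s] that by (meson UnionI mem_Collect_eq not_less)
  then show ?thesis by blast
qed

text \<open>The infinity of the set of generators enters here: finitely many elements leave all
  generators from some index on untouched.\<close>

lemma fresh_generators:
  assumes "finite I"
  obtains N where "\<And>i s. i \<in> I \<Longrightarrow> N \<le> s \<Longrightarrow> avoids s (f i)"
proof -
  have "\<exists>N. \<forall>i. \<forall>s\<ge>N i. avoids s (f i)" using finite_not_avoids by (intro choice allI)
  then obtain N where N: "\<forall>s\<ge>N i. avoids s (f i)" for i by blast
  show ?thesis
  proof (rule that[of "\<Sum>i\<in>I. N i"])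
    fix i s assume "i \<in> I" "(\<Sum>i\<in>I. N i) \<le> s"
    moreover have "N i \<le> (\<Sum>i\<in>I. N i)" using assms \<open>i \<in> I\<close> by (intro member_le_sum) auto
    ultimately show "avoids s (f i)" using N by auto
  qed
qed

text \<open>The factors are cancelled from the left. Each \<open>\<eta> c\<close> has private
  generators \<open>X c\<close>, involved neither in the other factors nor in \<open>a\<close>, so
  everything to its right avoids them. In the applications \<open>\<eta> c\<close> is a generator, a
  product of two generators, or 1.\<close>

lemma prod_gens_mult_eq_0:
  assumes cancel: "\<And>c a. c \<in> set cs \<Longrightarrow> (\<And>s. s \<in> X c \<Longrightarrow> avoids s a) \<Longrightarrow> \<eta> c * a = 0 \<Longrightarrow> a = 0"
    and av: "\<And>c d s. c \<in> set cs \<Longrightarrow> d \<in> set cs \<Longrightarrow> c \<noteq> d \<Longrightarrow> s \<in> X c \<Longrightarrow> avoids s (\<eta> d)"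
    and a: "\<And>c s. c \<in> set cs \<Longrightarrow> s \<in> X c \<Longrightarrow> avoids s a"
    and "distinct cs" "prod_list (map \<eta> cs) * a = 0"
  shows "a = 0"
  using assms
proof (induction cs)
  case (Cons c cs)
  have av: "avoids s (prod_list (map \<eta> cs) * a)" if s: "s \<in> X c" for s
  proof (intro avoids_mult avoids_prod_list)
    fix x assume "x \<in> set (map \<eta> cs)"
    then obtain d where "d \<in> set cs" "x = \<eta> d" by auto
    with Cons.prems(4) s show "avoids s x" by (auto intro!: Cons.prems(2)[of c d])
  qed (use s in \<open>auto intro!: Cons.prems(3)[of c]\<close>)
  have 0: "\<eta> c * (prod_list (map \<eta> cs) * a) = 0" using Cons.prems(5) by (simp add: mult.assoc)
  have "prod_list (map \<eta> cs) * a = 0"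
    by (rule Cons.prems(1)[of c, OF _ av 0]) auto
  with Cons.prems(4) show ?case
    by (rule_tac Cons.IH) (auto intro: Cons.prems(2,3) Cons.prems(1)[rotated 2])
qed simp

section \<open>Products of homogeneous elements\<close>

lemma gparity_prod_list:
  "(\<And>x. x \<in> set xs \<Longrightarrow> gparity (p x) (z x)) \<Longrightarrow>
    gparity (odd (length (filter p xs))) (prod_list (map z xs))"
proof (induction xs)
  case (Cons x xs)
  then have "gparity (p x \<noteq> odd (length (filter p xs))) (z x * prod_list (map z xs))"
    by (intro gparity_mult) auto
  then show ?case by (cases "p x") auto
qed simp

text \<open>Counts the inversions among odd entries in the way insertion sort meets them, which is
  the recursion behind \<open>prod_list_sort\<close>; \<open>odd_inversions_card\<close> turns the
  count into the exponent of a Koszul sign.\<close>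

fun odd_inversions :: "(nat \<Rightarrow> bool) \<Rightarrow> nat list \<Rightarrow> nat" where
  "odd_inversions p [] = 0"
| "odd_inversions p (x # xs) =
     (if p x then length (filter (\<lambda>y. p y \<and> y < x) xs) else 0) + odd_inversions p xs"

lemma odd_inversions_card:
  "odd_inversions p xs = card {(a, b). a < b \<and> b < length xs \<and> xs ! b < xs ! a \<and> p (xs ! a) \<and> p (xs ! b)}"
proof (induction xs)
  case (Cons x xs)
  let ?S = "\<lambda>xs. {(a, b). a < b \<and> b < length xs \<and> xs ! b < xs ! a \<and> p (xs ! a) \<and> p (xs ! b)}"
  let ?J = "if p x then {b. b < length xs \<and> p (xs ! b) \<and> xs ! b < x} else {}"
  have "?S (x # xs) = (\<lambda>b. (0, Suc b)) ` ?J \<union> (\<lambda>(a, b). (Suc a, Suc b)) ` ?S xs" (is "_ = ?A \<union> ?B")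
  proof (rule Set.set_eqI)
    fix z :: "nat \<times> nat"
    obtain a b where z: "z = (a, b)" by (cases z)
    show "z \<in> ?S (x # xs) \<longleftrightarrow> z \<in> ?A \<union> ?B"
      unfolding z by (cases a; cases b) (auto simp: image_iff)
  qed
  moreover have "finite (?S xs)"
    by (rule finite_subset[of _ "{..<length xs} \<times> {..<length xs}"]) auto
  then have "card (?A \<union> ?B) = card ?A + card ?B"
    by (intro card_Un_disjoint) auto
  moreover have "card ?A = card ?J" by (rule card_image) (auto simp: inj_on_def)
  moreover have "card ?B = card (?S xs)" by (rule card_image) (auto simp: inj_on_def)
  ultimately show ?case by (simp add: Cons.IH length_filter_conv_card)
qed simp

lemma prod_list_insort:
  assumes "\<And>y. y \<in> insert x (set xs) \<Longrightarrow> gparity (p y) (z y)" "sorted xs"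
  shows "z x * prod_list (map z xs) =
    (- 1) ^ (if p x then length (filter (\<lambda>y. p y \<and> y < x) xs) else 0) * prod_list (map z (insort x xs))"
  using assms
proof (induction xs)
  case (Cons y ys)
  show ?case
  proof (cases "x \<le> y")
    case True
    then have "filter (\<lambda>u. p u \<and> u < x) (y # ys) = []" using Cons.prems(2) by (auto simp: filter_empty_conv)
    with True show ?thesis by (simp del: filter.simps)
  next
    case False
    have IH: "z x * prod_list (map z ys) =
      (- 1) ^ (if p x then length (filter (\<lambda>y. p y \<and> y < x) ys) else 0) * prod_list (map z (insort x ys))"
      using Cons.prems by (intro Cons.IH) auto
    have "z x * z y = (if p x \<and> p y then - (z y * z x) else z y * z x)"
      using supercommute[of "p y" "z y" "p x" "z x"] Cons.prems(1) by auto
    then have "z x * prod_list (map z (y # ys)) =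
        (if p x \<and> p y then - 1 else 1) * (z y * (z x * prod_list (map z ys)))"
      by (simp flip: mult.assoc)
    also have "\<dots> = (if p x \<and> p y then - 1 else 1)
        * ((- 1) ^ (if p x then length (filter (\<lambda>y. p y \<and> y < x) ys) else 0) * prod_list (map z (insort x (y # ys))))"
      unfolding IH using False by (simp add: minus_one_power_iff)
    finally have *: "z x * prod_list (map z (y # ys)) = \<dots>" .
    from False have "y < x" "(x \<le> y) = False" by auto
    then show ?thesis unfolding * by (simp add: minus_one_power_iff)
  qed
qed simp

lemma prod_list_sort:
  assumes "\<And>y. y \<in> set xs \<Longrightarrow> gparity (p y) (z y)"
  shows "prod_list (map z xs) = (- 1) ^ odd_inversions p xs * prod_list (map z (sort xs))"
  using assms
proof (induction xs)
  case (Cons x xs)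
  have "length (filter P (sort xs)) = length (filter P xs)" for P
    by (metis mset_filter mset_sort size_mset)
  then have "z x * prod_list (map z (sort xs)) = (- 1) ^ (if p x then length (filter (\<lambda>y. p y \<and> y < x) xs) else 0)
      * prod_list (map z (sort (x # xs)))"
    using prod_list_insort[of x "sort xs" p z] Cons.prems by simp
  moreover have "prod_list (map z xs) = (- 1) ^ odd_inversions p xs * prod_list (map z (sort xs))"
    using Cons by auto
  ultimately show ?case by (simp add: power_add minus_one_power_iff)
qed simp

text \<open>Each of the two odd factors passes the segment between them once, with the same sign.
  These signs cancel, and only the exchange of the two factors remains.\<close>

lemma prod_list_transpose:
  assumes z: "\<And>c. c < l \<Longrightarrow> gparity (p c) (z c)" and ab: "a < b" "b < l" "p a" "p b"
  shows "prod_list (map (\<lambda>c. z (Transposition.transpose a b c)) [0..<l]) = - prod_list (map z [0..<l])"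
proof -
  have l: "[0..<l] = [0..<a] @ a # [Suc a..<b] @ b # [Suc b..<l]"
    using ab upt_add_eq_append[of 0 a "l - a"] upt_add_eq_append[of "Suc a" b "l - b"]
    by (simp add: upt_conv_Cons[of a] upt_conv_Cons[of b])
  let ?M = "prod_list (map z [Suc a..<b])"
  obtain q where q: "gparity q ?M" using gparity_prod_list[of "[Suc a..<b]" p z] z ab by auto
  have "z b * ?M * z a = (if q then - 1 else 1) * (?M * z b * z a)"
    using supercommute[OF q, of "p b" "z b"] z[of b] ab by simp
  also have "z a * z b = - (z b * z a)"
    using supercommute[of True "z b" True "z a"] z[of a] z[of b] ab by simp
  then have "?M * z b * z a = - (?M * z a * z b)" by (simp add: mult.assoc)
  also have "(if q then - 1 else 1) * - (?M * z a * z b) = - (z a * ?M * z b)"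
    using supercommute[OF q, of "p a" "z a"] z[of a] ab by (simp add: mult.assoc)
  finally have "z b * (?M * z a) = - (z a * (?M * z b))" by (simp add: mult.assoc)
  from arg_cong[OF this, of "\<lambda>x. x * _"]
  have "z b * (?M * (z a * r)) = - (z a * (?M * (z b * r)))" for r
    by (simp add: mult.assoc)
  moreover have "map (\<lambda>c. z (Transposition.transpose a b c)) [0..<a] = map z [0..<a]"
    "map (\<lambda>c. z (Transposition.transpose a b c)) [Suc a..<b] = map z [Suc a..<b]"
    "map (\<lambda>c. z (Transposition.transpose a b c)) [Suc b..<l] = map z [Suc b..<l]"
    using ab by (auto simp: transpose_def)
  ultimately show ?thesis unfolding l map_append list.map by (simp add: mult.assoc del: map_eq_conv)
qed

lemma prod_list_permute_odd:
  fixes z :: "nat \<Rightarrow> 'a::comm_ring_1 grassmann"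
  assumes \<pi>: "\<pi> permutes Q" and Q: "Q \<subseteq> {c. c < l \<and> p c}"
    and z: "\<And>c. c < l \<Longrightarrow> gparity (p c) (z c)"
  shows "prod_list (map (\<lambda>c. z (\<pi> c)) [0..<l]) = of_int (sign \<pi>) * prod_list (map z [0..<l])"
proof -
  have fin: "finite Q" by (rule finite_subset[OF Q]) simp
  \<comment> \<open>Quantified over \<open>z\<close>, because the step for a transposition applies
    the induction hypothesis to the family composed with it.\<close>
  have "\<forall>z :: nat \<Rightarrow> 'a grassmann. (\<forall>c<l. gparity (p c) (z c)) \<longrightarrow>
      prod_list (map (\<lambda>c. z (\<pi> c)) [0..<l]) = of_int (sign \<pi>) * prod_list (map z [0..<l])"
    using \<pi> fin
  proof (induction rule: permutes_induct)
    case (swap a b \<pi>)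
    show ?case
    proof (intro allI impI)
      fix z :: "nat \<Rightarrow> 'a grassmann" assume z: "\<forall>c<l. gparity (p c) (z c)"
      have ab: "a < l" "b < l" "p a" "p b" using Q swap by auto
      let ?z = "\<lambda>c. z (Transposition.transpose a b c)"
      have "\<forall>c<l. gparity (p c) (?z c)" using z ab by (auto simp: transpose_def)
      then have "prod_list (map (\<lambda>c. ?z (\<pi> c)) [0..<l]) = of_int (sign \<pi>) * prod_list (map ?z [0..<l])"
        using spec[OF swap.IH, of ?z] by simp
      moreover have "prod_list (map ?z [0..<l]) = - prod_list (map z [0..<l])"
        using prod_list_transpose[of l p z a b] prod_list_transpose[of l p z b a] z ab \<open>a \<noteq> b\<close>
        by (cases "a < b") (auto simp: transpose_commute[of b a])
      moreover have "sign (Transposition.transpose a b \<circ> \<pi>) = - sign \<pi>"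
      proof -
        have "permutation \<pi>" using \<open>\<pi> permutes Q\<close> fin permutation_permutes by blast
        then show ?thesis
          using \<open>a \<noteq> b\<close> by (simp add: sign_compose[OF permutation_swap_id] sign_swap_id)
      qed
      ultimately show "prod_list (map (\<lambda>c. z ((Transposition.transpose a b \<circ> \<pi>) c)) [0..<l])
          = of_int (sign (Transposition.transpose a b \<circ> \<pi>)) * prod_list (map z [0..<l])"
        by simp
    qed
  qed (simp add: sign_id)
  with z show ?thesis by blast
qed

text \<open>Distributivity without commutativity: the factors stay in the order of
  \<open>cs\<close>.\<close>

lemma prod_list_sum_PiE:
  fixes f :: "'b \<Rightarrow> 'c \<Rightarrow> 'a::semiring_1"
  assumes "distinct cs" "finite D"
  shows "prod_list (map (\<lambda>c. \<Sum>d\<in>D. f c d) cs) =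
    (\<Sum>\<rho>\<in>set cs \<rightarrow>\<^sub>E D. prod_list (map (\<lambda>c. f c (\<rho> c)) cs))"
  using assms(1)
proof (induction cs)
  case (Cons c cs)
  have "(\<Sum>\<rho>\<in>set (c # cs) \<rightarrow>\<^sub>E D. prod_list (map (\<lambda>c. f c (\<rho> c)) (c # cs)))
      = (\<Sum>\<rho>\<in>(\<lambda>(d, \<rho>). \<rho>(c := d)) ` (D \<times> (set cs \<rightarrow>\<^sub>E D)). prod_list (map (\<lambda>c. f c (\<rho> c)) (c # cs)))"
    by (simp only: list.set PiE_insert_eq)
  also have "\<dots> = (\<Sum>(d, \<rho>)\<in>D \<times> (set cs \<rightarrow>\<^sub>E D). f c d * prod_list (map (\<lambda>c. f c (\<rho> c)) cs))"
  proof (subst sum.reindex)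
    show "inj_on (\<lambda>(d, \<rho>). \<rho>(c := d)) (D \<times> (set cs \<rightarrow>\<^sub>E D))"
      using Cons.prems by (intro inj_combinator) simp
    have "(\<Prod>x\<leftarrow>cs. f x (if x = c then d else \<rho> x)) = (\<Prod>x\<leftarrow>cs. f x (\<rho> x))" for \<rho> d
      using Cons.prems by (intro arg_cong[of _ _ prod_list] map_cong) auto
    then show "sum ((\<lambda>\<rho>. prod_list (map (\<lambda>c. f c (\<rho> c)) (c # cs))) \<circ> (\<lambda>(d, \<rho>). \<rho>(c := d))) (D \<times> (set cs \<rightarrow>\<^sub>E D))
        = (\<Sum>(d, \<rho>)\<in>D \<times> (set cs \<rightarrow>\<^sub>E D). f c d * prod_list (map (\<lambda>c. f c (\<rho> c)) cs))"
      by (intro sum.cong) auto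
  qed
  also have "\<dots> = prod_list (map (\<lambda>c. \<Sum>d\<in>D. f c d) (c # cs))"
    using Cons by (simp add: sum_product sum.cartesian_product)
  finally show ?case by simp
qed simp

lemma prod_list_eq_0: "0 \<in> set xs \<Longrightarrow> prod_list xs = (0 :: 'a::semiring_1)"
  by (induction xs) auto

lemma prod_list_mult_of_geven:
  "distinct cs \<Longrightarrow> prod_list (map (\<lambda>c. a c * of_geven (b c)) cs)
    = of_geven (\<Prod>c\<in>set cs. b c) * prod_list (map a cs)"
proof (induction cs)
  case (Cons c cs)
  have comm: "a c * (of_geven u * x) = of_geven u * (a c * x)" for u x
    by (simp only: of_geven_commute[of u "a c"] flip: mult.assoc)
  from Cons have "prod_list (map (\<lambda>c. a c * of_geven (b c)) (c # cs))
      = a c * of_geven (b c) * (of_geven (\<Prod>c\<in>set cs. b c) * prod_list (map a cs))" by simp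
  also have "\<dots> = of_geven (b c * (\<Prod>c\<in>set cs. b c)) * (a c * prod_list (map a cs))"
    by (simp add: comm mult.assoc)
  finally show ?case using Cons.prems by simp
qed simp

section \<open>Evaluation of tensors\<close>

definition evw :: "(nat \<Rightarrow> nat \<Rightarrow> 'a::comm_ring_1 grassmann) \<Rightarrow> nat list \<Rightarrow> 'a grassmann" where
  "evw y w = prod_list (map (\<lambda>c. y (w ! c) c) [0..<length w])"

definition ev :: "(nat \<Rightarrow> nat \<Rightarrow> 'a::comm_ring_1 grassmann) \<Rightarrow> 'a tensor \<Rightarrow> 'a grassmann" where
  "ev y t = (\<Sum>w\<in>Poly_Mapping.keys t. evw y w * Poly_Mapping.lookup t w)"

definition point :: "nat \<Rightarrow> (nat \<Rightarrow> nat \<Rightarrow> 'a::comm_ring_1 grassmann) \<Rightarrow> bool" where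
  "point m y \<longleftrightarrow> (\<forall>v c. gparity (m \<le> v) (y v c))"

lemma ev_superset:
  assumes "finite X" "Poly_Mapping.keys t \<subseteq> X"
  shows "ev y t = (\<Sum>w\<in>X. evw y w * Poly_Mapping.lookup t w)"
  unfolding ev_def using assms by (intro sum.mono_neutral_left) (auto simp: in_keys_iff)

lemma ev_0 [simp]: "ev y 0 = 0"
  by (simp add: ev_def)

lemma ev_add: "ev y (s + t) = ev y s + ev y t"
proof -
  let ?X = "Poly_Mapping.keys s \<union> Poly_Mapping.keys t"
  have "Poly_Mapping.keys (s + t) \<subseteq> ?X" by (rule Poly_Mapping.keys_add)
  then have "ev y (s + t) = (\<Sum>w\<in>?X. evw y w * Poly_Mapping.lookup (s + t) w)" by (intro ev_superset) auto
  also have "\<dots> = ev y s + ev y t"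
    by (simp add: ev_superset[of ?X s] ev_superset[of ?X t] lookup_add distrib_left sum.distrib)
  finally show ?thesis .
qed

lemma ev_sum: "ev y (sum f I) = (\<Sum>i\<in>I. ev y (f i))"
  by (induction I rule: infinite_finite_induct) (auto simp: ev_add)

lemma ev_single: "ev y (Poly_Mapping.single w a) = evw y w * a"
  by (subst ev_superset[of "{w}"]) (auto simp: lookup_single)

lemma lookup_rscale: "Poly_Mapping.lookup (rscale t a) w = Poly_Mapping.lookup t w * a"
  by (simp add: rscale_def Poly_Mapping.map.rep_eq when_def)

lemma keys_rscale: "Poly_Mapping.keys (rscale t a) \<subseteq> Poly_Mapping.keys t"
  by (auto simp: in_keys_iff lookup_rscale)

lemma ev_rscale: "ev y (rscale t a) = ev y t * a"
  by (subst ev_superset[of "Poly_Mapping.keys t"])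
    (auto simp: keys_rscale ev_def lookup_rscale sum_distrib_right mult.assoc)

lemma ev_diff: "ev y (s - t) = ev y s - ev y t"
  using ev_add[of y "s - t" t] by simp

lemma ev_rlinear_ext:
  "ev y (rlinear_ext F t) = (\<Sum>w\<in>Poly_Mapping.keys t. ev y (F w) * Poly_Mapping.lookup t w)"
  by (simp add: rlinear_ext_def ev_sum ev_rscale)

lemma evw_cong: "(\<And>c. c < length w \<Longrightarrow> y (w ! c) c = y' (w ! c) c) \<Longrightarrow> evw y w = evw y' w"
  unfolding evw_def by (rule arg_cong[of _ _ prod_list]) auto

lemma ev_cong:
  assumes "\<And>w c. w \<in> Poly_Mapping.keys t \<Longrightarrow> c < length w \<Longrightarrow> y (w ! c) c = y' (w ! c) c"
  shows "ev y t = ev y' t"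
  unfolding ev_def using assms by (intro sum.cong refl arg_cong2[of _ _ _ _ times] evw_cong) auto

lemma evw_Cons: "evw y (i # w) = y i 0 * evw (\<lambda>v c. y v (Suc c)) w"
  unfolding evw_def by (simp add: upt_conv_Cons map_Suc_upt[symmetric] comp_def del: upt_Suc)

lemma gparity_evw:
  assumes "point m y"
  shows "gparity (odd (nodd m w)) (evw y w)"
proof -
  have "length (filter (\<lambda>c. m \<le> w ! c) [0..<length w]) = nodd m w"
    unfolding nodd_def by (metis (no_types) filter_map length_map map_nth comp_apply filter_cong)
  then show ?thesis
    unfolding evw_def using gparity_prod_list[of "[0..<length w]" "\<lambda>c. m \<le> w ! c" "\<lambda>c. y (w ! c) c"] assms
    by (simp add: point_def)
qed

lemma gbar_gbar [simp]: "gbar (gbar x) = x"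
  by (rule grassmann_eqI) (simp add: gbar.rep_eq flip: mult.assoc power_add mult_2)

lemma gbar_funpow: "(gbar ^^ k) x = (if odd k then gbar x else x)"
  by (induction k) auto

text \<open>\<open>vec_tensor\<close> moves a coefficient to the right across the word
  \<open>w\<close>, which twists it once per odd letter. The value of \<open>w\<close> has the
  parity of \<open>w\<close>, so moving the coefficient back to the left across this value undoes
  the twist.\<close>

lemma ev_vec_tensor:
  assumes "point m y"
  shows "ev y (vec_tensor m v t) = (\<Sum>i<dim_vec v. y i 0 * v $ i) * ev (\<lambda>v c. y v (Suc c)) t"
proof -
  let ?y = "\<lambda>v c. y v (Suc c)"
  have "point m ?y" using assms by (simp add: point_def)
  then have "evw ?y w * (gbar ^^ nodd m w) (v $ i) = v $ i * evw ?y w" for w i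
    using mult_commute_gbar[OF gparity_evw, of m ?y "v $ i" w] by (simp add: gbar_funpow)
  from arg_cong[OF this, of "\<lambda>x. y _ 0 * x * _"] have "evw y (i # w) * ((gbar ^^ nodd m w) (v $ i) * Poly_Mapping.lookup t w)
      = y i 0 * v $ i * (evw ?y w * Poly_Mapping.lookup t w)" for i w
    by (simp only: evw_Cons mult.assoc)
  then have "ev y (vec_tensor m v t) =
      (\<Sum>i<dim_vec v. \<Sum>w\<in>Poly_Mapping.keys t. y i 0 * v $ i * (evw ?y w * Poly_Mapping.lookup t w))"
    by (simp add: vec_tensor_def ev_sum ev_single)
  then show ?thesis by (simp add: ev_def sum_product)
qed

lemma ev_pure_tensor:
  "point m y \<Longrightarrow> ev y (pure_tensor m vs) =
    prod_list (map (\<lambda>c. \<Sum>i<dim_vec (vs ! c). y i c * vs ! c $ i) [0..<length vs])"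
proof (induction vs arbitrary: y)
  case Nil
  then show ?case by (simp add: ev_single evw_def)
next
  case (Cons v vs)
  then have "point m (\<lambda>v c. y v (Suc c))" by (simp add: point_def)
  from Cons.IH[OF this] Cons.prems show ?case
    by (simp add: ev_vec_tensor upt_conv_Cons map_Suc_upt[symmetric] comp_def del: upt_Suc)
qed

text \<open>The pullback of a point: each letter receives the value of its image under the matrix.
  Only the letter argument is affected, not the position.\<close>

definition transform :: "nat \<Rightarrow> (nat \<Rightarrow> nat \<Rightarrow> 'a::comm_ring_1 grassmann) \<Rightarrow> 'a grassmann mat
    \<Rightarrow> nat \<Rightarrow> nat \<Rightarrow> 'a grassmann" where
  "transform d y A j c = (if j < d then \<Sum>i<d. y i c * A $$ (i, j) else 0)"

lemma tensor_power_keys: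
  "t \<in> tensor_power m n l \<Longrightarrow> w \<in> Poly_Mapping.keys t \<Longrightarrow> length w = l \<and> (\<forall>c<l. w ! c < m + n)"
  unfolding tensor_power_def using nth_mem by fastforce

lemma ev_gl_act:
  assumes y: "point m y" and t: "t \<in> tensor_power m n l"
    and F: "\<And>j. j < m + n \<Longrightarrow> F (unit_vec (m + n) j) \<in> carrier_vec (m + n)"
  shows "ev y (gl_act m n F t) = ev (transform (m + n) y (matrix_of (m + n) F)) t"
proof -
  have "ev y (pure_tensor m (map (\<lambda>j. F (unit_vec (m + n) j)) w)) = evw (transform (m + n) y (matrix_of (m + n) F)) w"
    if "w \<in> Poly_Mapping.keys t" for w
    unfolding ev_pure_tensor[OF y] evw_def
  proof (intro arg_cong[of _ _ prod_list] map_cong)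
    fix c assume "c \<in> set [0..<length w]"
    then have c: "c < length w" "w ! c < m + n" using tensor_power_keys[OF t that] by auto
    then have "dim_vec (F (unit_vec (m + n) (w ! c))) = m + n" using F by auto
    with c show "(\<Sum>i<dim_vec (map (\<lambda>j. F (unit_vec (m + n) j)) w ! c). y i c * map (\<lambda>j. F (unit_vec (m + n) j)) w ! c $ i)
        = transform (m + n) y (matrix_of (m + n) F) (w ! c) c"
      by (simp add: transform_def matrix_of_def)
  qed simp
  then show ?thesis unfolding gl_act_def ev_rlinear_ext by (simp add: ev_def)
qed

text \<open>The factors of the value of the permuted word are listed by the positions
  \<open>?xs\<close>. Sorting them yields the factors on the right-hand side and a sign for each odd
  inversion; these inversions are the pairs counted by \<open>koszul_sign\<close>, so the two signs
  cancel.\<close>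

lemma evw_permute:
  assumes y: "point m y" and \<sigma>: "\<sigma> permutes {..<length w}"
  shows "evw y (permute_list (Hilbert_Choice.inv \<sigma>) w) * koszul_sign m \<sigma> w = evw (\<lambda>v c. y v (\<sigma> c)) w"
proof -
  let ?l = "length w" and ?i = "Hilbert_Choice.inv \<sigma>"
  let ?xs = "map ?i [0..<?l]" and ?p = "\<lambda>c. m \<le> w ! c" and ?z = "\<lambda>c. y (w ! c) (\<sigma> c)"
  have inv: "\<sigma> (?i c) = c" "?i (\<sigma> c) = c" for c using permutes_inverses[OF \<sigma>] by auto
  have iper: "?i permutes {..<?l}" by (rule permutes_inv[OF \<sigma>])
  have lt: "\<sigma> c < ?l" "?i c < ?l" if "c < ?l" for c
    using permutes_in_image[OF \<sigma>] permutes_in_image[OF iper] that by auto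
  have "inj_on ?i {0..<?l}" using permutes_inj[OF iper] by (rule inj_on_subset) simp
  then have "distinct ?xs" by (simp add: distinct_map)
  moreover have "set ?xs = {0..<?l}" using permutes_image[OF iper] by (simp add: atLeast0LessThan)
  ultimately have sort: "sort ?xs = [0..<?l]"
    using set_eq_iff_mset_eq_distinct[of ?xs "[0..<?l]"] by (intro properties_for_sort) auto
  have "odd_inversions ?p ?xs = card {(i, j). i < j \<and> j < ?l \<and> \<sigma> i > \<sigma> j \<and> m \<le> w ! i \<and> m \<le> w ! j}"
    unfolding odd_inversions_card
  proof (rule bij_betw_same_card[of "\<lambda>(a, b). (?i b, ?i a)"],
      rule bij_betw_byWitness[of _ "\<lambda>(i, j). (\<sigma> j, \<sigma> i)"])
  qed (use lt in \<open>auto simp: inv dest: less_trans\<close>)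
  then have k: "koszul_sign m \<sigma> w = (- 1) ^ odd_inversions ?p ?xs"
    by (simp add: koszul_sign_def)
  have "evw y (permute_list ?i w) = prod_list (map ?z ?xs)"
    unfolding evw_def by (rule arg_cong[of _ _ prod_list]) (simp add: permute_list_def inv)
  also have "\<dots> = (- 1) ^ odd_inversions ?p ?xs * prod_list (map ?z (sort ?xs))"
    using y by (intro prod_list_sort) (simp add: point_def)
  finally show ?thesis unfolding sort k by (simp add: evw_def minus_one_power_iff)
qed

lemma ev_sym_act:
  assumes y: "point m y" and \<sigma>: "\<sigma> permutes {..<l}"
    and t: "\<And>w. w \<in> Poly_Mapping.keys t \<Longrightarrow> length w = l"
  shows "ev y (sym_act m \<sigma> t) = ev (\<lambda>v c. y v (\<sigma> c)) t"
  unfolding sym_act_def ev_rlinear_ext unfolding ev_def[of _ t]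
  using t \<sigma> by (intro sum.cong refl) (simp add: ev_single evw_permute[OF y])

text \<open>For a word \<open>u\<close> with nonzero coefficient, the test point vanishes at each
  position on all letters but that of \<open>u\<close>, so \<open>u\<close> alone survives. Its
  value is a product of fresh generators, one for each odd letter, and cannot annihilate the
  coefficient.\<close>

lemma ev_separates:
  fixes t :: "'a::comm_ring_1 tensor"
  assumes t: "\<And>w. w \<in> Poly_Mapping.keys t \<Longrightarrow> length w = l"
    and 0: "\<And>y. point m y \<Longrightarrow> ev y t = 0"
  shows "t = 0"
proof (rule poly_mapping_eqI, rule ccontr)
  fix u assume "Poly_Mapping.lookup t u \<noteq> Poly_Mapping.lookup 0 u"
  then have u: "u \<in> Poly_Mapping.keys t" by (simp add: in_keys_iff)
  obtain N where N: "\<And>i s. i \<in> {u} \<Longrightarrow> N \<le> s \<Longrightarrow> avoids s (Poly_Mapping.lookup t i)"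
    using fresh_generators[of "{u}"] by blast
  define \<eta> :: "nat \<Rightarrow> 'a grassmann" where "\<eta> c = (if m \<le> u ! c then gen (N + c) else 1)" for c
  define y where "y v c = (if v = u ! c then \<eta> c else 0)" for v c
  have "point m y" by (auto simp: point_def y_def \<eta>_def gparity_gen)
  have "evw y w = 0" if "w \<in> Poly_Mapping.keys t - {u}" for w
  proof -
    have "length w = length u" using that u t by auto
    moreover have "w \<noteq> u" using that by simp
    ultimately obtain c where "c < length w" "w ! c \<noteq> u ! c" using nth_equalityI[of w u] by blast
    then show ?thesis unfolding evw_def by (intro prod_list_eq_0) (auto simp: y_def image_iff intro!: bexI[of _ c])
  qed
  then have "ev y t = evw y u * Poly_Mapping.lookup t u"
    unfolding ev_def using u by (simp add: sum.remove[of _ u])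
  moreover have "evw y u = prod_list (map \<eta> [0..<length u])" unfolding evw_def y_def by simp
  ultimately have "prod_list (map \<eta> [0..<length u]) * Poly_Mapping.lookup t u = 0"
    using 0[OF \<open>point m y\<close>] by simp
  then have "Poly_Mapping.lookup t u = 0"
  proof (rule prod_gens_mult_eq_0[of "[0..<length u]" "\<lambda>c. {N + c}" \<eta>, rotated -1])
    fix c a assume "\<And>s. s \<in> {N + c} \<Longrightarrow> avoids s a" "\<eta> c * a = 0"
    then show "a = 0" using gen_mult_eq_0[of "N + c" a] by (simp add: \<eta>_def split: if_splits)
  next
    fix c s assume "s \<in> {N + c}"
    then show "avoids s (Poly_Mapping.lookup t u)" using N[of u s] by simp
  qed (auto simp: \<eta>_def)
  with u show False by (simp add: in_keys_iff)
qed

text \<open>Every position contributes exactly one factor, so the value is additive in each position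
  separately.\<close>

lemma ev_sum_PiE:
  assumes "\<And>w. w \<in> Poly_Mapping.keys t \<Longrightarrow> length w = l" "finite D"
  shows "ev (\<lambda>v c. \<Sum>d\<in>D. P v c d) t = (\<Sum>\<rho>\<in>{..<l} \<rightarrow>\<^sub>E D. ev (\<lambda>v c. P v c (\<rho> c)) t)"
proof -
  have "evw (\<lambda>v c. \<Sum>d\<in>D. P v c d) w = (\<Sum>\<rho>\<in>{..<l} \<rightarrow>\<^sub>E D. evw (\<lambda>v c. P v c (\<rho> c)) w)"
    if "length w = l" for w
    unfolding evw_def using prod_list_sum_PiE[of "[0..<l]" D "\<lambda>c. P (w ! c) c"] assms(2) that
    by (simp add: atLeast0LessThan)
  then show ?thesis
    unfolding ev_def using assms(1) by (simp add: sum_distrib_right) (rule sum.swap)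
qed

lemma ev_mult_of_geven:
  assumes "\<And>w. w \<in> Poly_Mapping.keys t \<Longrightarrow> length w = l"
  shows "ev (\<lambda>v c. y v c * of_geven (b c)) t = of_geven (\<Prod>c<l. b c) * ev y t"
proof -
  have "evw (\<lambda>v c. y v c * of_geven (b c)) w = of_geven (\<Prod>c<l. b c) * evw y w" if "length w = l" for w
    unfolding evw_def using prod_list_mult_of_geven[of "[0..<l]" "\<lambda>c. y (w ! c) c" b] that
    by (simp add: atLeast0LessThan)
  then show ?thesis unfolding ev_def using assms by (simp add: sum_distrib_left mult.assoc)
qed

section \<open>The action of the symmetric group and of \<open>GL V\<close>\<close>

lemma tensor_power_0 [simp]: "0 \<in> tensor_power m n l"
  by (simp add: tensor_power_def)

lemma tensor_power_add: "s \<in> tensor_power m n l \<Longrightarrow> t \<in> tensor_power m n l \<Longrightarrow> s + t \<in> tensor_power m n l"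
  unfolding tensor_power_def using Poly_Mapping.keys_add[of s t] by blast

lemma tensor_power_sum:
  "(\<And>i. i \<in> I \<Longrightarrow> f i \<in> tensor_power m n l) \<Longrightarrow> sum f I \<in> tensor_power m n l"
  by (induction I rule: infinite_finite_induct) (auto intro: tensor_power_add)

lemma tensor_power_rscale: "t \<in> tensor_power m n l \<Longrightarrow> rscale t a \<in> tensor_power m n l"
  unfolding tensor_power_def using keys_rscale[of t a] by blast

lemma tensor_power_single:
  "length w = l \<Longrightarrow> set w \<subseteq> {..<m + n} \<Longrightarrow> Poly_Mapping.single w a \<in> tensor_power m n l"
  by (simp add: tensor_power_def)

lemma tensor_power_rlinear_ext:
  "(\<And>w. w \<in> Poly_Mapping.keys t \<Longrightarrow> F w \<in> tensor_power m n l) \<Longrightarrow> rlinear_ext F t \<in> tensor_power m n l"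
  unfolding rlinear_ext_def by (intro tensor_power_sum tensor_power_rscale)

lemma tensor_power_length:
  "t \<in> tensor_power m n l \<Longrightarrow> w \<in> Poly_Mapping.keys t \<Longrightarrow> length w = l"
  by (simp add: tensor_power_def)

lemma tensor_power_sym_act:
  assumes "t \<in> tensor_power m n l" "\<sigma> permutes {..<l}"
  shows "sym_act m' \<sigma> t \<in> tensor_power m n l"
  unfolding sym_act_def
proof (intro tensor_power_rlinear_ext tensor_power_single)
  fix w assume "w \<in> Poly_Mapping.keys t"
  then have w: "length w = l" "set w \<subseteq> {..<m + n}" using assms(1) by (auto simp: tensor_power_def)
  then show "length (permute_list (Hilbert_Choice.inv \<sigma>) w) = l" by simp
  show "set (permute_list (Hilbert_Choice.inv \<sigma>) w) \<subseteq> {..<m + n}"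
    using set_permute_list[of "Hilbert_Choice.inv \<sigma>" w] permutes_inv[OF assms(2)] w by simp
qed

lemma tensor_power_pure_tensor:
  "(\<And>v. v \<in> set vs \<Longrightarrow> dim_vec v = m + n) \<Longrightarrow> pure_tensor m vs \<in> tensor_power m n (length vs)"
proof (induction vs)
  case Nil
  then show ?case by (simp add: tensor_power_def)
next
  case (Cons v vs)
  then have IH: "pure_tensor m vs \<in> tensor_power m n (length vs)" by simp
  show ?case
    unfolding pure_tensor.simps vec_tensor_def
    using IH Cons.prems by (intro tensor_power_sum tensor_power_single) (auto simp: tensor_power_def)
qed

lemma GL_carrier: "F \<in> GL m n \<Longrightarrow> v \<in> carrier_vec (m + n) \<Longrightarrow> F v \<in> carrier_vec (m + n)"
  by (auto simp: GL_def bij_betw_def)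

lemma GL_vparity:
  "F \<in> GL m n \<Longrightarrow> v \<in> carrier_vec (m + n) \<Longrightarrow> vparity m p v \<Longrightarrow> vparity m p (F v)"
  unfolding GL_def by blast

lemma tensor_power_gl_act:
  assumes F: "F \<in> GL m n" and t: "t \<in> tensor_power m n l"
  shows "gl_act m n F t \<in> tensor_power m n l"
  unfolding gl_act_def
proof (rule tensor_power_rlinear_ext)
  fix w assume w: "w \<in> Poly_Mapping.keys t"
  let ?vs = "map (\<lambda>j. F (unit_vec (m + n) j)) w"
  have "pure_tensor m ?vs \<in> tensor_power m n (length ?vs)"
    using GL_carrier[OF F] by (intro tensor_power_pure_tensor) auto
  then show "pure_tensor m ?vs \<in> tensor_power m n l" using tensor_power_length[OF t w] by simp
qed

lemma GL_parity:
  assumes F: "F \<in> GL m n" and ij: "i < m + n" "j < m + n"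
  shows "gparity ((m \<le> i) \<noteq> (m \<le> j)) (matrix_of (m + n) F $$ (i, j))"
proof -
  let ?e = "unit_vec (m + n) j"
  have "vparity m (m \<le> j) ?e" by (auto simp: vparity_def unit_vec_def)
  then have "vparity m (m \<le> j) (F ?e)"
    by (rule GL_vparity[OF F unit_vec_carrier])
  moreover have "dim_vec (F ?e) = m + n" using GL_carrier[OF F, of ?e] by simp
  ultimately have "gparity ((m \<le> j) \<noteq> (m \<le> i)) (F ?e $ i)" using ij by (auto simp: vparity_def)
  then show ?thesis using ij by (simp add: matrix_of_def eq_commute)
qed

lemma point_transform:
  assumes "point m y" "F \<in> GL m n"
  shows "point m (transform (m + n) y (matrix_of (m + n) F))"
proof -
  have "gparity (m \<le> j) (y i c * matrix_of (m + n) F $$ (i, j))" if "i < m + n" "j < m + n" for i j c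
  proof -
    have "gparity (m \<le> i) (y i c)" using assms(1) by (simp add: point_def)
    from gparity_mult[OF this GL_parity[OF assms(2) that]] show ?thesis
      by (cases "m \<le> i"; cases "m \<le> j") auto
  qed
  then show ?thesis by (auto simp: point_def transform_def intro!: gparity_sum)
qed

lemma finite_stabilizers [simp]: "finite (row_stabilizer lam)" "finite (column_stabilizer lam)"
  unfolding row_stabilizer_def column_stabilizer_def
  by (rule finite_subset[OF _ finite_permutations[of "{..<sum_list lam}"]]; auto)+

lemma row_stabilizerD:
  assumes "\<tau> \<in> row_stabilizer lam"
  shows "\<tau> permutes {..<sum_list lam}"
    "c < sum_list lam \<Longrightarrow> fst (boxes lam ! \<tau> c) = fst (boxes lam ! c)"
  using assms by (auto simp: row_stabilizer_def)

lemma column_stabilizerD: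
  assumes "\<sigma> \<in> column_stabilizer lam"
  shows "\<sigma> permutes {..<sum_list lam}"
    "c < sum_list lam \<Longrightarrow> snd (boxes lam ! \<sigma> c) = snd (boxes lam ! c)"
  using assms by (auto simp: column_stabilizer_def)

lemma tensor_power_young_act:
  "t \<in> tensor_power m n (sum_list lam) \<Longrightarrow> young_act m' lam t \<in> tensor_power m n (sum_list lam)"
  unfolding young_act_def
  by (intro tensor_power_sum tensor_power_rscale tensor_power_sym_act)
    (auto dest: row_stabilizerD column_stabilizerD)

lemma ev_young_act:
  assumes y: "point m y" and t: "t \<in> tensor_power m' n (sum_list lam)"
  shows "ev y (young_act m lam t) = (\<Sum>\<sigma>\<in>column_stabilizer lam. \<Sum>\<tau>\<in>row_stabilizer lam.
    ev (\<lambda>v c. y v (\<tau> (\<sigma> c))) t * of_int (sign \<sigma>))"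
proof -
  have "ev y (sym_act m \<tau> (sym_act m \<sigma> t)) = ev (\<lambda>v c. y v (\<tau> (\<sigma> c))) t"
    if "\<sigma> permutes {..<sum_list lam}" "\<tau> permutes {..<sum_list lam}" for \<sigma> \<tau>
  proof -
    have "point m (\<lambda>v c. y v (\<tau> c))" using y by (simp add: point_def)
    from ev_sym_act[OF this that(1) tensor_power_length[OF t]]
      ev_sym_act[OF y that(2) tensor_power_length[OF tensor_power_sym_act[OF t that(1)]]]
    show ?thesis by simp
  qed
  then show ?thesis
    unfolding young_act_def ev_sum ev_rscale
    by (intro sum.cong refl) (simp add: row_stabilizerD(1) column_stabilizerD(1))
qed

lemma tensor_power_diff:
  assumes "s \<in> tensor_power m n l" "t \<in> tensor_power m n l"
  shows "s - t \<in> tensor_power m n l"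
proof -
  have "s - t = s + rscale t (- 1)"
    by (rule poly_mapping_eqI) (simp add: lookup_minus lookup_add lookup_rscale del: add_uminus_conv_diff)
  also have "\<dots> \<in> tensor_power m n l" by (intro tensor_power_add tensor_power_rscale assms)
  finally show ?thesis .
qed

lemma tensor_eqI:
  fixes s t :: "'a::comm_ring_1 tensor"
  assumes "s \<in> tensor_power m' n l" "t \<in> tensor_power m' n l" "\<And>y. point m y \<Longrightarrow> ev y s = ev y t"
  shows "s = t"
proof -
  have "s - t \<in> tensor_power m' n l" by (intro tensor_power_diff assms)
  then have "s - t = 0"
    by (rule ev_separates[OF tensor_power_length, where m = m]) (auto simp: ev_diff assms(3))
  then show ?thesis by simp
qed

text \<open>The group changes the letter argument of a point and the symmetric group its position
  argument; these two substitutions commute.\<close>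

lemma gl_act_young_act:
  assumes F: "F \<in> GL m n" and t: "t \<in> tensor_power m n (sum_list lam)"
  shows "gl_act m n F (young_act m lam t) = young_act m lam (gl_act m n F t)"
proof (rule tensor_eqI[where m = m, of _ m n "sum_list lam"])
  fix y :: "nat \<Rightarrow> nat \<Rightarrow> 'a grassmann" assume y: "point m y"
  let ?A = "matrix_of (m + n) F"
  have ev: "ev y (gl_act m n F s) = ev (transform (m + n) y ?A) s"
    if "point m y" "s \<in> tensor_power m n (sum_list lam)" for y s
    using ev_gl_act[OF that] GL_carrier[OF F] by simp
  have "ev (\<lambda>v c. transform (m + n) y ?A v (\<tau> (\<sigma> c))) t = ev (\<lambda>v c. y v (\<tau> (\<sigma> c))) (gl_act m n F t)"
    for \<sigma> \<tau> :: "nat \<Rightarrow> nat"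
    using ev[of "\<lambda>v c. y v (\<tau> (\<sigma> c))" t] y t by (simp add: point_def transform_def[abs_def])
  then show "ev y (gl_act m n F (young_act m lam t)) = ev y (young_act m lam (gl_act m n F t))"
    unfolding ev[OF y tensor_power_young_act[OF t]] ev_young_act[OF point_transform[OF y F] t]
      ev_young_act[OF y tensor_power_gl_act[OF F t]] by simp
qed (use F t in \<open>simp_all add: tensor_power_young_act tensor_power_gl_act\<close>)

section \<open>Evaluation at row-constant points\<close>

definition rowpt :: "nat list \<Rightarrow> (nat \<Rightarrow> nat \<Rightarrow> 'a) \<Rightarrow> nat \<Rightarrow> nat \<Rightarrow> 'a" where
  "rowpt lam y v c = y v (fst (boxes lam ! c))"

text \<open>For \<open>y\<close> satisfying \<open>point\<close>, this is the value of
  \<open>colsym m lam t\<close> at \<open>rowpt lam y\<close>, written as a function of the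
  point.\<close>

definition colev :: "nat list \<Rightarrow> (nat \<Rightarrow> nat \<Rightarrow> 'a::comm_ring_1 grassmann) \<Rightarrow> 'a tensor \<Rightarrow> 'a grassmann" where
  "colev lam y t = (\<Sum>\<sigma>\<in>column_stabilizer lam. ev (\<lambda>v c. rowpt lam y v (\<sigma> c)) t * of_int (sign \<sigma>))"

definition colsym :: "nat \<Rightarrow> nat list \<Rightarrow> 'a::comm_ring_1 tensor \<Rightarrow> 'a tensor" where
  "colsym m lam t = (\<Sum>\<sigma>\<in>column_stabilizer lam. rscale (sym_act m \<sigma> t) (of_int (sign \<sigma>)))"

lemma point_rowpt: "point m y \<Longrightarrow> point m (rowpt lam y)"
  by (simp add: point_def rowpt_def)

text \<open>In the symmetrizer the row permutations act last, hence on the position argument after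
  \<open>\<sigma>\<close>. There they move a position only within its row, where the point is
  constant, so all of them contribute the same.\<close>

lemma ev_young_act_rowpt:
  assumes y: "point m y" and t: "t \<in> tensor_power m' n (sum_list lam)"
  shows "ev (rowpt lam y) (young_act m lam t) = of_nat (card (row_stabilizer lam)) * colev lam y t"
proof -
  have "ev (\<lambda>v c. rowpt lam y v (\<tau> (\<sigma> c))) t = ev (\<lambda>v c. rowpt lam y v (\<sigma> c)) t"
    if "\<sigma> \<in> column_stabilizer lam" "\<tau> \<in> row_stabilizer lam" for \<sigma> \<tau>
  proof (rule ev_cong)
    fix w v c assume "w \<in> Poly_Mapping.keys t" "c < length w"
    then have "c < sum_list lam" using tensor_power_length[OF t] by simp
    then have "\<sigma> c < sum_list lam" using permutes_in_image[OF column_stabilizerD(1)[OF that(1)]] by simp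
    then show "rowpt lam y (w ! c) (\<tau> (\<sigma> c)) = rowpt lam y (w ! c) (\<sigma> c)"
      using row_stabilizerD(2)[OF that(2)] by (simp add: rowpt_def)
  qed
  then show ?thesis
    unfolding ev_young_act[OF point_rowpt[OF y] t] colev_def by (simp add: sum_distrib_left)
qed

lemma tensor_power_colsym:
  "t \<in> tensor_power m n (sum_list lam) \<Longrightarrow> colsym m' lam t \<in> tensor_power m n (sum_list lam)"
  unfolding colsym_def
  by (intro tensor_power_sum tensor_power_rscale tensor_power_sym_act) (auto dest: column_stabilizerD)

lemma ev_colsym:
  assumes y: "point m y" and t: "t \<in> tensor_power m' n (sum_list lam)"
  shows "ev y (colsym m lam t) = (\<Sum>\<sigma>\<in>column_stabilizer lam. ev (\<lambda>v c. y v (\<sigma> c)) t * of_int (sign \<sigma>))"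
  unfolding colsym_def ev_sum ev_rscale
  using ev_sym_act[OF y _ tensor_power_length[OF t]]
  by (intro sum.cong refl) (auto dest: column_stabilizerD)

lemma young_act_colsym:
  assumes t: "t \<in> tensor_power m' n (sum_list lam)"
  shows "young_act m lam t = (\<Sum>\<tau>\<in>row_stabilizer lam. sym_act m \<tau> (colsym m lam t))"
proof (rule tensor_eqI[where m = m])
  show "young_act m lam t \<in> tensor_power m' n (sum_list lam)" by (rule tensor_power_young_act[OF t])
  show "(\<Sum>\<tau>\<in>row_stabilizer lam. sym_act m \<tau> (colsym m lam t)) \<in> tensor_power m' n (sum_list lam)"
    using t by (intro tensor_power_sum tensor_power_sym_act tensor_power_colsym) (auto dest: row_stabilizerD)
  fix y :: "nat \<Rightarrow> nat \<Rightarrow> 'a grassmann" assume y: "point m y"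
  have "ev y (sym_act m \<tau> (colsym m lam t)) =
      (\<Sum>\<sigma>\<in>column_stabilizer lam. ev (\<lambda>v c. y v (\<tau> (\<sigma> c))) t * of_int (sign \<sigma>))"
    if "\<tau> \<in> row_stabilizer lam" for \<tau>
    using ev_sym_act[OF y row_stabilizerD(1)[OF that] tensor_power_length[OF tensor_power_colsym[OF t]]]
      ev_colsym[of m "\<lambda>v c. y v (\<tau> c)", OF _ t] y by (simp add: point_def)
  then show "ev y (young_act m lam t) = ev y (\<Sum>\<tau>\<in>row_stabilizer lam. sym_act m \<tau> (colsym m lam t))"
    unfolding ev_young_act[OF y t] ev_sum by (subst sum.swap) simp
qed

text \<open>The coefficients of the permuted tensor are signed sums of those of \<open>t\<close>, so
  generators that are fresh for \<open>t\<close> remain fresh for its row symmetrization.\<close>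

lemma avoids_lookup_sym_act:
  "(\<And>w. w \<in> Poly_Mapping.keys t \<Longrightarrow> avoids s (Poly_Mapping.lookup t w)) \<Longrightarrow>
    avoids s (Poly_Mapping.lookup (sym_act m \<sigma> t) u)"
proof -
  assume a: "\<And>w. w \<in> Poly_Mapping.keys t \<Longrightarrow> avoids s (Poly_Mapping.lookup t w)"
  have "avoids s (koszul_sign m \<sigma> w)" for w
    by (simp add: koszul_sign_def minus_one_power_iff avoids_uminus)
  then show ?thesis
    unfolding sym_act_def rlinear_ext_def Poly_Mapping.lookup_sum lookup_rscale lookup_single
    using a by (intro avoids_sum avoids_mult) (auto simp: when_def)
qed

text \<open>Polarization: for a letter \<open>v\<close> in row \<open>k\<close> substitute \<open>[v = k] + \<Sum> \<eta>\<^sub>d\<close>, where \<open>d\<close> runs over the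
  boxes of row \<open>k\<close> in which a given word has the letter \<open>v\<close>.  The terms involving every \<open>\<eta>\<^sub>d\<close> come
  from row permutations.\<close>

lemma row_symmetrization_eq_0:
  fixes t :: "'a::comm_ring_1 tensor"
  assumes t: "t \<in> tensor_power m' n (sum_list lam)"
    and zero: "\<And>y. point m y \<Longrightarrow> (\<And>v k. v < m \<Longrightarrow> gbody (y v k) = (if v = k then 1 else 0)) \<Longrightarrow>
      ev (rowpt lam y) t = 0"
  shows "(\<Sum>\<tau>\<in>row_stabilizer lam. sym_act m \<tau> t) = 0" (is "?S = 0")
proof (rule poly_mapping_eqI, rule ccontr)
  let ?l = "sum_list lam"
  let ?row = "\<lambda>c. fst (boxes lam ! c)"
  note len = tensor_power_length[OF t]
  have S: "?S \<in> tensor_power m' n ?l"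
    using t by (intro tensor_power_sum tensor_power_sym_act) (auto dest: row_stabilizerD)
  fix u assume "Poly_Mapping.lookup ?S u \<noteq> Poly_Mapping.lookup 0 u"
  then have u: "u \<in> Poly_Mapping.keys ?S" by (simp add: in_keys_iff)
  have lu: "length u = ?l" by (rule tensor_power_length[OF S u])
  obtain N where N: "\<And>w s. w \<in> Poly_Mapping.keys t \<Longrightarrow> N \<le> s \<Longrightarrow> avoids s (Poly_Mapping.lookup t w)"
    using fresh_generators[of "Poly_Mapping.keys t" "Poly_Mapping.lookup t"] by auto
  \<comment> \<open>An even letter needs an even element of body zero, hence a product of two
    generators. Two indices are reserved for each position.\<close>
  define \<eta> :: "nat \<Rightarrow> 'a grassmann" where
    "\<eta> c = (if m \<le> u ! c then gen (N + 2 * c) else gen (N + 2 * c) * gen (N + 2 * c + 1))" for c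
  have par: "gparity (m \<le> u ! c) (\<eta> c)" for c
    using gparity_mult[OF gparity_gen gparity_gen] by (auto simp: \<eta>_def gparity_gen)
  have av: "avoids (N + 2 * c) (\<eta> d)" "avoids (N + 2 * c + 1) (\<eta> d)" if "c \<noteq> d" for c d
    using that by (auto simp: \<eta>_def intro!: avoids_mult avoids_gen)
  have con: "contains (N + 2 * c) (\<eta> c)" for c
    using contains_gen[of "N + 2 * c"] contains_mult by (auto simp: \<eta>_def)
  define Y where "Y v d = (if u ! d = v then \<eta> d else 0)" for v d
  \<comment> \<open>Index \<open>?l\<close> selects the constant term, an index
    \<open>d < ?l\<close> the summand of box \<open>d\<close>, which is present only for positions
    in the same row.\<close>
  define P where "P v c d = (if d = ?l then if v < m \<and> v = ?row c then 1 else 0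
    else if ?row d = ?row c then Y v d else 0)" for v c d
  define y where "y v k = (if v < m \<and> v = k then 1 else 0) + (\<Sum>d<?l. if ?row d = k then Y v d else 0)" for v k
  have Y: "gparity (m \<le> v) (Y v d)" for v d using par[of d] by (auto simp: Y_def)
  have "gparity (m \<le> v) (y v k)" for v k
  proof -
    have "gparity (m \<le> v) (if v < m \<and> v = k then 1 else 0)" by auto
    moreover have "gparity (m \<le> v) (if ?row d = k then Y v d else 0)" for d using Y[of v d] by simp
    ultimately show ?thesis unfolding y_def by (intro gparity_add gparity_sum)
  qed
  then have "point m y" by (simp add: point_def)
  \<comment> \<open>The added summands have body zero, so the even letters keep the identity as body
    and \<open>zero\<close> applies.\<close>
  moreover have "gbody (\<eta> d) = 0" for d by (simp add: \<eta>_def gbody_odd[OF gparity_gen])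
  then have "gbody (Y v d) = 0" for v d by (simp add: Y_def)
  then have "gbody (y v k) = (if v = k then 1 else 0)" if "v < m" for v k
    using that unfolding y_def by (simp add: gbody_sum if_distrib[of gbody] cong: if_cong)
  ultimately have "ev (rowpt lam y) t = 0" by (rule zero)
  moreover have "rowpt lam y v c = (\<Sum>d\<in>{..?l}. P v c d)" for v c
  proof -
    have "(\<Sum>d<?l. P v c d) = (\<Sum>d<?l. if ?row d = ?row c then Y v d else 0)"
      by (intro sum.cong) (auto simp: P_def)
    then show ?thesis
      unfolding lessThan_Suc_atMost[symmetric] by (simp add: rowpt_def y_def P_def add.commute)
  qed
  then have "rowpt lam y = (\<lambda>v c. \<Sum>d\<in>{..?l}. P v c d)" by (intro ext)
  ultimately have total: "(\<Sum>\<rho>\<in>{..<?l} \<rightarrow>\<^sub>E {..?l}. ev (\<lambda>v c. P v c (\<rho> c)) t) = 0"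
    using ev_sum_PiE[OF len, where D = "{..?l}" and P = P] by simp
  \<comment> \<open>The choices of summands that come from row permutations, restricted so as to lie
    in the extensional function space.\<close>
  define I where "I = (\<lambda>\<tau>. restrict \<tau> {..<?l}) ` row_stabilizer lam"
  have I: "I \<subseteq> {..<?l} \<rightarrow>\<^sub>E {..?l}"
  proof
    fix \<rho> assume "\<rho> \<in> I"
    then obtain \<tau> where \<tau>: "\<rho> = restrict \<tau> {..<?l}" "\<tau> \<in> row_stabilizer lam" by (auto simp: I_def)
    then have "\<tau> c < ?l" if "c < ?l" for c
      using permutes_in_image[OF row_stabilizerD(1)[OF \<tau>(2)]] that by simp
    then show "\<rho> \<in> {..<?l} \<rightarrow>\<^sub>E {..?l}" using \<tau>(1) by (auto intro: less_imp_le)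
  qed
  have inj: "inj_on (\<lambda>\<tau>. restrict \<tau> {..<?l}) (row_stabilizer lam)"
  proof (rule inj_onI, rule ext)
    fix \<tau> \<tau>' c assume \<tau>: "\<tau> \<in> row_stabilizer lam" "\<tau>' \<in> row_stabilizer lam"
      "restrict \<tau> {..<?l} = restrict \<tau>' {..<?l}"
    show "\<tau> c = \<tau>' c"
    proof (cases "c < ?l")
      case True
      then show ?thesis using fun_cong[OF \<tau>(3), of c] by simp
    next
      case False
      then show ?thesis using row_stabilizerD(1)[OF \<tau>(1)] row_stabilizerD(1)[OF \<tau>(2)]
        by (simp add: permutes_not_in)
    qed
  qed
  have "ev (\<lambda>v c. P v c (restrict \<tau> {..<?l} c)) t = ev Y (sym_act m \<tau> t)" if \<tau>: "\<tau> \<in> row_stabilizer lam" for \<tau>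
  proof -
    have pt: "point m Y" using Y by (simp add: point_def)
    have "\<tau> c < ?l" if "c < ?l" for c
      using permutes_in_image[OF row_stabilizerD(1)[OF \<tau>]] that by simp
    then have "ev (\<lambda>v c. P v c (restrict \<tau> {..<?l} c)) t = ev (\<lambda>v c. Y v (\<tau> c)) t"
      using row_stabilizerD(2)[OF \<tau>] len by (intro ev_cong) (fastforce simp: P_def)
    then show ?thesis using ev_sym_act[OF pt row_stabilizerD(1)[OF \<tau>] len] by simp
  qed
  then have "(\<Sum>\<rho>\<in>I. ev (\<lambda>v c. P v c (\<rho> c)) t) = ev Y ?S"
    unfolding I_def ev_sum by (simp add: sum.reindex[OF inj])
  also have "\<dots> = (\<Sum>w\<in>Poly_Mapping.keys ?S. if w = u then prod_list (map \<eta> [0..<?l]) * Poly_Mapping.lookup ?S u else 0)"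
    unfolding ev_def
  proof (intro sum.cong refl)
    fix w assume w: "w \<in> Poly_Mapping.keys ?S"
    show "evw Y w * Poly_Mapping.lookup ?S w =
      (if w = u then prod_list (map \<eta> [0..<?l]) * Poly_Mapping.lookup ?S u else 0)"
    proof (cases "w = u")
      case True
      then show ?thesis using lu by (simp add: evw_def Y_def)
    next
      case False
      then obtain c where "c < length w" "w ! c \<noteq> u ! c"
        using nth_equalityI[of w u] tensor_power_length[OF S w] lu by auto
      then have "evw Y w = 0"
        unfolding evw_def by (intro prod_list_eq_0) (auto simp: Y_def image_iff intro!: bexI[of _ c])
      then show ?thesis using False by simp
    qed
  qed
  finally have SI: "(\<Sum>\<rho>\<in>I. ev (\<lambda>v c. P v c (\<rho> c)) t) = prod_list (map \<eta> [0..<?l]) * Poly_Mapping.lookup ?S u"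
    using u by simp
  \<comment> \<open>A choice outside \<open>I\<close> either leaves out some box \<open>d\<close>,
    and then its term avoids the first generator of \<open>d\<close>, or is a permutation that
    changes the row of some position, and then its term is zero.\<close>
  have miss: "\<exists>d<?l. avoids (N + 2 * d) (ev (\<lambda>v c. P v c (\<rho> c)) t)" if \<rho>: "\<rho> \<in> ({..<?l} \<rightarrow>\<^sub>E {..?l}) - I" for \<rho>
  proof (cases "{..<?l} \<subseteq> \<rho> ` {..<?l}")
    case False
    then obtain d where d: "d < ?l" "d \<notin> \<rho> ` {..<?l}" by auto
    have "avoids (N + 2 * d) (P v c (\<rho> c))" if "c < ?l" for v c
    proof -
      have "\<rho> c \<noteq> d" using d that by auto
      then show ?thesis using av(1)[of d "\<rho> c"] by (auto simp: P_def Y_def)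
    qed
    then have "avoids (N + 2 * d) (ev (\<lambda>v c. P v c (\<rho> c)) t)"
      unfolding ev_def evw_def using N len by (intro avoids_sum avoids_mult avoids_prod_list) auto
    with d show ?thesis by blast
  next
    case True
    then have "card (\<rho> ` {..<?l}) = ?l"
      using card_mono[OF _ True] card_image_le[of "{..<?l}" \<rho>] by simp
    with True have im: "\<rho> ` {..<?l} = {..<?l}"
      using card_subset_eq[of "\<rho> ` {..<?l}" "{..<?l}"] by simp
    define \<tau> where "\<tau> c = (if c < ?l then \<rho> c else c)" for c
    have "bij_betw \<rho> {..<?l} {..<?l}" using im by (simp add: bij_betw_def eq_card_imp_inj_on)
    then have "bij_betw \<tau> {..<?l} {..<?l}" by (rule bij_betw_cong[THEN iffD1, rotated]) (simp add: \<tau>_def)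
    then have per: "\<tau> permutes {..<?l}" by (rule bij_imp_permutes) (simp add: \<tau>_def)
    have "\<rho> = restrict \<tau> {..<?l}" using \<rho> by (auto simp: \<tau>_def restrict_def PiE_def extensional_def)
    then have "\<tau> \<notin> row_stabilizer lam" using \<rho> by (auto simp: I_def)
    then obtain c where c: "c < ?l" "?row (\<rho> c) \<noteq> ?row c" using per by (auto simp: row_stabilizer_def \<tau>_def)
    have "\<rho> c < ?l" using im c(1) by auto
    then have "P v c (\<rho> c) = 0" for v using c(2) by (simp add: P_def)
    then have "evw (\<lambda>v c. P v c (\<rho> c)) w = 0" if "length w = ?l" for w
      unfolding evw_def using c(1) that by (intro prod_list_eq_0) (force simp: image_iff)
    then have "ev (\<lambda>v c. P v c (\<rho> c)) t = 0" unfolding ev_def using len by simp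
    then show ?thesis using c(1) by auto
  qed
  let ?a = "Poly_Mapping.lookup ?S u"
  have "(\<Sum>\<rho>\<in>({..<?l} \<rightarrow>\<^sub>E {..?l}) - I. ev (\<lambda>v c. P v c (\<rho> c)) t) + prod_list (map \<eta> [0..<?l]) * ?a = 0"
    unfolding SI[symmetric] using total I by (subst (asm) sum.subset_diff[of I]) (auto intro: finite_PiE)
  then have eq: "prod_list (map \<eta> [0..<?l]) * ?a = - (\<Sum>\<rho>\<in>({..<?l} \<rightarrow>\<^sub>E {..?l}) - I. ev (\<lambda>v c. P v c (\<rho> c)) t)"
    by (simp add: eq_neg_iff_add_eq_0 add.commute)
  \<comment> \<open>Every monomial on the left of \<open>eq\<close> involves the first generator of
    each box, while each term on the right misses one of them.\<close>
  have "prod_list (map \<eta> [0..<?l]) * ?a = 0"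
  proof (rule grassmann_eqI, rule ccontr)
    fix U assume "gcoeff (prod_list (map \<eta> [0..<?l]) * ?a) U \<noteq> gcoeff 0 U"
    then have U: "gcoeff (prod_list (map \<eta> [0..<?l]) * ?a) U \<noteq> 0" by (simp add: zero_grassmann.rep_eq)
    have "N + 2 * d \<in> U" if "d < ?l" for d
    proof -
      have "contains (N + 2 * d) (prod_list (map \<eta> [0..<?l]) * ?a)"
        using that con[of d] contains_prod_list[of "\<eta> d" "map \<eta> [0..<?l]"] by (intro contains_mult) auto
      with U show ?thesis by (simp add: contains_def)
    qed
    then have "gcoeff (ev (\<lambda>v c. P v c (\<rho> c)) t) U = 0" if "\<rho> \<in> ({..<?l} \<rightarrow>\<^sub>E {..?l}) - I" for \<rho>
      using miss[OF that] by (auto simp: avoids_def)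
    moreover have "gcoeff (sum f A) U = (\<Sum>i\<in>A. gcoeff (f i) U)" for f :: "(nat \<Rightarrow> nat) \<Rightarrow> 'a grassmann" and A
      by (induction A rule: infinite_finite_induct) (simp_all add: zero_grassmann.rep_eq plus_grassmann.rep_eq)
    ultimately have "gcoeff (prod_list (map \<eta> [0..<?l]) * ?a) U = 0"
      unfolding eq by (simp add: uminus_grassmann.rep_eq)
    with U show False by simp
  qed
  then have "?a = 0"
  proof (rule prod_gens_mult_eq_0[of "[0..<?l]" "\<lambda>c. {N + 2 * c, N + 2 * c + 1}" \<eta>, rotated -1])
    fix c a assume a: "\<And>s. s \<in> {N + 2 * c, N + 2 * c + 1} \<Longrightarrow> avoids s a" and 0: "\<eta> c * a = 0"
    show "a = 0"
    proof (cases "m \<le> u ! c")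
      case True
      then show ?thesis using 0 a gen_mult_eq_0[of "N + 2 * c" a] by (simp add: \<eta>_def)
    next
      case False
      have "gen (N + 2 * c + 1) * a = 0"
      proof (rule gen_mult_eq_0[of "N + 2 * c"])
        show "avoids (N + 2 * c) (gen (N + 2 * c + 1) * a)" using a by (intro avoids_mult avoids_gen) auto
      qed (use 0 False in \<open>simp add: \<eta>_def mult.assoc\<close>)
      then show ?thesis by (rule gen_mult_eq_0) (simp add: a)
    qed
  next
    fix c s assume "s \<in> {N + 2 * c, N + 2 * c + 1}"
    then have "N \<le> s" by auto
    then show "avoids s ?a"
      unfolding Poly_Mapping.lookup_sum using N by (intro avoids_sum avoids_lookup_sym_act) auto
  qed (use av in auto)
  with u show False by (simp add: in_keys_iff)
qed

section \<open>Rectangular diagrams\<close>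

lemma boxes_replicate:
  "boxes (replicate r q) = concat (map (\<lambda>i. map (Pair i) [0..<q]) [0..<r])"
  unfolding boxes_def by (intro arg_cong[of _ _ concat]) simp

lemma boxes_replicate_nth: "c < r * q \<Longrightarrow> boxes (replicate r q) ! c = (c div q, c mod q)"
proof (induction r)
  case (Suc r)
  have len: "length (boxes (replicate r q)) = r * q" by (simp add: length_boxes sum_list_replicate)
  have app: "boxes (replicate (Suc r) q) = boxes (replicate r q) @ map (Pair r) [0..<q]"
    unfolding boxes_replicate by simp
  show ?case
  proof (cases "c < r * q")
    case True
    then show ?thesis using Suc.IH len app by (simp add: nth_append)
  next
    case False
    define d where "d = c - r * q"
    have d: "c = r * q + d" "d < q" using False Suc.prems by (auto simp: d_def)
    then show ?thesis using len app by (simp add: nth_append)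
  qed
qed simp

section \<open>Determinants of block diagonal and Kronecker matrices\<close>

lemma det_four_block_diag:
  fixes A D :: "'a::comm_ring_1 mat"
  assumes A: "A \<in> carrier_mat n n" and D: "D \<in> carrier_mat k k"
  shows "det (four_block_mat A (0\<^sub>m n k) (0\<^sub>m k n) D) = det A * det D"
proof -
  have 1: "det (four_block_mat (1\<^sub>m n) (0\<^sub>m n k) (0\<^sub>m k n) D) = det D" for n
  proof (induction n)
    case 0
    have "four_block_mat (1\<^sub>m 0) (0\<^sub>m 0 k) (0\<^sub>m k 0) D = D" using D by (intro eq_matI) auto
    then show ?case by simp
  next
    case (Suc n)
    let ?B = "four_block_mat (1\<^sub>m n) (0\<^sub>m n k) (0\<^sub>m k n) D"
    have B: "?B \<in> carrier_mat (n + k) (n + k)" using D by simp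
    have "four_block_mat (1\<^sub>m (Suc n)) (0\<^sub>m (Suc n) k) (0\<^sub>m k (Suc n)) D
        = four_block_mat (1\<^sub>m 1) (0\<^sub>m 1 (n + k)) (0\<^sub>m (n + k) 1) ?B"
      using D by (intro eq_matI) (auto simp: less_Suc_eq_0_disj)
    then show ?case using det_four_block_mat_lower_left_zero_col[OF _ _ _ B, of "1\<^sub>m 1" "0\<^sub>m 1 (n + k)"] Suc
      by simp
  qed
  have 2: "det (four_block_mat A (0\<^sub>m n k) (0\<^sub>m k n) (1\<^sub>m k)) = det A" for k
  proof (induction k)
    case 0
    have "four_block_mat A (0\<^sub>m n 0) (0\<^sub>m 0 n) (1\<^sub>m 0) = A" using A by (intro eq_matI) auto
    then show ?case by simp
  next
    case (Suc k)
    let ?B = "four_block_mat A (0\<^sub>m n k) (0\<^sub>m k n) (1\<^sub>m k)"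
    have B: "?B \<in> carrier_mat (n + k) (n + k)" using A by simp
    have "four_block_mat A (0\<^sub>m n (Suc k)) (0\<^sub>m (Suc k) n) (1\<^sub>m (Suc k))
        = four_block_mat ?B (0\<^sub>m (n + k) 1) (0\<^sub>m 1 (n + k)) (1\<^sub>m 1)"
    proof (rule eq_matI)
      fix i j assume "i < dim_row (four_block_mat ?B (0\<^sub>m (n + k) 1) (0\<^sub>m 1 (n + k)) (1\<^sub>m 1))"
        "j < dim_col (four_block_mat ?B (0\<^sub>m (n + k) 1) (0\<^sub>m 1 (n + k)) (1\<^sub>m 1))"
      then have "i < n + Suc k" "j < n + Suc k" using A by auto
      then show "four_block_mat A (0\<^sub>m n (Suc k)) (0\<^sub>m (Suc k) n) (1\<^sub>m (Suc k)) $$ (i, j)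
          = four_block_mat ?B (0\<^sub>m (n + k) 1) (0\<^sub>m 1 (n + k)) (1\<^sub>m 1) $$ (i, j)"
        using A by (cases "i < n"; cases "j < n"; cases "i < n + k"; cases "j < n + k") auto
    qed (use A in auto)
    then show ?case using det_four_block_mat_upper_right_zero_col[OF B, of _ "0\<^sub>m 1 (n + k)" "1\<^sub>m 1"] Suc
      by simp
  qed
  have "four_block_mat A (0\<^sub>m n k) (0\<^sub>m k n) D = four_block_mat A (0\<^sub>m n k) (0\<^sub>m k n) (1\<^sub>m k)
      * four_block_mat (1\<^sub>m n) (0\<^sub>m n k) (0\<^sub>m k n) D"
    using A D by (subst mult_four_block_mat[where ?nr1.0 = n and ?n1.0 = n and ?n2.0 = k and ?nr2.0 = k
          and ?nc1.0 = n and ?nc2.0 = k]) auto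
  then show ?thesis
    using A D 1 2 by (simp add: det_mult[where n = "n + k"])
qed

lemma det_block_diag_power:
  fixes g :: "'a::comm_ring_1 mat"
  assumes g: "g \<in> carrier_mat r r"
  shows "det (mat (q * r) (q * r) (\<lambda>(c, d). if c div r = d div r then g $$ (c mod r, d mod r) else 0)) = det g ^ q"
proof (induction q)
  case (Suc q)
  let ?K = "\<lambda>q. mat (q * r) (q * r) (\<lambda>(c, d). if c div r = d div r then g $$ (c mod r, d mod r) else 0)"
  have "?K (Suc q) = four_block_mat g (0\<^sub>m r (q * r)) (0\<^sub>m (q * r) r) (?K q)"
  proof (rule eq_matI)
    fix c d assume "c < dim_row (four_block_mat g (0\<^sub>m r (q * r)) (0\<^sub>m (q * r) r) (?K q))"
      "d < dim_col (four_block_mat g (0\<^sub>m r (q * r)) (0\<^sub>m (q * r) r) (?K q))"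
    then have cd: "c < r + q * r" "d < r + q * r" using g by auto
    have r: "r > 0" using cd by (cases r) auto
    have e: "(c - r) div r = c div r - 1" "(c - r) mod r = c mod r" "c div r \<ge> 1" if "r \<le> c" for c
      using that r by (auto simp: le_div_geq le_mod_geq)
    show "?K (Suc q) $$ (c, d) = four_block_mat g (0\<^sub>m r (q * r)) (0\<^sub>m (q * r) r) (?K q) $$ (c, d)"
      using cd g r e[of c] e[of d] by (cases "c < r"; cases "d < r") auto
  qed (use g in auto)
  then show ?case using Suc g by (simp add: det_four_block_diag)
qed simp

text \<open>Rows and columns contribute the same sign, which squares to 1.\<close>

lemma det_permute_both:
  fixes A :: "'a::comm_ring_1 mat"
  assumes A: "A \<in> carrier_mat n n" and p: "p permutes {0..<n}"
  shows "det (mat n n (\<lambda>(i, j). A $$ (p i, p j))) = det A"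
proof -
  let ?R = "\<lambda>A. mat n n (\<lambda>(i, j). A $$ (p i, j))"
  have lt: "p i < n" if "i < n" for i using permutes_in_image[OF p, of i] that by simp
  have "mat n n (\<lambda>(i, j). A $$ (p i, p j)) = ?R ((?R A\<^sup>T)\<^sup>T)"
    using A lt by (intro eq_matI) auto
  then have "det (mat n n (\<lambda>(i, j). A $$ (p i, p j))) = of_int (sign p) * (of_int (sign p) * det A)"
    using det_permute_rows[OF _ p, of "(?R A\<^sup>T)\<^sup>T"] det_permute_rows[OF _ p, of "A\<^sup>T"]
      det_transpose[of "?R A\<^sup>T" n] det_transpose[OF A] A by simp
  then show ?thesis by (simp flip: mult.assoc of_int_mult)
qed

text \<open>For the row map \<open>\<lambda>c. c div q\<close> this is the Kronecker product of
  \<open>g\<close> with the identity of size \<open>q\<close>, on boxes in row-by-row order. A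
  general \<open>\<rho>\<close> replaces the row of each box; the determinant is then the
  coefficient that \<open>\<rho>\<close> receives in \<open>colev_row_transform\<close>.\<close>

definition kron :: "nat \<Rightarrow> nat \<Rightarrow> 'a::comm_ring_1 mat \<Rightarrow> (nat \<Rightarrow> nat) \<Rightarrow> 'a mat" where
  "kron r q g \<rho> = mat (r * q) (r * q) (\<lambda>(c, d). if c mod q = d mod q then g $$ (\<rho> c, d div q) else 0)"

lemma kron_carrier [simp]: "kron r q g \<rho> \<in> carrier_mat (r * q) (r * q)"
  by (simp add: kron_def)

lemma det_kron:
  fixes g :: "'a::comm_ring_1 mat"
  assumes g: "g \<in> carrier_mat r r"
  shows "det (kron r q g (\<lambda>c. c div q)) = det g ^ q"
proof -
  \<comment> \<open>Passes from the row-by-row to the column-by-column order of the boxes, in which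
    the matrix is block diagonal with \<open>q\<close> copies of \<open>g\<close>.\<close>
  define p where "p c = (if c < r * q then c mod q * r + c div q else c)" for c
  have pos: "q > 0" "r > 0" if "c < r * q" for c using that by (cases q; cases r; simp)+
  have dm: "c div q < r" "c mod q < q" if "c < r * q" for c
    using that pos[OF that] by (auto simp: less_mult_imp_div_less)
  have pdm: "p c div r = c mod q" "p c mod r = c div q" if "c < r * q" for c
    using dm[OF that] that by (auto simp: p_def)
  have lt: "p c < r * q" if "c < r * q" for c
  proof -
    have "p c < Suc (c mod q) * r" using dm[OF that] that by (simp add: p_def)
    also have "\<dots> \<le> q * r" using dm[OF that] by (intro mult_le_mono1) simp
    finally show ?thesis by (simp add: mult.commute)
  qed
  have "inj_on p {0..<r * q}"
  proof (rule inj_onI)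
    fix c d assume cd: "c \<in> {0..<r * q}" "d \<in> {0..<r * q}" "p c = p d"
    then have "c mod q = d mod q" "c div q = d div q" using pdm[of c] pdm[of d] by auto
    then show "c = d" by (metis div_mult_mod_eq)
  qed
  then have "bij_betw p {0..<r * q} {0..<r * q}"
    using lt by (intro bij_betw_imageI endo_inj_surj) auto
  then have p: "p permutes {0..<r * q}" by (rule bij_imp_permutes) (simp add: p_def)
  let ?K = "mat (q * r) (q * r) (\<lambda>(c, d). if c div r = d div r then g $$ (c mod r, d mod r) else 0)"
  have "kron r q g (\<lambda>c. c div q) = mat (r * q) (r * q) (\<lambda>(i, j). ?K $$ (p i, p j))"
    by (rule eq_matI) (use lt in \<open>auto simp: kron_def pdm mult.commute\<close>)
  moreover have "det (mat (r * q) (r * q) (\<lambda>(i, j). ?K $$ (p i, p j))) = det ?K"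
    using p by (intro det_permute_both) (auto simp: mult.commute)
  ultimately show ?thesis using det_block_diag_power[OF g, of q] by simp
qed

lemma column_stabilizer_replicate:
  "\<sigma> \<in> column_stabilizer (replicate r q) \<longleftrightarrow>
    \<sigma> permutes {..<r * q} \<and> (\<forall>c<r * q. \<sigma> c mod q = c mod q)"
proof -
  have "\<sigma> c < r * q" if "\<sigma> permutes {..<r * q}" "c < r * q" for c
    using permutes_in_image[OF that(1), of c] that(2) by simp
  then show ?thesis
    unfolding column_stabilizer_def by (auto simp: sum_list_replicate boxes_replicate_nth)
qed

text \<open>This is the Leibniz formula: an entry between boxes of different columns is zero, which
  removes the permutations outside the column stabilizer.\<close>

lemma sum_column_stabilizer_eq_det:
  fixes g :: "'a::comm_ring_1 mat"
  shows "(\<Sum>\<sigma>\<in>column_stabilizer (replicate r q). of_int (sign \<sigma>) * (\<Prod>c<r * q. g $$ (\<rho> c, \<sigma> c div q)))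
    = det (kron r q g \<rho>)"
proof -
  let ?C = "column_stabilizer (replicate r q)" and ?l = "r * q"
  have "det (kron r q g \<rho>) = (\<Sum>\<sigma>\<in>{\<sigma>. \<sigma> permutes {0..<?l}}. of_int (sign \<sigma>) * (\<Prod>c = 0..<?l. kron r q g \<rho> $$ (c, \<sigma> c)))"
    by (rule det_def') simp
  also have "\<dots> = (\<Sum>\<sigma>\<in>?C. of_int (sign \<sigma>) * (\<Prod>c = 0..<?l. kron r q g \<rho> $$ (c, \<sigma> c)))"
  proof (rule sum.mono_neutral_right)
    show "finite {\<sigma>. \<sigma> permutes {0..<?l}}" by (simp add: finite_permutations)
    show "?C \<subseteq> {\<sigma>. \<sigma> permutes {0..<?l}}" by (auto simp: column_stabilizer_replicate atLeast0LessThan)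
    show "\<forall>\<sigma>\<in>{\<sigma>. \<sigma> permutes {0..<?l}} - ?C. of_int (sign \<sigma>) * (\<Prod>c = 0..<?l. kron r q g \<rho> $$ (c, \<sigma> c)) = 0"
    proof
      fix \<sigma> assume \<sigma>: "\<sigma> \<in> {\<sigma>. \<sigma> permutes {0..<?l}} - ?C"
      then obtain c where c: "c < ?l" "\<sigma> c mod q \<noteq> c mod q"
        by (auto simp: column_stabilizer_replicate atLeast0LessThan)
      then have "kron r q g \<rho> $$ (c, \<sigma> c) = 0"
        using \<sigma> permutes_in_image[of \<sigma> "{0..<?l}" c] by (auto simp: kron_def)
      then have "(\<Prod>c = 0..<?l. kron r q g \<rho> $$ (c, \<sigma> c)) = 0"
        using c(1) by (intro prod_zero) auto
      then show "of_int (sign \<sigma>) * (\<Prod>c = 0..<?l. kron r q g \<rho> $$ (c, \<sigma> c)) = 0" by simp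
    qed
  qed
  also have "\<dots> = (\<Sum>\<sigma>\<in>?C. of_int (sign \<sigma>) * (\<Prod>c<?l. g $$ (\<rho> c, \<sigma> c div q)))"
  proof (intro sum.cong refl arg_cong2[of _ _ _ _ times] prod.cong)
    fix \<sigma> c assume \<sigma>: "\<sigma> \<in> ?C" and c: "c \<in> {..<?l}"
    then have "\<sigma> c < ?l" using permutes_in_image[of \<sigma> "{..<?l}" c] by (simp add: column_stabilizer_replicate)
    then show "kron r q g \<rho> $$ (c, \<sigma> c) = g $$ (\<rho> c, \<sigma> c div q)"
      using \<sigma> c by (auto simp: column_stabilizer_replicate kron_def)
  qed (simp add: atLeast0LessThan)
  finally show ?thesis by simp
qed

text \<open>Expanding the left-hand side gives a sum over maps \<open>\<rho>\<close> from positions to rows.  The coefficient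
  of \<open>\<rho>\<close> is a determinant, which vanishes unless \<open>\<rho>\<close> is the row map composed with a column
  permutation.\<close>

lemma colev_row_transform:
  fixes y :: "nat \<Rightarrow> nat \<Rightarrow> 'a::comm_ring_1 grassmann"
  assumes g: "g \<in> carrier_mat r r" and t: "t \<in> tensor_power m n (r * q)"
  shows "colev (replicate r q) (\<lambda>v k. \<Sum>k'<r. y v k' * of_geven (g $$ (k', k))) t
    = of_geven (det g ^ q) * colev (replicate r q) y t"
proof -
  let ?l = "r * q" and ?lam = "replicate r q"
  let ?C = "column_stabilizer ?lam" and ?X = "{..<?l} \<rightarrow>\<^sub>E {..<r}"
  define E where "E \<rho> = ev (\<lambda>v c. y v (\<rho> c)) t" for \<rho> :: "nat \<Rightarrow> nat"
  note len = tensor_power_length[OF t]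
  have lt: "\<sigma> c < ?l" if "\<sigma> \<in> ?C" "c < ?l" for \<sigma> c
    using permutes_in_image[of \<sigma> "{..<?l}" c] that by (simp add: column_stabilizer_replicate)
  have rowpt: "rowpt ?lam z v (\<sigma> c) = z v (\<sigma> c div q)" if "\<sigma> \<in> ?C" "c < ?l"
    for z :: "nat \<Rightarrow> nat \<Rightarrow> 'a grassmann" and v \<sigma> c
    using boxes_replicate_nth[OF lt[OF that]] by (simp add: rowpt_def)
  have "colev ?lam (\<lambda>v k. \<Sum>k'<r. y v k' * of_geven (g $$ (k', k))) t =
    (\<Sum>\<sigma>\<in>?C. \<Sum>\<rho>\<in>?X. of_geven (of_int (sign \<sigma>) * (\<Prod>c<?l. g $$ (\<rho> c, \<sigma> c div q))) * E \<rho>)"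
    unfolding colev_def
  proof (intro sum.cong refl)
    fix \<sigma> assume \<sigma>: "\<sigma> \<in> ?C"
    have "ev (\<lambda>v c. rowpt ?lam (\<lambda>v k. \<Sum>k'<r. y v k' * of_geven (g $$ (k', k))) v (\<sigma> c)) t
        = ev (\<lambda>v c. \<Sum>k'<r. y v k' * of_geven (g $$ (k', \<sigma> c div q))) t"
      using len \<sigma> by (intro ev_cong) (simp add: rowpt)
    also have "\<dots> = (\<Sum>\<rho>\<in>?X. ev (\<lambda>v c. y v (\<rho> c) * of_geven (g $$ (\<rho> c, \<sigma> c div q))) t)"
      using ev_sum_PiE[OF len, where D = "{..<r}" and P = "\<lambda>v c k'. y v k' * of_geven (g $$ (k', \<sigma> c div q))"]
      by simp
    also have "\<dots> = (\<Sum>\<rho>\<in>?X. of_geven (\<Prod>c<?l. g $$ (\<rho> c, \<sigma> c div q)) * E \<rho>)"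
      unfolding E_def by (intro sum.cong refl ev_mult_of_geven[OF len])
    finally have *: "ev (\<lambda>v c. rowpt ?lam (\<lambda>v k. \<Sum>k'<r. y v k' * of_geven (g $$ (k', k))) v (\<sigma> c)) t = \<dots>" .
    show "ev (\<lambda>v c. rowpt ?lam (\<lambda>v k. \<Sum>k'<r. y v k' * of_geven (g $$ (k', k))) v (\<sigma> c)) t * of_int (sign \<sigma>)
        = (\<Sum>\<rho>\<in>?X. of_geven (of_int (sign \<sigma>) * (\<Prod>c<?l. g $$ (\<rho> c, \<sigma> c div q))) * E \<rho>)"
      unfolding * by (subst mult_of_int_commute[symmetric]) (simp add: sum_distrib_left of_geven_of_int mult.assoc)
  qed
  also have "\<dots> = (\<Sum>\<rho>\<in>?X. of_geven (det (kron r q g \<rho>)) * E \<rho>)"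
    by (subst sum.swap) (simp add: sum_column_stabilizer_eq_det[symmetric] of_geven_sum sum_distrib_right)
  also have "\<dots> = (\<Sum>\<rho>\<in>(\<lambda>\<pi>. restrict (\<lambda>c. \<pi> c div q) {..<?l}) ` ?C. of_geven (det (kron r q g \<rho>)) * E \<rho>)"
  proof (rule sum.mono_neutral_right)
    show "finite ?X" by (intro finite_PiE) auto
    show "(\<lambda>\<pi>. restrict (\<lambda>c. \<pi> c div q) {..<?l}) ` ?C \<subseteq> ?X"
      by (rule image_subsetI, rule restrict_PiE_iff[THEN iffD2]) (use lt in \<open>auto simp: less_mult_imp_div_less\<close>)
    show "\<forall>\<rho>\<in>?X - (\<lambda>\<pi>. restrict (\<lambda>c. \<pi> c div q) {..<?l}) ` ?C. of_geven (det (kron r q g \<rho>)) * E \<rho> = 0"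
    proof
      fix \<rho> assume \<rho>: "\<rho> \<in> ?X - (\<lambda>\<pi>. restrict (\<lambda>c. \<pi> c div q) {..<?l}) ` ?C"
      \<comment> \<open>The only column-preserving map on the boxes with rows given by
        \<open>\<rho>\<close>. As \<open>\<rho>\<close> does not come from a column permutation,
        \<open>\<pi>\<close> is not injective, and two boxes with the same image give equal rows of
        the matrix.\<close>
      define \<pi> where "\<pi> c = (if c < ?l then \<rho> c * q + c mod q else c)" for c
      have q: "q > 0" if "c < ?l" for c using that by (cases q) auto
      have dm: "\<pi> c div q = \<rho> c" "\<pi> c mod q = c mod q" if "c < ?l" for c
        using that q[OF that] by (auto simp: \<pi>_def)
      have \<pi>lt: "\<pi> c < ?l" if "c < ?l" for c
      proof -
        have "\<pi> c < Suc (\<rho> c) * q" using that q[OF that] by (simp add: \<pi>_def)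
        also have "\<dots> \<le> r * q" using \<rho> that by (intro mult_le_mono1) (auto simp: Suc_le_eq)
        finally show ?thesis .
      qed
      have "\<not> inj_on \<pi> {..<?l}"
      proof
        assume "inj_on \<pi> {..<?l}"
        then have "bij_betw \<pi> {..<?l} {..<?l}" using \<pi>lt by (intro bij_betw_imageI endo_inj_surj) auto
        then have "\<pi> permutes {..<?l}" by (rule bij_imp_permutes) (simp add: \<pi>_def)
        then have "\<pi> \<in> ?C" using dm(2) by (simp add: column_stabilizer_replicate)
        moreover have "\<rho> = restrict (\<lambda>c. \<pi> c div q) {..<?l}"
          using \<rho> dm(1) by (auto simp: restrict_def PiE_def extensional_def)
        ultimately show False using \<rho> by blast
      qed
      then obtain c d where cd: "c < ?l" "d < ?l" "c \<noteq> d" "\<pi> c = \<pi> d" by (auto simp: inj_on_def)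
      then have "\<rho> c = \<rho> d" "c mod q = d mod q" using dm[of c] dm[of d] by auto
      then have "row (kron r q g \<rho>) c = row (kron r q g \<rho>) d"
        using cd by (intro eq_vecI) (auto simp: kron_def)
      then have "det (kron r q g \<rho>) = 0" using cd by (intro det_identical_rows[of _ ?l c d]) auto
      then show "of_geven (det (kron r q g \<rho>)) * E \<rho> = 0" by simp
    qed
  qed
  also have "\<dots> = (\<Sum>\<pi>\<in>?C. of_geven (det g ^ q) * (ev (\<lambda>v c. rowpt ?lam y v (\<pi> c)) t * of_int (sign \<pi>)))"
  proof (subst sum.reindex)
    show "inj_on (\<lambda>\<pi>. restrict (\<lambda>c. \<pi> c div q) {..<?l}) ?C"
    proof (rule inj_onI, rule ext)
      fix \<pi> \<pi>' c assume \<pi>: "\<pi> \<in> ?C" "\<pi>' \<in> ?C"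
        "restrict (\<lambda>c. \<pi> c div q) {..<?l} = restrict (\<lambda>c. \<pi>' c div q) {..<?l}"
      show "\<pi> c = \<pi>' c"
      proof (cases "c < ?l")
        case True
        then have "\<pi> c div q = \<pi>' c div q" using fun_cong[OF \<pi>(3), of c] by simp
        moreover have "\<pi> c mod q = \<pi>' c mod q" using \<pi> True by (simp add: column_stabilizer_replicate)
        ultimately show ?thesis by (metis div_mult_mod_eq)
      next
        case False
        then show ?thesis using \<pi> by (auto simp: column_stabilizer_replicate permutes_not_in)
      qed
    qed
    have "of_geven (det (kron r q g (restrict (\<lambda>c. \<pi> c div q) {..<?l}))) * E (restrict (\<lambda>c. \<pi> c div q) {..<?l})
        = of_geven (det g ^ q) * (ev (\<lambda>v c. rowpt ?lam y v (\<pi> c)) t * of_int (sign \<pi>))" if \<pi>: "\<pi> \<in> ?C" for \<pi>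
    proof -
      \<comment> \<open>For \<open>\<rho>\<close> coming from a column permutation, the matrix is
        the Kronecker product with permuted rows, so the sign of \<open>\<pi>\<close>
        reappears.\<close>
      have "kron r q g (restrict (\<lambda>c. \<pi> c div q) {..<?l})
          = mat ?l ?l (\<lambda>(i, j). kron r q g (\<lambda>c. c div q) $$ (\<pi> i, j))"
        using \<pi> lt by (intro eq_matI) (auto simp: kron_def column_stabilizer_replicate)
      moreover have "\<pi> permutes {0..<?l}" using \<pi> by (simp add: column_stabilizer_replicate atLeast0LessThan)
      ultimately have "det (kron r q g (restrict (\<lambda>c. \<pi> c div q) {..<?l})) = of_int (sign \<pi>) * det g ^ q"
        by (simp add: det_permute_rows[OF kron_carrier] det_kron[OF g])
      moreover have "E (restrict (\<lambda>c. \<pi> c div q) {..<?l}) = ev (\<lambda>v c. rowpt ?lam y v (\<pi> c)) t"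
        unfolding E_def using len \<pi> by (intro ev_cong) (simp add: rowpt)
      ultimately show ?thesis
        using mult_of_int_commute[of "sign \<pi>" "of_geven (det g ^ q) * ev (\<lambda>v c. rowpt ?lam y v (\<pi> c)) t"]
        by (simp add: of_geven_of_int mult.assoc)
    qed
    then show "sum ((\<lambda>\<rho>. of_geven (det (kron r q g \<rho>)) * E \<rho>) \<circ> (\<lambda>\<pi>. restrict (\<lambda>c. \<pi> c div q) {..<?l})) ?C
      = (\<Sum>\<pi>\<in>?C. of_geven (det g ^ q) * (ev (\<lambda>v c. rowpt ?lam y v (\<pi> c)) t * of_int (sign \<pi>)))"
      by (intro sum.cong) auto
  qed
  finally show ?thesis by (simp add: colev_def sum_distrib_left)
qed

section \<open>Canonical tensors\<close>

text \<open>\<open>\<xi> l k\<close> is the value of the odd letter \<open>m + l\<close> in row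
  \<open>k\<close>, with the letter first. Row \<open>m\<close>, present only in
  \<open>lam_g\<close>, gives 0 on all even letters.\<close>

definition normal_point :: "nat \<Rightarrow> (nat \<Rightarrow> nat \<Rightarrow> 'a::comm_ring_1 grassmann) \<Rightarrow> nat \<Rightarrow> nat \<Rightarrow> 'a grassmann" where
  "normal_point m \<xi> v k = (if v < m then if v = k then 1 else 0 else \<xi> (v - m) k)"

definition odd_matrix :: "(nat \<Rightarrow> nat \<Rightarrow> 'a::comm_ring_1 grassmann) \<Rightarrow> bool" where
  "odd_matrix \<xi> \<longleftrightarrow> (\<forall>l k. gparity True (\<xi> l k))"

lemma point_normal_point: "odd_matrix \<xi> \<Longrightarrow> point m (normal_point m \<xi>)"
  by (auto simp: point_def normal_point_def odd_matrix_def)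

lemma distinct_boxes: "distinct (boxes lam)"
proof -
  have "distinct (concat (map (\<lambda>i. map (Pair i) (f i)) xs))"
    if "distinct xs" "\<And>i. distinct (f i)" for f :: "nat \<Rightarrow> nat list" and xs
    using that by (induction xs) (auto simp: distinct_map inj_on_def)
  then show ?thesis unfolding boxes_def by simp
qed

lemma boxes_nth_inj:
  "c < sum_list lam \<Longrightarrow> d < sum_list lam \<Longrightarrow> boxes lam ! c = boxes lam ! d \<longleftrightarrow> c = d"
  using nth_eq_iff_index_eq[OF distinct_boxes] by (simp add: length_boxes)

lemma boxes_nth_mem: "c < sum_list lam \<Longrightarrow> boxes lam ! c \<in> set (boxes lam)"
  by (simp add: length_boxes)

lemma map_boxes_nth: "map f (boxes lam) = map (\<lambda>c. f (boxes lam ! c)) [0..<sum_list lam]"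
  by (rule nth_equalityI) (auto simp: length_boxes)

text \<open>The fiber \<open>B\<close> over \<open>j\<close> is split off: a fiber-preserving
  permutation is the composite of an arbitrary permutation of \<open>B\<close> and a
  fiber-preserving one of the rest \<open>A\<close>.\<close>

lemma card_fiber_permutations:
  assumes "finite J" "finite Q" "h ` Q \<subseteq> J"
  shows "card {\<sigma>. \<sigma> permutes Q \<and> (\<forall>c\<in>Q. h (\<sigma> c) = h c)} = (\<Prod>j\<in>J. fact (card {c \<in> Q. h c = j}))"
  using assms
proof (induction J arbitrary: Q)
  case empty
  then have "{\<sigma>. \<sigma> permutes Q \<and> (\<forall>c\<in>Q. h (\<sigma> c) = h c)} = {id}" by auto
  then show ?case by simp
next
  case (insert j J)
  define A where "A = {c \<in> Q. h c \<noteq> j}"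
  define B where "B = {c \<in> Q. h c = j}"
  have AB: "Q = A \<union> B" "A \<inter> B = {}" "finite A" "finite B" using insert.prems by (auto simp: A_def B_def)
  let ?P = "\<lambda>Q. {\<sigma>. \<sigma> permutes Q \<and> (\<forall>c\<in>Q. h (\<sigma> c) = h c)}"
  let ?r = "\<lambda>X \<sigma> c. if c \<in> X then \<sigma> c else c"
  have r: "?r X \<sigma> permutes X" if "\<sigma> permutes Q" "\<sigma> ` X \<subseteq> X" "finite X" for \<sigma> X
  proof (rule bij_imp_permutes)
    have "inj_on \<sigma> X" using permutes_inj[OF that(1)] by (rule inj_on_subset) simp
    then have "bij_betw \<sigma> X X" using that by (simp add: bij_betw_imageI endo_inj_surj)
    then show "bij_betw (?r X \<sigma>) X X" by (rule bij_betw_cong[THEN iffD1, rotated]) simp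
  qed simp
  have stable: "\<sigma> ` A \<subseteq> A" "\<sigma> ` B \<subseteq> B" if "\<sigma> \<in> ?P Q" for \<sigma>
    using that permutes_in_image[of \<sigma> Q] by (auto simp: A_def B_def)
  have "bij_betw (\<lambda>(p, q). p \<circ> q) (?P A \<times> {q. q permutes B}) (?P Q)"
  proof (rule bij_betw_byWitness[of _ "\<lambda>\<sigma>. (?r A \<sigma>, ?r B \<sigma>)"])
    show "\<forall>z\<in>?P A \<times> {q. q permutes B}. (\<lambda>\<sigma>. (?r A \<sigma>, ?r B \<sigma>)) ((\<lambda>(p, q). p \<circ> q) z) = z"
    proof (clarify, intro conjI ext, goal_cases)
      case (1 p q c)
      then have "q c = c" if "c \<in> A" using AB(2) permutes_not_in[of q B c] that by auto
      with 1 show ?case using permutes_not_in[of p A c] by auto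
    next
      case (2 p q c)
      then show ?case using AB(2) permutes_in_image[of q B c] permutes_not_in[of q B c] permutes_not_in[of p A "q c"] by auto
    qed
    show "\<forall>\<sigma>\<in>?P Q. (\<lambda>(p, q). p \<circ> q) ((\<lambda>\<sigma>. (?r A \<sigma>, ?r B \<sigma>)) \<sigma>) = \<sigma>"
    proof
      fix \<sigma> assume \<sigma>: "\<sigma> \<in> ?P Q"
      show "(\<lambda>(p, q). p \<circ> q) ((\<lambda>\<sigma>. (?r A \<sigma>, ?r B \<sigma>)) \<sigma>) = \<sigma>"
        using stable[OF \<sigma>] AB \<sigma> by (auto simp: fun_eq_iff permutes_not_in)
    qed
    show "(\<lambda>(p, q). p \<circ> q) ` (?P A \<times> {q. q permutes B}) \<subseteq> ?P Q"
    proof clarify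
      fix p q assume p: "p permutes A" "\<forall>c\<in>A. h (p c) = h c" and q: "q permutes B"
      have "p permutes Q" "q permutes Q" using p q AB(1) by (auto intro: permutes_subset)
      then have "p \<circ> q permutes Q" by (rule permutes_compose[rotated])
      moreover have "h ((p \<circ> q) c) = h c" if "c \<in> Q" for c
      proof (cases "c \<in> B")
        case True
        then have "q c \<in> B" using permutes_in_image[OF q] by simp
        then have "p (q c) = q c" using AB(2) permutes_not_in[OF p(1), of "q c"] by blast
        then show ?thesis using True \<open>q c \<in> B\<close> by (simp add: B_def)
      next
        case False
        then show ?thesis using that AB(1) p(2) permutes_not_in[OF q, of c] by auto
      qed
      ultimately show "p \<circ> q permutes Q \<and> (\<forall>c\<in>Q. h ((p \<circ> q) c) = h c)" by blast
    qed
    show "(\<lambda>\<sigma>. (?r A \<sigma>, ?r B \<sigma>)) ` ?P Q \<subseteq> ?P A \<times> {q. q permutes B}"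
    proof
      fix z assume "z \<in> (\<lambda>\<sigma>. (?r A \<sigma>, ?r B \<sigma>)) ` ?P Q"
      then obtain \<sigma> where \<sigma>: "\<sigma> \<in> ?P Q" "z = (?r A \<sigma>, ?r B \<sigma>)" by auto
      then show "z \<in> ?P A \<times> {q. q permutes B}"
        using r[of \<sigma> A] r[of \<sigma> B] stable[OF \<sigma>(1)] AB by auto
    qed
  qed
  then have "card (?P Q) = card (?P A) * card {q. q permutes B}"
    by (simp add: bij_betw_same_card[symmetric] card_cartesian_product)
  moreover have "card (?P A) = (\<Prod>i\<in>J. fact (card {c \<in> A. h c = i}))"
    using insert.prems by (intro insert.IH) (auto simp: A_def)
  moreover have "{c \<in> A. h c = i} = {c \<in> Q. h c = i}" if "i \<in> J" for i
    using that insert.hyps by (auto simp: A_def)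
  moreover have "card {q. q permutes B} = fact (card B)" using AB(4) by (simp add: card_permutations)
  ultimately show ?case using insert.hyps by (simp add: B_def)
qed

lemma evw_map_boxes:
  "evw (\<lambda>v c. rowpt lam y v (\<sigma> c)) (map f (boxes lam))
    = prod_list (map (\<lambda>c. y (f (boxes lam ! c)) (fst (boxes lam ! \<sigma> c))) [0..<sum_list lam])"
  unfolding evw_def rowpt_def by (rule arg_cong[of _ _ prod_list]) (auto simp: length_boxes)

text \<open>At a normalized point only the permutations that fix the even letters of a canonical filling
  contribute, and each contributes the same amount.\<close>

lemma colev_canonical:
  fixes \<xi> :: "nat \<Rightarrow> nat \<Rightarrow> 'a::comm_ring_1 grassmann"
  assumes f: "canonical m n lam f" and \<xi>: "odd_matrix \<xi>"
  shows "colev lam (normal_point m \<xi>) (Poly_Mapping.single (map f (boxes lam)) 1)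
    = of_nat (kappa m n lam f) * prod_list (map (\<lambda>b. normal_point m \<xi> (f b) (fst b)) (boxes lam))"
proof -
  let ?l = "sum_list lam" and ?b = "\<lambda>c. boxes lam ! c"
  let ?y = "normal_point m \<xi>"
  have f': "fst b < m \<and> f b = fst b \<or> snd b < n \<and> f b = m + snd b" if "b \<in> set (boxes lam)" for b
    using f that unfolding canonical_iff by (cases b) auto
  \<comment> \<open>\<open>Q\<close> consists of the positions with odd letters, \<open>C'\<close>
    of the column permutations that fix all other positions.\<close>
  define Q where "Q = {c. c < ?l \<and> m \<le> f (?b c)}"
  define C' where "C' = {\<sigma>. \<sigma> permutes Q \<and> (\<forall>c\<in>Q. snd (?b (\<sigma> c)) = snd (?b c))}"
  define z where "z c = ?y (f (?b c)) (fst (?b c))" for c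
  have Qf: "f (?b c) = m + snd (?b c)" "snd (?b c) < n" if "c \<in> Q" for c
    using f'[OF boxes_nth_mem[of c lam]] that by (auto simp: Q_def)
  have nQ: "f (?b c) = fst (?b c)" "f (?b c) < m" if "c < ?l" "c \<notin> Q" for c
    using f'[OF boxes_nth_mem[of c lam]] that by (auto simp: Q_def)
  have C'C: "C' \<subseteq> column_stabilizer lam"
  proof
    fix \<sigma> assume \<sigma>: "\<sigma> \<in> C'"
    then have "\<sigma> permutes {..<?l}" by (auto simp: C'_def Q_def intro: permutes_subset)
    moreover have "snd (?b (\<sigma> c)) = snd (?b c)" for c
      using \<sigma> permutes_not_in[of \<sigma> Q c] by (cases "c \<in> Q") (auto simp: C'_def)
    ultimately show "\<sigma> \<in> column_stabilizer lam" by (simp add: column_stabilizer_def)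
  qed
  have 0: "evw (\<lambda>v c. rowpt lam ?y v (\<sigma> c)) (map f (boxes lam)) = 0" if \<sigma>: "\<sigma> \<in> column_stabilizer lam - C'" for \<sigma>
  proof -
    have per: "\<sigma> permutes {..<?l}" using \<sigma> column_stabilizerD(1) by blast
    \<comment> \<open>A column permutation that keeps the row of every even position fixes these
      positions and lies in \<open>C'\<close>. Any other one puts an even letter into a foreign row,
      where its value is 0.\<close>
    have "\<exists>c<?l. c \<notin> Q \<and> fst (?b (\<sigma> c)) \<noteq> fst (?b c)"
    proof (rule ccontr)
      assume *: "\<not> ?thesis"
      have "\<sigma> c = c" if "c \<in> {..<?l} - Q" for c
      proof -
        have "\<sigma> c < ?l" using permutes_in_image[OF per, of c] that by simp
        moreover have "?b (\<sigma> c) = ?b c"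
          using * that \<sigma> column_stabilizerD(2)[of \<sigma> lam c] by (auto simp: prod_eq_iff)
        ultimately show ?thesis using boxes_nth_inj[of "\<sigma> c" lam c] that by simp
      qed
      then have "\<sigma> permutes Q" by (rule permutes_superset[OF per])
      then have "\<sigma> \<in> C'" using \<sigma> column_stabilizerD(2)[of \<sigma> lam] by (auto simp: C'_def Q_def)
      then show False using \<sigma> by simp
    qed
    then obtain c where c: "c < ?l" "c \<notin> Q" "fst (?b (\<sigma> c)) \<noteq> fst (?b c)" by blast
    then have "?y (f (?b c)) (fst (?b (\<sigma> c))) = 0" using nQ[of c] by (simp add: normal_point_def)
    then show ?thesis unfolding evw_map_boxes using c(1) by (intro prod_list_eq_0) (force simp: image_iff)
  qed
  have P: "evw (\<lambda>v c. rowpt lam ?y v (\<sigma> c)) (map f (boxes lam)) = of_int (sign \<sigma>) * prod_list (map z [0..<?l])"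
    if \<sigma>: "\<sigma> \<in> C'" for \<sigma>
  proof -
    have per: "\<sigma> permutes Q" using \<sigma> by (simp add: C'_def)
    have "?y (f (?b c)) (fst (?b (\<sigma> c))) = z (\<sigma> c)" for c
    proof (cases "c \<in> Q")
      case True
      then have "\<sigma> c \<in> Q" using permutes_in_image[OF per] by simp
      then have "f (?b (\<sigma> c)) = f (?b c)" using Qf[of c] Qf[of "\<sigma> c"] True \<sigma> by (simp add: C'_def)
      then show ?thesis by (simp add: z_def)
    next
      case False
      then show ?thesis using permutes_not_in[OF per] by (simp add: z_def)
    qed
    then have "evw (\<lambda>v c. rowpt lam ?y v (\<sigma> c)) (map f (boxes lam)) = prod_list (map (\<lambda>c. z (\<sigma> c)) [0..<?l])"
      unfolding evw_map_boxes by simp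
    also have "\<dots> = of_int (sign \<sigma>) * prod_list (map z [0..<?l])"
    proof (rule prod_list_permute_odd[OF per, of _ "\<lambda>c. m \<le> f (?b c)"])
      show "gparity (m \<le> f (?b c)) (z c)" for c
        using point_normal_point[OF \<xi>, of m] by (simp add: z_def point_def)
    qed (auto simp: Q_def)
    finally show ?thesis .
  qed
  have "card C' = (\<Prod>j<n. fact (card {c \<in> Q. snd (?b c) = j}))"
    unfolding C'_def by (rule card_fiber_permutations) (use Qf(2) in \<open>auto simp: Q_def\<close>)
  also have "\<dots> = kappa m n lam f"
    unfolding kappa_def
  proof (intro prod.cong refl arg_cong[of _ _ fact])
    fix j assume "j \<in> {..<n}"
    show "card {c \<in> Q. snd (?b c) = j} = card {i. (i, j) \<in> set (boxes lam) \<and> f (i, j) = m + j}"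
    proof (rule bij_betw_same_card[of "\<lambda>c. fst (?b c)"], rule bij_betw_imageI)
      show "inj_on (\<lambda>c. fst (?b c)) {c \<in> Q. snd (?b c) = j}"
      proof (rule inj_onI)
        fix c d assume "c \<in> {c \<in> Q. snd (?b c) = j}" "d \<in> {c \<in> Q. snd (?b c) = j}" "fst (?b c) = fst (?b d)"
        then have "?b c = ?b d" "c < ?l" "d < ?l" by (auto simp: prod_eq_iff Q_def)
        then show "c = d" using boxes_nth_inj by simp
      qed
      show "(\<lambda>c. fst (?b c)) ` {c \<in> Q. snd (?b c) = j} = {i. (i, j) \<in> set (boxes lam) \<and> f (i, j) = m + j}"
      proof (intro equalityI subsetI)
        fix i assume "i \<in> (\<lambda>c. fst (?b c)) ` {c \<in> Q. snd (?b c) = j}"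
        then obtain c where c: "c \<in> Q" "?b c = (i, j)" by force
        then show "i \<in> {i. (i, j) \<in> set (boxes lam) \<and> f (i, j) = m + j}"
          using Qf(1)[OF c(1)] boxes_nth_mem[of c lam] by (auto simp: Q_def)
      next
        fix i assume i: "i \<in> {i. (i, j) \<in> set (boxes lam) \<and> f (i, j) = m + j}"
        then obtain c where c: "c < ?l" "?b c = (i, j)" by (auto simp: in_set_conv_nth length_boxes)
        then have "c \<in> {c \<in> Q. snd (?b c) = j}" using i by (simp add: Q_def)
        then show "i \<in> (\<lambda>c. fst (?b c)) ` {c \<in> Q. snd (?b c) = j}" using c(2) by (intro image_eqI[of _ _ c]) auto
      qed
    qed
  qed
  finally have card: "card C' = kappa m n lam f" .
  have "colev lam ?y (Poly_Mapping.single (map f (boxes lam)) 1) =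
    (\<Sum>\<sigma>\<in>column_stabilizer lam. evw (\<lambda>v c. rowpt lam ?y v (\<sigma> c)) (map f (boxes lam)) * of_int (sign \<sigma>))"
    by (simp add: colev_def ev_single)
  also have "\<dots> = (\<Sum>\<sigma>\<in>C'. evw (\<lambda>v c. rowpt lam ?y v (\<sigma> c)) (map f (boxes lam)) * of_int (sign \<sigma>))"
    using C'C 0 by (intro sum.mono_neutral_right) auto
  \<comment> \<open>Reordering odd factors produces the signature once more, and the two signs
    cancel. Antisymmetrization acts on equal odd letters as symmetrization, so the terms add
    up.\<close>
  also have "\<dots> = (\<Sum>\<sigma>\<in>C'. prod_list (map z [0..<?l]))"
  proof (intro sum.cong refl)
    fix \<sigma> assume "\<sigma> \<in> C'"
    have "of_int (sign \<sigma>) * of_int (sign \<sigma>) = (1 :: 'a grassmann)"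
      by (simp flip: of_int_mult)
    then show "evw (\<lambda>v c. rowpt lam ?y v (\<sigma> c)) (map f (boxes lam)) * of_int (sign \<sigma>) = prod_list (map z [0..<?l])"
      unfolding P[OF \<open>\<sigma> \<in> C'\<close>] by (subst mult_of_int_commute[symmetric]) (simp flip: mult.assoc)
  qed
  also have "\<dots> = of_nat (kappa m n lam f) * prod_list (map z [0..<?l])" using card by simp
  finally show ?thesis unfolding z_def map_boxes_nth .
qed

section \<open>Monomials in odd elements\<close>

lemma prod_list_normal_point:
  "prod_list (map (\<lambda>x. normal_point m \<xi> (v x) (k x)) xs) =
    (if \<exists>x\<in>set xs. v x < m \<and> v x \<noteq> k x then 0
     else prod_list (map (\<lambda>(l, k). \<xi> l k) (map (\<lambda>x. (v x - m, k x)) (filter (\<lambda>x. m \<le> v x) xs))))"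
  by (induction xs) (auto simp: normal_point_def)

text \<open>Moving the second copy of a repeated factor to the first produces the square of an odd
  element, up to sign.\<close>

lemma prod_list_odd_repeated:
  fixes z :: "'b \<Rightarrow> 'a::field_char_0 grassmann"
  assumes z: "\<And>x. gparity True (z x)" and "\<not> distinct xs"
  shows "prod_list (map z xs) = 0"
proof -
  obtain as bs cs x where xs: "xs = as @ [x] @ bs @ [x] @ cs"
    using not_distinct_decomp[OF assms(2)] by blast
  have "gparity (odd (length bs)) (prod_list (map z bs))"
    using gparity_prod_list[of bs "\<lambda>_. True" z] z by simp
  then have "prod_list (map z bs) * z x = (if odd (length bs) then - 1 else 1) * (z x * prod_list (map z bs))"
    using supercommute[OF z[of x], of "odd (length bs)" "prod_list (map z bs)"] by simp
  moreover have "z x * (z x * prod_list (map z bs)) = 0"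
    using odd_square_zero[OF z[of x]] by (simp flip: mult.assoc)
  ultimately have *: "z x * (prod_list (map z bs) * z x) = 0" by simp
  have "z x * (prod_list (map z bs) * (z x * prod_list (map z cs))) = 0"
    using arg_cong[OF *, of "\<lambda>u. u * prod_list (map z cs)"] by (simp add: mult.assoc)
  then show ?thesis unfolding xs by simp
qed

text \<open>The sign depends only on the two lists: \<open>e\<close> is chosen before
  \<open>z\<close>, so one integer serves all odd matrices at once.\<close>

lemma prod_list_odd_rearrange:
  assumes "mset xs = mset ys"
  shows "\<exists>e :: int. \<forall>z :: 'b \<Rightarrow> 'a::comm_ring_1 grassmann. (\<forall>x. gparity True (z x)) \<longrightarrow>
    prod_list (map z xs) = of_int e * prod_list (map z ys)"
  using assms
proof (induction xs arbitrary: ys)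
  case Nil
  then show ?case by (intro exI[of _ 1]) simp
next
  case (Cons x xs)
  then have "x \<in> set ys" by (metis list.set_intros(1) set_mset_mset)
  then obtain as bs where ys: "ys = as @ x # bs" by (meson split_list)
  then have "mset xs = mset (as @ bs)" using Cons.prems by simp
  from Cons.IH[OF this] obtain e :: int where e: "\<And>z :: 'b \<Rightarrow> 'a grassmann. \<forall>x. gparity True (z x) \<Longrightarrow>
    prod_list (map z xs) = of_int e * prod_list (map z (as @ bs))" by blast
  show ?case
  proof (intro exI allI impI)
    fix z :: "'b \<Rightarrow> 'a grassmann" assume z: "\<forall>x. gparity True (z x)"
    have "gparity (odd (length as)) (prod_list (map z as))"
      using gparity_prod_list[of as "\<lambda>_. True" z] z by simp
    then have sw: "z x * prod_list (map z as) = (- 1) ^ length as * (prod_list (map z as) * z x)"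
      using supercommute[of "odd (length as)" "prod_list (map z as)" True "z x"] z
      by (simp add: minus_one_power_iff)
    have "prod_list (map z (x # xs)) = z x * of_int e * (prod_list (map z as) * prod_list (map z bs))"
      using e[OF z] by (simp add: mult.assoc)
    also have "\<dots> = of_int e * (z x * prod_list (map z as)) * prod_list (map z bs)"
      unfolding mult_of_int_commute[of e "z x", symmetric] by (simp add: mult.assoc)
    also have "\<dots> = of_int (e * (- 1) ^ length as) * prod_list (map z ys)"
      unfolding sw ys by (simp add: mult.assoc)
    finally show "prod_list (map z (x # xs)) = of_int (e * (- 1) ^ length as) * prod_list (map z ys)" .
  qed
qed

section \<open>The canonical tensors form a basis\<close>

definition shape :: "nat \<Rightarrow> nat \<Rightarrow> nat list \<Rightarrow> bool" where
  "shape m n lam \<longleftrightarrow> lam = lam_h m n \<or> lam = lam_g m n"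

lemma set_boxes_replicate: "set (boxes (replicate r q)) = {..<r} \<times> {..<q}"
  by (auto simp: set_boxes)

lemma shape_boxes:
  assumes "shape m n lam"
  shows "{..<m} \<times> {..<n} \<subseteq> set (boxes lam)"
    and "m \<le> length lam"
    and "b \<in> set (boxes lam) \<Longrightarrow> j < n \<Longrightarrow> (fst b, j) \<in> set (boxes lam)"
  using assms unfolding shape_def lam_h_def lam_g_def
  by (auto simp: set_boxes_replicate simp del: replicate_Suc)

text \<open>\<open>S\<close> is the set of boxes of the small rectangle with odd letters. The test
  \<open>m \<le> fst b\<close> makes the bottom row of \<open>lam_g\<close> odd, while the last
  column of \<open>lam_h\<close>, lying outside \<open>S\<close>, gets even letters; one formula
  thus encodes the canonical fillings of both diagrams.\<close>

definition fill :: "nat \<Rightarrow> (nat \<times> nat) set \<Rightarrow> nat \<times> nat \<Rightarrow> nat" where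
  "fill m S b = (if b \<in> S \<or> m \<le> fst b then m + snd b else fst b)"

lemma canonical_fill:
  assumes "shape m n lam" "S \<subseteq> {..<m} \<times> {..<n}"
  shows "canonical m n lam (fill m S)"
  using assms unfolding shape_def by (auto simp: canonical_lam_h canonical_lam_g fill_def)

definition monomial :: "nat \<Rightarrow> nat list \<Rightarrow> (nat \<Rightarrow> nat \<Rightarrow> 'a::comm_ring_1 grassmann) \<Rightarrow> (nat \<times> nat) set \<Rightarrow> 'a grassmann" where
  "monomial m lam \<xi> S = prod_list (map (\<lambda>b. normal_point m \<xi> (fill m S b) (fst b)) (boxes lam))"

text \<open>Exactly \<open>n\<close> positions are sent to the bottom row; carrying distinct labels
  below \<open>n\<close>, they carry all of them. In \<open>lam_g\<close> this row admits no even
  letter of nonzero value, so the labels are the odd letters.\<close>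

lemma bottom_row_full:
  assumes \<sigma>: "\<sigma> permutes {..<Suc m * n}"
    and "\<And>c. c < Suc m * n \<Longrightarrow> \<sigma> c div n = m \<Longrightarrow> v c < n"
    and "\<And>c d. c < Suc m * n \<Longrightarrow> d < Suc m * n \<Longrightarrow> \<sigma> c div n = m \<Longrightarrow> \<sigma> d div n = m \<Longrightarrow> v c = v d \<Longrightarrow> c = d"
    and j: "j < n"
  obtains c where "c < Suc m * n" "\<sigma> c div n = m" "v c = j"
proof -
  let ?L = "Suc m * n"
  define Q where "Q = {c. c < ?L \<and> \<sigma> c div n = m}"
  have n: "n > 0" using j by simp
  have "\<sigma> ` Q = {m * n..<Suc m * n}"
  proof (intro equalityI subsetI)
    fix d assume "d \<in> \<sigma> ` Q"
    then have "d < ?L" "d div n = m" using permutes_in_image[OF \<sigma>] by (auto simp: Q_def)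
    then show "d \<in> {m * n..<Suc m * n}" using n by (simp add: less_eq_div_iff_mult_less_eq[symmetric])
  next
    fix d assume d: "d \<in> {m * n..<Suc m * n}"
    then have "d div n = m" by (intro div_nat_eqI) (auto simp: mult.commute)
    moreover obtain c where "c < ?L" "d = \<sigma> c"
      using d permutes_image[OF \<sigma>] by (metis atLeastLessThan_iff imageE lessThan_iff)
    ultimately show "d \<in> \<sigma> ` Q" by (auto simp: Q_def)
  qed
  moreover have "inj_on \<sigma> Q" using permutes_inj[OF \<sigma>] by (rule inj_on_subset) simp
  ultimately have "card Q = n" using card_image[of \<sigma> Q] by simp
  moreover have "inj_on v Q" using assms(3) by (auto simp: inj_on_def Q_def)
  moreover have sub: "v ` Q \<subseteq> {..<n}" using assms(2) by (auto simp: Q_def)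
  ultimately have "v ` Q = {..<n}" by (intro card_subset_eq) (auto simp: card_image)
  then have "j \<in> v ` Q" using j by simp
  then obtain c where "c \<in> Q" "j = v c" by (rule imageE)
  then show ?thesis using that[of c] by (simp add: Q_def)
qed

text \<open>Odd factors can be reordered up to sign, so a nonzero term depends only on the pairs of
  odd letter and row that occur. A pair in a row \<open>k < m\<close> marks the box of that row
  whose column is the index of the letter; the bottom row of \<open>lam_g\<close>, if present,
  contains every odd letter. These are the pairs of a canonical filling. Neither \<open>S\<close>
  nor \<open>e\<close> depends on \<open>\<xi>\<close>.\<close>

lemma word_monomial:
  assumes lam: "shape m n lam" and w: "length w = sum_list lam" "\<And>c. c < sum_list lam \<Longrightarrow> w ! c < m + n"
    and \<sigma>: "\<sigma> permutes {..<sum_list lam}"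
  shows "\<exists>S (e::int). S \<subseteq> {..<m} \<times> {..<n} \<and> (\<forall>\<xi> :: nat \<Rightarrow> nat \<Rightarrow> 'a::field_char_0 grassmann. odd_matrix \<xi> \<longrightarrow>
    evw (\<lambda>v c. rowpt lam (normal_point m \<xi>) v (\<sigma> c)) w = of_int e * monomial m lam \<xi> S)"
proof -
  let ?L = "sum_list lam"
  define row where "row c = fst (boxes lam ! \<sigma> c)" for c
  define xs where "xs = filter (\<lambda>c. m \<le> w ! c) [0..<?L]"
  define K where "K = map (\<lambda>c. (w ! c - m, row c)) xs"
  have lt: "\<sigma> c < ?L" if "c < ?L" for c using permutes_in_image[OF \<sigma>] that by simp
  have evw: "evw (\<lambda>v c. rowpt lam (normal_point m \<xi>) v (\<sigma> c)) w =
      (if \<exists>c<?L. w ! c < m \<and> w ! c \<noteq> row c then 0 else prod_list (map (\<lambda>(l, k). \<xi> l k) K))"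
    for \<xi> :: "nat \<Rightarrow> nat \<Rightarrow> 'a grassmann"
    using prod_list_normal_point[of m \<xi> "\<lambda>c. w ! c" row "[0..<?L]"] w(1)
    by (auto simp: evw_def rowpt_def row_def K_def xs_def)
  show ?thesis
  proof (cases "(\<exists>c<?L. w ! c < m \<and> w ! c \<noteq> row c) \<or> \<not> distinct K")
    case True
    have "evw (\<lambda>v c. rowpt lam (normal_point m \<xi>) v (\<sigma> c)) w = 0" if "odd_matrix \<xi>"
      for \<xi> :: "nat \<Rightarrow> nat \<Rightarrow> 'a grassmann"
      unfolding evw using True prod_list_odd_repeated[of "\<lambda>(l, k). \<xi> l k" K] that
      by (auto simp: odd_matrix_def)
    \<comment> \<open>A vanishing term is recorded with the factor 0; the empty set is a
      default.\<close>
    then show ?thesis by (intro exI[of _ "{}"] exI[of _ 0]) auto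
  next
    case False
    then have even: "w ! c = row c" if "c < ?L" "w ! c < m" for c using that by blast
    have K: "distinct K" using False by simp
    have xs: "c \<in> set xs \<longleftrightarrow> c < ?L \<and> m \<le> w ! c" for c by (auto simp: xs_def)
    define S where "S = {(i, j). i < m \<and> (j, i) \<in> set K}"
    have Kn: "l < n" "(k, l) \<in> set (boxes lam)" if "(l, k) \<in> set K" for l k
    proof -
      obtain c where c: "c < ?L" "m \<le> w ! c" "l = w ! c - m" "k = row c" using \<open>(l, k) \<in> set K\<close> xs by (auto simp: K_def)
      then show "l < n" using w(2)[of c] by simp
      then show "(k, l) \<in> set (boxes lam)"
        using shape_boxes(3)[OF lam boxes_nth_mem[OF lt[OF c(1)]]] c(4) by (simp add: row_def)
    qed
    then have S: "S \<subseteq> {..<m} \<times> {..<n}" by (auto simp: S_def)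
    define K' where "K' = map (\<lambda>b. (fill m S b - m, fst b)) (filter (\<lambda>b. m \<le> fill m S b) (boxes lam))"
    have fill: "m \<le> fill m S b \<longleftrightarrow> b \<in> S \<or> m \<le> fst b" for b by (auto simp: fill_def)
    then have K'eq: "K' = map (\<lambda>b. (snd b, fst b)) (filter (\<lambda>b. b \<in> S \<or> m \<le> fst b) (boxes lam))"
      by (auto simp: K'_def fill_def)
    have mono: "monomial m lam \<xi> S = prod_list (map (\<lambda>(l, k). \<xi> l k) K')" for \<xi> :: "nat \<Rightarrow> nat \<Rightarrow> 'a grassmann"
      unfolding monomial_def K'_def prod_list_normal_point by (auto simp: fill_def split: if_splits)
    have "distinct K'"
      unfolding K'eq using distinct_boxes by (auto simp: distinct_map inj_on_def prod_eq_iff)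
    moreover have "set K = set K'"
    proof (intro equalityI subsetI; clarify)
      fix l k assume "(l, k) \<in> set K"
      then show "(l, k) \<in> set K'"
        using Kn[of l k] by (force simp: K'eq S_def image_iff)
    next
      fix l k assume "(l, k) \<in> set K'"
      then have lk: "(k, l) \<in> set (boxes lam)" "(k, l) \<in> S \<or> m \<le> k" by (auto simp: K'eq)
      show "(l, k) \<in> set K"
      proof (cases "(k, l) \<in> S")
        case True
        then show ?thesis by (simp add: S_def)
      next
        case False
        \<comment> \<open>Pairs of \<open>K'\<close> that do not come from \<open>S\<close> lie in
          the bottom row of \<open>lam_g\<close>, where all odd letters have to be found in
          \<open>K\<close>.\<close>
        then have mk: "m \<le> k" using lk by simp
        then have lg: "lam = replicate (Suc m) n" and k: "k = m" "l < n"
          using lk(1) lam by (auto simp: shape_def lam_h_def lam_g_def set_boxes_replicate simp del: replicate_Suc)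
        have L: "?L = Suc m * n" by (simp add: lg sum_list_replicate del: replicate_Suc)
        have row: "row c = \<sigma> c div n" if "c < ?L" for c
          using lt[OF that] unfolding row_def lg L[unfolded lg] by (simp add: boxes_replicate_nth del: replicate_Suc mult_Suc)
        have odd: "m \<le> w ! c" if "c < ?L" "\<sigma> c div n = m" for c
          using even[of c] row[of c] that by (cases "w ! c < m") auto
        have inj: "inj_on (\<lambda>c. (w ! c - m, row c)) (set xs)" using K by (simp add: K_def distinct_map)
        obtain c where "c < Suc m * n" "\<sigma> c div n = m" "w ! c - m = l"
        proof (rule bottom_row_full[of \<sigma> m n "\<lambda>c. w ! c - m" l])
          show "\<sigma> permutes {..<Suc m * n}" using \<sigma> L by simp
          show "w ! c - m < n" if "c < Suc m * n" "\<sigma> c div n = m" for c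
            using odd[of c] w(2)[of c] that L by simp
          show "c = d" if "c < Suc m * n" "d < Suc m * n" "\<sigma> c div n = m" "\<sigma> d div n = m" "w ! c - m = w ! d - m" for c d
            using inj_onD[OF inj, of c d] that L row[of c] row[of d] odd[of c] odd[of d] xs by simp
        qed (use k in auto)
        then show ?thesis using xs[of c] odd[of c] row[of c] L k by (auto simp: K_def image_iff intro!: bexI[of _ c])
      qed
    qed
    ultimately have "mset K = mset K'" using K by (simp add: set_eq_iff_mset_eq_distinct)
    from prod_list_odd_rearrange[OF this] obtain e :: int where e: "\<And>z :: nat \<times> nat \<Rightarrow> 'a grassmann. \<forall>x. gparity True (z x) \<Longrightarrow>
      prod_list (map z K) = of_int e * prod_list (map z K')" by blast
    have "evw (\<lambda>v c. rowpt lam (normal_point m \<xi>) v (\<sigma> c)) w = of_int e * monomial m lam \<xi> S" if "odd_matrix \<xi>"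
      for \<xi> :: "nat \<Rightarrow> nat \<Rightarrow> 'a grassmann"
      unfolding evw mono using False e[of "\<lambda>(l, k). \<xi> l k"] that by (auto simp: odd_matrix_def)
    with S show ?thesis by blast
  qed
qed

section \<open>Inverse matrices and normalization of points\<close>

lemma gbody_comm_ring_hom: "comm_ring_hom (\<lambda>x :: 'a::comm_ring_1 geven. gbody (of_geven x))"
  by unfold_locales auto

text \<open>The even part is a commutative ring in which the determinant is a unit by
  \<open>geven_unit\<close>, so the adjugate provides the inverse.\<close>

lemma geven_matrix_inverse:
  fixes g :: "'a::field geven mat"
  assumes g: "g \<in> carrier_mat r r" and body: "gbody (of_geven (det g)) \<noteq> 0"
  obtains g' where "g' \<in> carrier_mat r r" "g * g' = 1\<^sub>m r" "g' * g = 1\<^sub>m r"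
proof -
  obtain u where u: "det g * u = 1" by (rule geven_unit[OF body])
  show ?thesis
  proof (rule that[of "u \<cdot>\<^sub>m adj_mat g"])
    have "u * det g = 1" using u by (simp add: mult.commute)
    then show "g * (u \<cdot>\<^sub>m adj_mat g) = 1\<^sub>m r" "(u \<cdot>\<^sub>m adj_mat g) * g = 1\<^sub>m r"
      using adj_mat[OF g] g by (simp_all add: mult_smult_distrib[of _ r r] mult_smult_assoc_mat[of _ r r])
        (auto intro!: eq_matI)
  qed (use adj_mat(1)[OF g] in simp)
qed

lemma gbody_det:
  assumes g: "g \<in> carrier_mat r r"
  shows "gbody (of_geven (det g)) = det (mat r r (\<lambda>(i, j). gbody (of_geven (g $$ (i, j)))))"
proof -
  have "map_mat (\<lambda>x. gbody (of_geven x)) g = mat r r (\<lambda>(i, j). gbody (of_geven (g $$ (i, j))))"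
    using g by (intro eq_matI) auto
  then show ?thesis using comm_ring_hom.hom_det[OF gbody_comm_ring_hom, of g] by simp
qed

text \<open>The even letters give the first \<open>m\<close> rows of \<open>g\<close>; any further
  row is that of the identity matrix. The body of \<open>g\<close> is then the identity, so
  \<open>g\<close> is invertible, and \<open>y\<close> times the inverse of \<open>g\<close> is
  normalized.\<close>

lemma normalize_point:
  fixes y :: "nat \<Rightarrow> nat \<Rightarrow> 'a::field_char_0 grassmann"
  assumes y: "point m y" "\<And>v k. v < m \<Longrightarrow> gbody (y v k) = (if v = k then 1 else 0)" and r: "m \<le> r"
  obtains g \<xi> where "g \<in> carrier_mat r r" "odd_matrix \<xi>"
    "\<And>v k. k < r \<Longrightarrow> y v k = (\<Sum>k'<r. normal_point m \<xi> v k' * of_geven (g $$ (k', k)))"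
proof -
  define g where "g = mat r r (\<lambda>(k', k). if k' < m then to_geven (y k' k) else if k' = k then 1 else 0)"
  have g: "g \<in> carrier_mat r r" by (simp add: g_def)
  have yg: "of_geven (g $$ (v, k)) = y v k" if "v < m" "k < r" for v k
    using that r y(1) by (auto simp: g_def point_def intro!: of_geven_to_geven) (metis not_le)
  have "mat r r (\<lambda>(i, j). gbody (of_geven (g $$ (i, j)))) = 1\<^sub>m r"
  proof (rule eq_matI)
    fix i j assume "i < dim_row (1\<^sub>m r)" "j < dim_col (1\<^sub>m r)"
    then show "mat r r (\<lambda>(i, j). gbody (of_geven (g $$ (i, j)))) $$ (i, j) = 1\<^sub>m r $$ (i, j)"
      using yg[of i j] y(2)[of i j] by (cases "i < m") (auto simp: g_def)
  qed auto
  then have "gbody (of_geven (det g)) \<noteq> 0" unfolding gbody_det[OF g] by simp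
  from geven_matrix_inverse[OF g this] obtain g' where
    g': "g' \<in> carrier_mat r r" "g * g' = 1\<^sub>m r" "g' * g = 1\<^sub>m r" .
  have gg: "(\<Sum>k''<r. a $$ (i, k'') * b $$ (k'', j)) = (if i = j then 1 else 0)"
    if "a * b = 1\<^sub>m r" "a \<in> carrier_mat r r" "b \<in> carrier_mat r r" "i < r" "j < r" for a b :: "'a geven mat" and i j
  proof -
    have 1: "(a * b) $$ (i, j) = (\<Sum>k''<r. a $$ (i, k'') * b $$ (k'', j))"
      using that(2-) by (simp add: scalar_prod_def atLeast0LessThan)
    have 2: "(a * b) $$ (i, j) = (if i = j then 1 else 0)" using that by simp
    show ?thesis by (rule trans[OF 1[symmetric] 2])
  qed
  define y0 where "y0 v k = (\<Sum>k'<r. y v k' * of_geven (g' $$ (k', k)))" for v k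
  define \<xi> where "\<xi> l k = y0 (m + l) k" for l k
  have "gparity (m \<le> v) (y v k' * of_geven (g' $$ (k', k)))" for v k k'
    using gparity_mult[OF _ gparity_of_geven, of "m \<le> v" "y v k'"] y(1) by (simp add: point_def)
  then have par: "gparity (m \<le> v) (y0 v k)" for v k unfolding y0_def by (intro gparity_sum)
  have "odd_matrix \<xi>" unfolding odd_matrix_def \<xi>_def
  proof (intro allI)
    show "gparity True (y0 (m + l) k)" for l k using par[of "m + l" k] by simp
  qed
  moreover have "normal_point m \<xi> v k = y0 v k" if "k < r" for v k
  proof (cases "v < m")
    case True
    have "y0 v k = of_geven (\<Sum>k'<r. g $$ (v, k') * g' $$ (k', k))"
      unfolding y0_def using True yg by (simp add: of_geven_sum)
    then show ?thesis using True that r gg[OF g'(2) g g'(1), of v k] by (auto simp: normal_point_def)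
  qed (simp add: normal_point_def \<xi>_def)
  moreover have "y v k = (\<Sum>k'<r. y0 v k' * of_geven (g $$ (k', k)))" if "k < r" for v k
  proof -
    have "(\<Sum>k'<r. y0 v k' * of_geven (g $$ (k', k)))
        = (\<Sum>k''<r. y v k'' * of_geven (\<Sum>k'<r. g' $$ (k'', k') * g $$ (k', k)))"
      unfolding y0_def by (simp add: sum_distrib_right sum_distrib_left of_geven_sum mult.assoc) (rule sum.swap)
    also have "\<dots> = (\<Sum>k''<r. if k'' = k then y v k'' else 0)"
      using that by (intro sum.cong refl) (simp add: gg[OF g'(3) g'(1) g])
    finally show ?thesis using that by simp
  qed
  ultimately show ?thesis using that[OF g, of \<xi>] by simp
qed

section \<open>Linearity and the submodules \<open>W\<close>\<close>

lemma rscale_0 [simp]: "rscale 0 a = 0" and rscale_add: "rscale (s + t) a = rscale s a + rscale t a"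
  and rscale_rscale: "rscale (rscale t a) b = rscale t (a * b)"
  and rscale_add_right: "rscale t (a + b) = rscale t a + rscale t b"
  and rscale_0_right [simp]: "rscale t 0 = 0" and rscale_1 [simp]: "rscale t 1 = t"
  by (rule poly_mapping_eqI; simp add: lookup_rscale lookup_add distrib_left distrib_right mult.assoc)+

lemma rscale_sum: "rscale (sum f I) a = (\<Sum>i\<in>I. rscale (f i) a)"
  by (induction I rule: infinite_finite_induct) (auto simp: rscale_add)

lemma colev_diff: "colev lam y (s - t) = colev lam y s - colev lam y t"
  by (simp add: colev_def ev_diff left_diff_distrib sum_subtractf)

lemma colev_sum: "colev lam y (sum f I) = (\<Sum>i\<in>I. colev lam y (f i))"
  unfolding colev_def by (simp add: ev_sum sum_distrib_right) (rule sum.swap)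

lemma colev_rscale: "colev lam y (rscale t a) = colev lam y t * a"
proof -
  have "x * a * of_int k = x * of_int k * a" for x and k :: int
    using mult_of_int_commute[of k a] by (simp add: mult.assoc)
  then show ?thesis by (simp add: colev_def ev_rscale sum_distrib_right)
qed

lemma young_act_add:
  fixes s t :: "'a::comm_ring_1 tensor"
  assumes "s \<in> tensor_power m' n (sum_list lam)" "t \<in> tensor_power m' n (sum_list lam)"
  shows "young_act m lam (s + t) = young_act m lam s + young_act m lam t"
proof (rule tensor_eqI[where m = m, of _ m' n "sum_list lam"])
  fix y :: "nat \<Rightarrow> nat \<Rightarrow> 'a grassmann" assume y: "point m y"
  show "ev y (young_act m lam (s + t)) = ev y (young_act m lam s + young_act m lam t)"
    unfolding ev_add ev_young_act[OF y assms(1)] ev_young_act[OF y assms(2)]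
      ev_young_act[OF y tensor_power_add[OF assms]] by (simp add: distrib_right sum.distrib)
qed (use assms in \<open>auto intro: tensor_power_add tensor_power_young_act\<close>)

lemma young_act_rscale:
  fixes t :: "'a::comm_ring_1 tensor"
  assumes t: "t \<in> tensor_power m' n (sum_list lam)"
  shows "young_act m lam (rscale t a) = rscale (young_act m lam t) a"
proof (rule tensor_eqI[where m = m, of _ m' n "sum_list lam"])
  fix y :: "nat \<Rightarrow> nat \<Rightarrow> 'a grassmann" assume y: "point m y"
  have "x * a * of_int k = x * of_int k * a" for x and k :: int
    using mult_of_int_commute[of k a] by (simp add: mult.assoc)
  then show "ev y (young_act m lam (rscale t a)) = ev y (rscale (young_act m lam t) a)"
    unfolding ev_rscale ev_young_act[OF y t] ev_young_act[OF y tensor_power_rscale[OF t]]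
    by (simp add: sum_distrib_right)
qed (use t in \<open>auto intro: tensor_power_rscale tensor_power_young_act\<close>)

lemma young_act_0 [simp]: "young_act m lam 0 = 0"
proof -
  have "young_act m lam 0 + young_act m lam 0 = young_act m lam 0"
    using young_act_add[of 0 0 0 lam 0 m] by simp
  then show ?thesis by simp
qed

lemma young_act_sum:
  assumes "\<And>i. i \<in> I \<Longrightarrow> f i \<in> tensor_power m' n (sum_list lam)"
  shows "young_act m lam (sum f I) = (\<Sum>i\<in>I. young_act m lam (f i))"
  using assms
proof (induction I rule: infinite_finite_induct)
  case (insert i I)
  then show ?case by (simp add: young_act_add[of _ m' n] tensor_power_sum)
qed auto

lemma W_closed:
  shows W_add: "x \<in> W m n lam \<Longrightarrow> y \<in> W m n lam \<Longrightarrow> x + y \<in> W m n lam"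
    and W_rscale: "x \<in> W m n lam \<Longrightarrow> rscale x a \<in> W m n lam"
    and W_0: "0 \<in> W m n lam"
proof -
  show "x + y \<in> W m n lam" if "x \<in> W m n lam" "y \<in> W m n lam"
    using that unfolding W_def by (auto simp: image_iff) (metis tensor_power_add young_act_add)
  show "rscale x a \<in> W m n lam" if "x \<in> W m n lam"
    using that unfolding W_def by (auto simp: image_iff) (metis tensor_power_rscale young_act_rscale)
  show "0 \<in> W m n lam"
    unfolding W_def by (rule image_eqI[of _ _ 0]) auto
qed

lemma W_sum: "(\<And>i. i \<in> I \<Longrightarrow> f i \<in> W m n lam) \<Longrightarrow> sum f I \<in> W m n lam"
  by (induction I rule: infinite_finite_induct) (auto intro: W_add W_0)

lemma gl_act_W: "F \<in> GL m n \<Longrightarrow> x \<in> W m n lam \<Longrightarrow> gl_act m n F x \<in> W m n lam"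
  unfolding W_def using gl_act_young_act tensor_power_gl_act by fastforce

lemma W_subset: "W m n lam \<subseteq> tensor_power m n (sum_list lam)"
  unfolding W_def using tensor_power_young_act by auto

lemma colev_cong:
  assumes t: "t \<in> tensor_power m n (sum_list lam)"
    and y: "\<And>v k. v < m + n \<Longrightarrow> k < length lam \<Longrightarrow> y v k = y' v k"
  shows "colev lam y t = colev lam y' t"
  unfolding colev_def
proof (intro sum.cong refl arg_cong2[of _ _ _ _ times] ev_cong)
  fix \<sigma> w v c assume *: "\<sigma> \<in> column_stabilizer lam" "w \<in> Poly_Mapping.keys t" "c < length w"
  then have "\<sigma> c < sum_list lam"
    using tensor_power_length[OF t] permutes_in_image[OF column_stabilizerD(1)] by auto
  from boxes_nth_mem[OF this] have "fst (boxes lam ! \<sigma> c) < length lam" by (auto simp: set_boxes)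
  then show "rowpt lam y (w ! c) (\<sigma> c) = rowpt lam y' (w ! c) (\<sigma> c)"
    using tensor_power_keys[OF t *(2)] *(3) by (simp add: rowpt_def y)
qed

lemma shape_replicate:
  assumes "shape m n lam"
  obtains r q where "lam = replicate r q" "m \<le> r" "sum_list lam = r * q"
  using assms unfolding shape_def lam_h_def lam_g_def
  by (metis le_add1 le_refl sum_list_replicate of_nat_id)

text \<open>Polarization reduces the claim to points with the identity as body on even letters. Such
  a point is a row transform of a normalized one, which changes the value only by a power of a
  determinant.\<close>

lemma young_act_eq_0:
  fixes t :: "'a::field_char_0 tensor"
  assumes lam: "shape m n lam" and t: "t \<in> tensor_power m n (sum_list lam)"
    and 0: "\<And>\<xi>. odd_matrix \<xi> \<Longrightarrow> colev lam (normal_point m \<xi>) t = 0"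
  shows "young_act m lam t = 0"
proof -
  obtain r q where rq: "lam = replicate r q" "m \<le> r" "sum_list lam = r * q" by (rule shape_replicate[OF lam])
  have "(\<Sum>\<tau>\<in>row_stabilizer lam. sym_act m \<tau> (colsym m lam t)) = 0"
  proof (rule row_symmetrization_eq_0[OF tensor_power_colsym[OF t]])
    fix y :: "nat \<Rightarrow> nat \<Rightarrow> 'a grassmann"
    assume y: "point m y" "\<And>v k. v < m \<Longrightarrow> gbody (y v k) = (if v = k then 1 else 0)"
    obtain g \<xi> where g: "g \<in> carrier_mat r r" "odd_matrix \<xi>"
      "\<And>v k. k < r \<Longrightarrow> y v k = (\<Sum>k'<r. normal_point m \<xi> v k' * of_geven (g $$ (k', k)))"
      using normalize_point[OF y rq(2)] by blast
    have "ev (rowpt lam y) (colsym m lam t) = colev lam y t"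
      unfolding ev_colsym[OF point_rowpt[OF y(1)] t] colev_def ..
    also have "\<dots> = colev lam (\<lambda>v k. \<Sum>k'<r. normal_point m \<xi> v k' * of_geven (g $$ (k', k))) t"
      using g(3) rq(1) by (intro colev_cong[OF t]) simp
    also have "\<dots> = of_geven (det g ^ q) * colev lam (normal_point m \<xi>) t"
      unfolding rq(1) by (rule colev_row_transform[OF g(1)]) (use t rq in simp)
    finally show "ev (rowpt lam y) (colsym m lam t) = 0" using 0[OF g(2)] by simp
  qed
  then show ?thesis using young_act_colsym[OF t] by simp
qed

section \<open>Coordinates with respect to the canonical tensors\<close>

definition canonical_tensor :: "nat \<Rightarrow> nat list \<Rightarrow> (nat \<times> nat) set \<Rightarrow> 'a::comm_ring_1 tensor" where
  "canonical_tensor m lam S = filling_tensor m lam (fill m S)"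

abbreviation box_sets :: "nat \<Rightarrow> nat \<Rightarrow> (nat \<times> nat) set set" where
  "box_sets m n \<equiv> Pow ({..<m} \<times> {..<n})"

text \<open>The index set is the same for both diagrams, which lets \<open>phi_coeff\<close> carry
  coordinates from one to the other.\<close>

definition combination :: "nat \<Rightarrow> nat \<Rightarrow> nat list \<Rightarrow> ((nat \<times> nat) set \<Rightarrow> 'a::comm_ring_1 grassmann) \<Rightarrow> 'a tensor" where
  "combination m n lam a = (\<Sum>S\<in>box_sets m n. rscale (canonical_tensor m lam S) (a S))"

lemma combination_add: "combination m n lam a + combination m n lam b = combination m n lam (\<lambda>S. a S + b S)"
  by (simp add: combination_def rscale_add_right sum.distrib)

lemma combination_rscale: "rscale (combination m n lam a) c = combination m n lam (\<lambda>S. a S * c)"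
  by (simp add: combination_def rscale_sum rscale_rscale)

lemma combination_0: "combination m n lam (\<lambda>_. 0) = 0"
  by (simp add: combination_def)

lemma combination_single:
  assumes "S \<in> box_sets m n"
  shows "combination m n lam (\<lambda>S'. if S' = S then c else 0) = rscale (canonical_tensor m lam S) c"
proof -
  have "combination m n lam (\<lambda>S'. if S' = S then c else 0)
      = (\<Sum>S'\<in>box_sets m n. if S' = S then rscale (canonical_tensor m lam S) c else 0)"
    unfolding combination_def by (intro sum.cong) auto
  then show ?thesis using assms by simp
qed

lemma sum_combinations:
  assumes "\<And>i. i \<in> I \<Longrightarrow> \<exists>a. x i = combination m n lam a"
  shows "\<exists>a. (\<Sum>i\<in>I. x i) = combination m n lam a"
  using assms
proof (induction I rule: infinite_finite_induct)
  case (insert i I)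
  then obtain a b where "x i = combination m n lam a" "(\<Sum>i\<in>I. x i) = combination m n lam b" by blast
  then have "(\<Sum>i\<in>insert i I. x i) = combination m n lam (\<lambda>S. a S + b S)"
    using insert.hyps by (simp add: combination_add)
  then show ?case by blast
next
  case empty
  show ?case using combination_0[of m n lam, symmetric] by (intro exI) simp
next
  case (infinite I)
  then show ?case using combination_0[of m n lam, symmetric] by (intro exI) simp
qed

lemma fill_word_tensor_power:
  assumes "shape m n lam" "S \<in> box_sets m n"
  shows "Poly_Mapping.single (map (fill m S) (boxes lam)) a \<in> tensor_power m n (sum_list lam)"
proof (rule tensor_power_single)
  show "set (map (fill m S) (boxes lam)) \<subseteq> {..<m + n}"
    using canonical_fill[of m n lam S] assms unfolding canonical_def by fastforce
qed (simp add: length_boxes)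

lemma canonical_tensor_W: "shape m n lam \<Longrightarrow> S \<in> box_sets m n \<Longrightarrow> canonical_tensor m lam S \<in> W m n lam"
  unfolding canonical_tensor_def filling_tensor_def W_def using fill_word_tensor_power by blast

lemma combination_W: "shape m n lam \<Longrightarrow> combination m n lam a \<in> W m n lam"
  unfolding combination_def by (intro W_sum W_rscale canonical_tensor_W) auto

lemma kappa_pos: "kappa m n lam f > 0"
  unfolding kappa_def by (intro prod_pos) auto

lemma colev_fill:
  assumes "shape m n lam" "S \<in> box_sets m n" "odd_matrix \<xi>"
  shows "colev lam (normal_point m \<xi>) (Poly_Mapping.single (map (fill m S) (boxes lam)) 1)
    = of_nat (kappa m n lam (fill m S)) * monomial m lam \<xi> S"
  unfolding monomial_def using colev_canonical[OF canonical_fill[OF assms(1)] assms(3)] assms(2) by auto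

text \<open>At normalized points every term of \<open>colev\<close> is an integer multiple of the
  monomial of a canonical tensor, with set and integer independent of the point. Replacing each term
  by that canonical word, suitably scaled, gives \<open>t'\<close> with the same values, and
  \<open>young_act_eq_0\<close> identifies the images of \<open>t\<close> and
  \<open>t'\<close>.\<close>

lemma W_combination:
  fixes x :: "'a::field_char_0 tensor"
  assumes lam: "shape m n lam" and x: "x \<in> W m n lam"
  obtains a where "x = combination m n lam a"
proof -
  let ?L = "sum_list lam" and ?C = "column_stabilizer lam"
  obtain t where t: "t \<in> tensor_power m n ?L" "x = young_act m lam t" using x by (auto simp: W_def)
  have "\<exists>S (e::int). S \<in> box_sets m n \<and> (\<forall>\<xi> :: nat \<Rightarrow> nat \<Rightarrow> 'a grassmann. odd_matrix \<xi> \<longrightarrow>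
    evw (\<lambda>v c. rowpt lam (normal_point m \<xi>) v (\<sigma> c)) w = of_int e * monomial m lam \<xi> S)"
    if "w \<in> Poly_Mapping.keys t" "\<sigma> \<in> ?C" for w \<sigma>
    using word_monomial[OF lam _ _ column_stabilizerD(1)[OF that(2)], of w] tensor_power_keys[OF t(1) that(1)]
    by auto
  then obtain S and e :: "nat list \<Rightarrow> (nat \<Rightarrow> nat) \<Rightarrow> int" where S: "\<And>w \<sigma>. w \<in> Poly_Mapping.keys t \<Longrightarrow> \<sigma> \<in> ?C \<Longrightarrow> S w \<sigma> \<in> box_sets m n"
    and e: "\<And>w \<sigma> \<xi> :: nat \<Rightarrow> nat \<Rightarrow> 'a grassmann. w \<in> Poly_Mapping.keys t \<Longrightarrow> \<sigma> \<in> ?C \<Longrightarrow> odd_matrix \<xi> \<Longrightarrow>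
      evw (\<lambda>v c. rowpt lam (normal_point m \<xi>) v (\<sigma> c)) w = of_int (e w \<sigma>) * monomial m lam \<xi> (S w \<sigma>)"
    by metis
  define k where "k w \<sigma> = kappa m n lam (fill m (S w \<sigma>))" for w \<sigma>
  \<comment> \<open>The factor \<open>1 / of_nat (k w \<sigma>)\<close> compensates the multiplicity
    \<open>kappa\<close> in \<open>colev_fill\<close>; here characteristic zero enters.\<close>
  define c :: "nat list \<Rightarrow> (nat \<Rightarrow> nat) \<Rightarrow> 'a grassmann" where
    "c w \<sigma> = of_int (e w \<sigma>) * gconst (1 / of_nat (k w \<sigma>)) * Poly_Mapping.lookup t w * of_int (sign \<sigma>)" for w \<sigma>
  define u :: "nat list \<Rightarrow> (nat \<Rightarrow> nat) \<Rightarrow> 'a tensor" where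
    "u w \<sigma> = rscale (Poly_Mapping.single (map (fill m (S w \<sigma>)) (boxes lam)) 1) (c w \<sigma>)" for w \<sigma>
  have u: "u w \<sigma> \<in> tensor_power m n ?L" if "w \<in> Poly_Mapping.keys t" "\<sigma> \<in> ?C" for w \<sigma>
    unfolding u_def by (intro tensor_power_rscale fill_word_tensor_power[OF lam] S that)
  define t' where "t' = (\<Sum>w\<in>Poly_Mapping.keys t. \<Sum>\<sigma>\<in>?C. u w \<sigma>)"
  have t': "t' \<in> tensor_power m n ?L" unfolding t'_def by (intro tensor_power_sum u)
  have "young_act m lam (t - t') = 0"
  proof (rule young_act_eq_0[OF lam tensor_power_diff[OF t(1) t']])
    fix \<xi> :: "nat \<Rightarrow> nat \<Rightarrow> 'a grassmann" assume \<xi>: "odd_matrix \<xi>"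
    have 1: "of_nat j * gconst (1 / of_nat j) = (1 :: 'a grassmann)" if "j > 0" for j :: nat
      using that by (simp flip: gconst_of_nat gconst_mult add: gconst_1)
    have "colev lam (normal_point m \<xi>) (u w \<sigma>)
        = evw (\<lambda>v c. rowpt lam (normal_point m \<xi>) v (\<sigma> c)) w * Poly_Mapping.lookup t w * of_int (sign \<sigma>)"
      if w: "w \<in> Poly_Mapping.keys t" "\<sigma> \<in> ?C" for w \<sigma>
    proof -
      let ?M = "monomial m lam \<xi> (S w \<sigma>)"
      have "colev lam (normal_point m \<xi>) (u w \<sigma>) = of_nat (k w \<sigma>) * ?M * c w \<sigma>"
        unfolding u_def colev_rscale k_def colev_fill[OF lam S[OF w] \<xi>] ..
      also have "?M * of_int (e w \<sigma>) = of_int (e w \<sigma>) * ?M" by (rule mult_of_int_commute[symmetric])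
      then have "of_nat (k w \<sigma>) * ?M * c w \<sigma> =
          of_nat (k w \<sigma>) * (of_int (e w \<sigma>) * (?M * gconst (1 / of_nat (k w \<sigma>)))) * Poly_Mapping.lookup t w * of_int (sign \<sigma>)"
        unfolding c_def by (simp only: mult.assoc[symmetric]) (simp add: mult.assoc)
      also have "?M * gconst (1 / of_nat (k w \<sigma>)) = gconst (1 / of_nat (k w \<sigma>)) * ?M"
        by (rule gconst_commute[symmetric])
      also have "of_nat (k w \<sigma>) * (of_int (e w \<sigma>) * (gconst (1 / of_nat (k w \<sigma>)) * ?M)) = of_int (e w \<sigma>) * ?M"
      proof -
        have "of_nat (k w \<sigma>) * of_int (e w \<sigma>) = (of_int (e w \<sigma>) * of_nat (k w \<sigma>) :: 'a grassmann)"
          by (metis mult_of_int_commute of_int_of_nat_eq)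
        then have "of_nat (k w \<sigma>) * (of_int (e w \<sigma>) * (gconst (1 / of_nat (k w \<sigma>)) * ?M))
            = of_int (e w \<sigma>) * (of_nat (k w \<sigma>) * gconst (1 / of_nat (k w \<sigma>))) * ?M"
          by (simp only: mult.assoc[symmetric])
        then show ?thesis using 1[of "k w \<sigma>"] kappa_pos by (simp add: k_def)
      qed
      finally show ?thesis using e[OF w \<xi>] by simp
    qed
    then have "colev lam (normal_point m \<xi>) t' = (\<Sum>w\<in>Poly_Mapping.keys t. \<Sum>\<sigma>\<in>?C.
        evw (\<lambda>v c. rowpt lam (normal_point m \<xi>) v (\<sigma> c)) w * Poly_Mapping.lookup t w * of_int (sign \<sigma>))"
      unfolding t'_def colev_sum by simp
    also have "\<dots> = colev lam (normal_point m \<xi>) t"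
      unfolding colev_def ev_def sum_distrib_right by (rule sum.swap)
    finally show "colev lam (normal_point m \<xi>) (t - t') = 0" by (simp add: colev_diff)
  qed
  moreover have "young_act m lam t = young_act m lam (t - t') + young_act m lam t'"
    using young_act_add[OF tensor_power_diff[OF t(1) t'] t', of m] by simp
  ultimately have "x = young_act m lam t'" using t(2) by simp
  also have "\<dots> = (\<Sum>w\<in>Poly_Mapping.keys t. \<Sum>\<sigma>\<in>?C. young_act m lam (u w \<sigma>))"
    unfolding t'_def using u by (simp add: young_act_sum[of _ _ m n] tensor_power_sum)
  also have "\<exists>a. \<dots> = combination m n lam a"
  proof (intro sum_combinations)
    fix w \<sigma> assume w: "w \<in> Poly_Mapping.keys t" "\<sigma> \<in> ?C"
    have "young_act m lam (u w \<sigma>) = rscale (canonical_tensor m lam (S w \<sigma>)) (c w \<sigma>)"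
      unfolding u_def canonical_tensor_def filling_tensor_def
      by (rule young_act_rscale[OF fill_word_tensor_power[OF lam S[OF w]]])
    then show "\<exists>a. young_act m lam (u w \<sigma>) = combination m n lam a"
      using combination_single[OF S[OF w], of lam] by metis
  qed
  finally show ?thesis using that by blast
qed

text \<open>Induction over inclusion isolates one coefficient. With \<open>\<xi>\<close> zero in the
  first \<open>m\<close> rows outside \<open>S\<close> and distinct generators elsewhere, monomials
  of sets not contained in \<open>S\<close> vanish, proper subsets of \<open>S\<close> have
  coefficient zero by induction, and the remaining monomial is a product of fresh
  generators.\<close>

lemma monomials_independent:
  fixes a :: "(nat \<times> nat) set \<Rightarrow> 'a::field_char_0 grassmann"
  assumes lam: "shape m n lam" and k: "\<And>S. k S > 0"
    and 0: "\<And>\<xi>. odd_matrix \<xi> \<Longrightarrow> (\<Sum>S\<in>box_sets m n. of_nat (k S) * monomial m lam \<xi> S * a S) = 0"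
    and S: "S \<in> box_sets m n"
  shows "a S = 0"
proof -
  have "finite S" using S by (auto intro: finite_subset)
  then show ?thesis using S
  proof (induction S rule: finite_psubset_induct)
    case (psubset S)
    obtain N where N: "\<And>i s. i \<in> {S} \<Longrightarrow> N \<le> s \<Longrightarrow> avoids s (a i)" using fresh_generators[of "{S}" a] by auto
    \<comment> \<open>\<open>prod_encode\<close> gives each entry its own generator; the shift by
      \<open>N\<close> keeps it out of \<open>a S\<close>.\<close>
    define \<xi> :: "nat \<Rightarrow> nat \<Rightarrow> 'a grassmann" where
      "\<xi> l k = (if (k, l) \<in> S \<or> m \<le> k then gen (N + prod_encode (l, k)) else 0)" for l k
    have \<xi>: "odd_matrix \<xi>" by (auto simp: odd_matrix_def \<xi>_def gparity_gen)
    have "of_nat (k S') * monomial m lam \<xi> S' * a S' = 0" if S': "S' \<in> box_sets m n - {S}" for S'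
    proof (cases "S' \<subseteq> S")
      case True
      then have "a S' = 0" using psubset.IH[of S'] S' by auto
      then show ?thesis by simp
    next
      case False
      then obtain b where b: "b \<in> S'" "b \<notin> S" by blast
      then have "b \<in> set (boxes lam)" "fst b < m" using S' shape_boxes(1)[OF lam] by auto
      moreover from this have "normal_point m \<xi> (fill m S' b) (fst b) = 0"
        using b by (simp add: fill_def normal_point_def \<xi>_def)
      ultimately have "monomial m lam \<xi> S' = 0"
        unfolding monomial_def by (intro prod_list_eq_0) (force simp: image_iff)
      then show ?thesis by simp
    qed
    then have "(\<Sum>S'\<in>box_sets m n. of_nat (k S') * monomial m lam \<xi> S' * a S') = of_nat (k S) * monomial m lam \<xi> S * a S"
      using psubset.prems by (subst sum.remove[of _ S]) auto
    then have "of_nat (k S) * (monomial m lam \<xi> S * a S) = of_nat (k S) * 0" using 0[OF \<xi>] by (simp add: mult.assoc)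
    then have "monomial m lam \<xi> S * a S = 0" by (rule of_nat_grassmann_cancel) (rule k)
    then show ?case
      unfolding monomial_def
    proof (rule prod_gens_mult_eq_0[where X = "\<lambda>b. {N + prod_encode (snd b, fst b)}", rotated -1])
      show "distinct (boxes lam)" by (rule distinct_boxes)
      show "avoids s (a S)" if "s \<in> {N + prod_encode (snd b, fst b)}" for b s using N that by auto
      fix b assume "b \<in> set (boxes lam)"
      show "avoids s (normal_point m \<xi> (fill m S d) (fst d))"
        if "b \<noteq> d" "s \<in> {N + prod_encode (snd b, fst b)}" for d s
      proof -
        have "s \<noteq> N + prod_encode (snd d, fst d)"
          using that inj_prod_encode[of UNIV] by (auto simp: prod_eq_iff dest: injD)
        then show ?thesis by (auto simp: fill_def normal_point_def \<xi>_def)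
      qed
      fix x assume x: "\<And>s. s \<in> {N + prod_encode (snd b, fst b)} \<Longrightarrow> avoids s x"
        "normal_point m \<xi> (fill m S b) (fst b) * x = 0"
      show "x = 0"
      proof (cases "b \<in> S \<or> m \<le> fst b")
        case True
        then show ?thesis using x gen_mult_eq_0[of "N + prod_encode (snd b, fst b)" x]
          by (auto simp: fill_def normal_point_def \<xi>_def)
      next
        case False
        then show ?thesis using x(2) by (simp add: fill_def normal_point_def)
      qed
    qed
  qed
qed

section \<open>The Berezinian\<close>

definition even_mat :: "'a::comm_ring_1 grassmann mat \<Rightarrow> bool" where
  "even_mat X \<longleftrightarrow> (\<forall>i<dim_row X. \<forall>j<dim_col X. gparity False (X $$ (i, j)))"

definition odd_mat :: "'a::comm_ring_1 grassmann mat \<Rightarrow> bool" where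
  "odd_mat X \<longleftrightarrow> (\<forall>i<dim_row X. \<forall>j<dim_col X. gparity True (X $$ (i, j)))"

lemma index_mult_mat_sum:
  "X \<in> carrier_mat a b \<Longrightarrow> Y \<in> carrier_mat b c \<Longrightarrow> i < a \<Longrightarrow> j < c \<Longrightarrow>
    (X * Y) $$ (i, j) = (\<Sum>k<b. X $$ (i, k) * Y $$ (k, j))"
  by (simp add: scalar_prod_def atLeast0LessThan)

lemma gparity_mult_mat:
  assumes "X \<in> carrier_mat a b" "Y \<in> carrier_mat b c"
    and "\<And>i k. i < a \<Longrightarrow> k < b \<Longrightarrow> gparity p (X $$ (i, k))"
    and "\<And>k j. k < b \<Longrightarrow> j < c \<Longrightarrow> gparity q (Y $$ (k, j))"
    and "i < a" "j < c"
  shows "gparity (p \<noteq> q) ((X * Y) $$ (i, j))"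
  unfolding index_mult_mat_sum[OF assms(1,2,5,6)] using assms by (intro gparity_sum gparity_mult) auto

lemma even_mat_mult:
  assumes "X \<in> carrier_mat a b" "Y \<in> carrier_mat b c"
  shows "even_mat X \<Longrightarrow> even_mat Y \<Longrightarrow> even_mat (X * Y)"
    and "odd_mat X \<Longrightarrow> odd_mat Y \<Longrightarrow> even_mat (X * Y)"
    and "even_mat X \<Longrightarrow> odd_mat Y \<Longrightarrow> odd_mat (X * Y)"
    and "odd_mat X \<Longrightarrow> even_mat Y \<Longrightarrow> odd_mat (X * Y)"
  using assms gparity_mult_mat[OF assms, of False False] gparity_mult_mat[OF assms, of True True]
    gparity_mult_mat[OF assms, of False True] gparity_mult_mat[OF assms, of True False]
  by (auto simp: even_mat_def odd_mat_def simp del: index_mult_mat(1))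

lemma even_mat_add:
  assumes "X \<in> carrier_mat a b" "Y \<in> carrier_mat a b"
  shows "even_mat X \<Longrightarrow> even_mat Y \<Longrightarrow> even_mat (X + Y)"
    and "odd_mat X \<Longrightarrow> odd_mat Y \<Longrightarrow> odd_mat (X + Y)"
  using assms by (auto simp: even_mat_def odd_mat_def intro: gparity_add)

lemma even_mat_one [simp]: "even_mat (1\<^sub>m r)"
  by (auto simp: even_mat_def)

lemma odd_mat_uminus: "odd_mat X \<Longrightarrow> odd_mat (- X)"
  by (auto simp: odd_mat_def intro: gparity_uminus)

abbreviation ge_mat :: "'a::comm_ring_1 grassmann mat \<Rightarrow> 'a geven mat" where
  "ge_mat X \<equiv> map_mat to_geven X"

lemma of_geven_ge_mat:
  "even_mat X \<Longrightarrow> i < dim_row X \<Longrightarrow> j < dim_col X \<Longrightarrow> of_geven (ge_mat X $$ (i, j)) = X $$ (i, j)"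
  by (simp add: even_mat_def of_geven_to_geven)

lemma ge_mat_mult:
  assumes "X \<in> carrier_mat a b" "Y \<in> carrier_mat b c" "even_mat X" "even_mat Y"
  shows "ge_mat (X * Y) = ge_mat X * ge_mat Y"
proof (rule eq_matI)
  fix i j assume "i < dim_row (ge_mat X * ge_mat Y)" "j < dim_col (ge_mat X * ge_mat Y)"
  then have ij: "i < a" "j < c" using assms by auto
  have "of_geven (ge_mat (X * Y) $$ (i, j)) = (X * Y) $$ (i, j)"
    using assms ij by (intro of_geven_ge_mat even_mat_mult(1)) auto
  also have "\<dots> = (\<Sum>k<b. X $$ (i, k) * Y $$ (k, j))" by (rule index_mult_mat_sum[OF assms(1,2) ij])
  also have "\<dots> = of_geven (\<Sum>k<b. ge_mat X $$ (i, k) * ge_mat Y $$ (k, j))"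
    using assms ij of_geven_ge_mat[OF assms(3)] of_geven_ge_mat[OF assms(4)] by (simp add: of_geven_sum)
  also have "(\<Sum>k<b. ge_mat X $$ (i, k) * ge_mat Y $$ (k, j)) = (ge_mat X * ge_mat Y) $$ (i, j)"
    using assms ij by (intro index_mult_mat_sum[symmetric]) auto
  finally show "ge_mat (X * Y) $$ (i, j) = (ge_mat X * ge_mat Y) $$ (i, j)" by (simp add: of_geven_inject)
qed (use assms in auto)

lemma ge_mat_one: "ge_mat (1\<^sub>m r) = 1\<^sub>m r"
proof (rule eq_matI)
  fix i j assume "i < dim_row (1\<^sub>m r :: 'a geven mat)" "j < dim_col (1\<^sub>m r :: 'a geven mat)"
  then have "of_geven (ge_mat (1\<^sub>m r) $$ (i, j)) = of_geven (1\<^sub>m r $$ (i, j) :: 'a geven)"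
    by (simp add: of_geven_to_geven)
  then show "ge_mat (1\<^sub>m r) $$ (i, j) = (1\<^sub>m r :: 'a geven mat) $$ (i, j)" by (simp add: of_geven_inject)
qed auto

lemma det_ge_mat_mult:
  assumes "X \<in> carrier_mat r r" "Y \<in> carrier_mat r r" "even_mat X" "even_mat Y"
  shows "det (ge_mat (X * Y)) = det (ge_mat X) * det (ge_mat Y)"
  unfolding ge_mat_mult[OF assms] using assms by (intro det_mult) auto

text \<open>The matrix is inverted over the commutative ring of even elements and the result is
  mapped back.\<close>

lemma even_matrix_inverse:
  fixes X :: "'a::field grassmann mat"
  assumes X: "X \<in> carrier_mat r r" "even_mat X" and body: "det (map_mat gbody X) \<noteq> 0"
  obtains U where "U \<in> carrier_mat r r" "even_mat U" "X * U = 1\<^sub>m r" "U * X = 1\<^sub>m r"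
proof -
  let ?g = "ge_mat X"
  have g: "?g \<in> carrier_mat r r" using X by simp
  have "mat r r (\<lambda>(i, j). gbody (of_geven (?g $$ (i, j)))) = map_mat gbody X"
    using X of_geven_ge_mat[OF X(2)] by (intro eq_matI) auto
  then have "gbody (of_geven (det ?g)) \<noteq> 0" using body gbody_det[OF g] by simp
  then obtain g' where g': "g' \<in> carrier_mat r r" "?g * g' = 1\<^sub>m r" "g' * ?g = 1\<^sub>m r"
    using geven_matrix_inverse[OF g] by blast
  define U where "U = map_mat of_geven g'"
  have U: "U \<in> carrier_mat r r" "even_mat U" using g' by (auto simp: U_def even_mat_def)
  have geU: "ge_mat U = g'" using g' by (intro eq_matI) (auto simp: U_def of_geven_inverse)
  have eq: "Z = 1\<^sub>m r" if "Z \<in> carrier_mat r r" "even_mat Z" "ge_mat Z = 1\<^sub>m r" for Z :: "'a grassmann mat"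
  proof (rule eq_matI)
    fix i j assume "i < dim_row (1\<^sub>m r :: 'a grassmann mat)" "j < dim_col (1\<^sub>m r :: 'a grassmann mat)"
    then show "Z $$ (i, j) = 1\<^sub>m r $$ (i, j)"
      using that of_geven_ge_mat[OF that(2), of i j] by auto
  qed (use that in auto)
  have "X * U = 1\<^sub>m r" "U * X = 1\<^sub>m r"
    using X U g' geU by (auto intro!: eq even_mat_mult(1) simp: ge_mat_mult)
  with U show ?thesis by (rule that)
qed

text \<open>Every permutation other than the identity moves some index to one different from
  \<open>i\<close>, hence meets a zero entry; only the product of the diagonal remains.\<close>

lemma det_unit_off_column:
  fixes X :: "'a::comm_ring_1 mat"
  assumes X: "X \<in> carrier_mat r r" and i: "i < r"
    and unit: "\<And>k l. k < r \<Longrightarrow> l < r \<Longrightarrow> l \<noteq> i \<Longrightarrow> X $$ (k, l) = (if k = l then 1 else 0)"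
  shows "det X = X $$ (i, i)"
proof -
  have "det X = (\<Sum>p\<in>{p. p permutes {0..<r}}. if p = id then \<Prod>k = 0..<r. X $$ (k, k) else 0)"
    unfolding det_def'[OF X]
  proof (intro sum.cong refl)
    fix p assume p: "p \<in> {p. p permutes {0..<r}}"
    show "of_int (sign p) * (\<Prod>k = 0..<r. X $$ (k, p k)) = (if p = id then \<Prod>k = 0..<r. X $$ (k, k) else 0)"
    proof (cases "p = id")
      case False
      then obtain k where k: "p k \<noteq> k" by (auto simp: fun_eq_iff)
      have "\<exists>k. p k \<noteq> k \<and> p k \<noteq> i"
      proof (cases "p k = i")
        case True
        then have "p i \<noteq> i" "p i \<noteq> p k" using k permutes_inj[of p] p by (auto dest: injD)
        then show ?thesis using True by (intro exI[of _ i]) auto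
      qed (use k in auto)
      then obtain k where k: "p k \<noteq> k" "p k \<noteq> i" by blast
      then have kr: "k < r" using p permutes_not_in[of p "{0..<r}" k] by force
      then have "p k < r" using p permutes_in_image[of p "{0..<r}" k] by simp
      then have "X $$ (k, p k) = 0" using unit[of k "p k"] k kr by simp
      then have "(\<Prod>k = 0..<r. X $$ (k, p k)) = 0" using kr by (intro prod_zero) auto
      then show ?thesis using False by simp
    qed simp
  qed
  also have "\<dots> = (\<Prod>k = 0..<r. X $$ (k, k))" by (simp add: finite_permutations permutes_id)
  also have "\<dots> = (\<Prod>k = 0..<r. if k = i then X $$ (i, i) else 1)"
    using unit by (intro prod.cong) auto
  finally show ?thesis using i by simp
qed

lemma det_unit_off_row:
  fixes X :: "'a::comm_ring_1 mat"
  assumes X: "X \<in> carrier_mat r r" and i: "i < r"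
    and unit: "\<And>k l. k < r \<Longrightarrow> l < r \<Longrightarrow> k \<noteq> i \<Longrightarrow> X $$ (k, l) = (if k = l then 1 else 0)"
  shows "det X = X $$ (i, i)"
  using det_unit_off_column[of "X\<^sup>T" r i] X i unit det_transpose[OF X] by auto

text \<open>The odd counterpart of Sylvester's identity \<open>det (1 + P Q) = det (1 + Q P)\<close>: the nonzero
  entries of \<open>Q\<close> are split off one at a time.\<close>

lemma det_one_plus_odd:
  fixes P Q :: "'a::field_char_0 grassmann mat"
  assumes P: "P \<in> carrier_mat m n" "odd_mat P" and Q: "Q \<in> carrier_mat n m" "odd_mat Q"
  shows "det (ge_mat (1\<^sub>m m + P * Q)) * det (ge_mat (1\<^sub>m n + Q * P)) = 1"
  using Q
proof (induction "card {(j, i). j < n \<and> i < m \<and> Q $$ (j, i) \<noteq> 0}" arbitrary: Q rule: less_induct)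
  case less
  note Q = less.prems
  let ?nz = "\<lambda>Q :: 'a grassmann mat. {(j, i). j < n \<and> i < m \<and> Q $$ (j, i) \<noteq> 0}"
  have fin: "finite (?nz Q)" for Q by (rule finite_subset[of _ "{..<n} \<times> {..<m}"]) auto
  show ?case
  proof (cases "?nz Q = {}")
    case True
    then have "Q = 0\<^sub>m n m" using Q(1) by (intro eq_matI) auto
    then have "1\<^sub>m m + P * Q = 1\<^sub>m m" "1\<^sub>m n + Q * P = 1\<^sub>m n" using P(1) by auto
    then show ?thesis by (simp only: ge_mat_one det_one) simp
  next
    case False
    then obtain j i where ji: "j < n" "i < m" "Q $$ (j, i) \<noteq> 0" by auto
    define a where "a = Q $$ (j, i)"
    \<comment> \<open>\<open>E\<close> carries the entry \<open>a\<close> that is split off, and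
      \<open>Q'\<close> has one nonzero entry less than \<open>Q\<close>.\<close>
    define E where "E = mat n m (\<lambda>(j', i'). if j' = j \<and> i' = i then a else 0)"
    define Q' where "Q' = mat n m (\<lambda>(j', i'). if j' = j \<and> i' = i then 0 else Q $$ (j', i'))"
    have a: "gparity True a" using Q ji by (auto simp: a_def odd_mat_def)
    have E: "E \<in> carrier_mat n m" "odd_mat E" using a by (auto simp: E_def odd_mat_def)
    have Q': "Q' \<in> carrier_mat n m" "odd_mat Q'" using Q by (auto simp: Q'_def odd_mat_def)
    have QE: "Q = Q' + E" using Q(1) by (intro eq_matI) (auto simp: Q'_def E_def a_def)
    have "?nz Q' \<subset> ?nz Q"
    proof (rule psubsetI)
      show "?nz Q' \<subseteq> ?nz Q" by (auto simp: Q'_def split: if_splits)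
      have "(j, i) \<in> ?nz Q" "(j, i) \<notin> ?nz Q'" using ji by (auto simp: Q'_def)
      then show "?nz Q' \<noteq> ?nz Q" by blast
    qed
    then have IH: "det (ge_mat (1\<^sub>m m + P * Q')) * det (ge_mat (1\<^sub>m n + Q' * P)) = 1"
      using less.hyps[OF psubset_card_mono[OF fin] Q'] by blast
    define X where "X = 1\<^sub>m m + P * Q'"
    define Y where "Y = 1\<^sub>m n + Q' * P"
    have PQ': "P * Q' \<in> carrier_mat m m" "even_mat (P * Q')" using P Q' even_mat_mult(2)[OF P(1) Q'(1)] by auto
    have Q'P: "Q' * P \<in> carrier_mat n n" "even_mat (Q' * P)" using P Q' even_mat_mult(2)[OF Q'(1) P(1)] by auto
    have X: "X \<in> carrier_mat m m" "even_mat X" using PQ' unfolding X_def by (auto intro!: even_mat_add(1))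
    have Y: "Y \<in> carrier_mat n n" "even_mat Y" using Q'P unfolding Y_def by (auto intro!: even_mat_add(1))
    have "map_mat gbody X = 1\<^sub>m m"
    proof (rule eq_matI)
      fix k l assume "k < dim_row (1\<^sub>m m)" "l < dim_col (1\<^sub>m m)"
      then have kl: "k < m" "l < m" by auto
      have "gbody ((P * Q') $$ (k, l)) = 0"
        unfolding index_mult_mat_sum[OF P(1) Q'(1) kl] gbody_sum
        using P kl by (intro sum.neutral) (auto simp: odd_mat_def gbody_odd)
      then show "map_mat gbody X $$ (k, l) = 1\<^sub>m m $$ (k, l)"
        using kl PQ'(1) P(1) Q'(1) by (auto simp: X_def simp del: index_mult_mat(1))
    qed (use X in auto)
    then have "det (map_mat gbody X) \<noteq> 0" by simp
    from even_matrix_inverse[OF X this] obtain U where U: "U \<in> carrier_mat m m" "even_mat U" "X * U = 1\<^sub>m m" "U * X = 1\<^sub>m m" .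
    \<comment> \<open>The relation P Y = X P turns into P' Y = P, and both matrices factor: 1 + P Q
      = X (1 + P' E) and 1 + Q P = (1 + E P') Y. The induction hypothesis covers X and Y, so a
      matrix with a single nonzero entry remains.\<close>
    define P' where "P' = U * P"
    have P': "P' \<in> carrier_mat m n" "odd_mat P'" using U P even_mat_mult(3)[OF U(1) P(1)] by (auto simp: P'_def)
    have XP': "X * P' = P"
      unfolding P'_def using assoc_mult_mat[OF X(1) U(1) P(1), symmetric] U P by simp
    have "P * Y = X * P"
      unfolding X_def Y_def using P Q' PQ'(1) Q'P(1)
      by (simp add: mult_add_distrib_mat[of P m n _ n] add_mult_distrib_mat[of _ m m _ P n] assoc_mult_mat[of P m n Q' m P n])
    then have P'Y: "P' * Y = P"
      unfolding P'_def using assoc_mult_mat[OF U(1) P(1) Y(1)] assoc_mult_mat[OF U(1) X(1) P(1), symmetric] U P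
      by simp
    have c: "P' * E \<in> carrier_mat m m" "E * P' \<in> carrier_mat n n" "P * E \<in> carrier_mat m m" "E * P \<in> carrier_mat n n"
      using P P' E by auto
    have "1\<^sub>m m + P * Q = X + P * E"
      unfolding QE X_def using P Q' E by (simp add: mult_add_distrib_mat[of P m n Q' m E] assoc_add_mat[of _ m m])
    also have "\<dots> = X * (1\<^sub>m m + P' * E)"
    proof -
      have "X * (P' * E) = P * E" using assoc_mult_mat[OF X(1) P'(1) E(1)] XP' by simp
      then show ?thesis using X c(1) by (simp add: mult_add_distrib_mat[of X m m _ m])
    qed
    finally have 1: "1\<^sub>m m + P * Q = X * (1\<^sub>m m + P' * E)" .
    have "1\<^sub>m n + Q * P = Y + E * P"
      unfolding QE Y_def using P Q' E by (simp add: add_mult_distrib_mat[of Q' n m E P n] assoc_add_mat[of _ n n])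
    also have "\<dots> = (1\<^sub>m n + E * P') * Y"
      using Y c assoc_mult_mat[OF E(1) P'(1) Y(1)] P'Y by (simp add: add_mult_distrib_mat[of _ n n _ Y n])
    finally have 2: "1\<^sub>m n + Q * P = (1\<^sub>m n + E * P') * Y" .
    let ?Z1 = "1\<^sub>m m + P' * E" and ?Z2 = "1\<^sub>m n + E * P'"
    have Z: "?Z1 \<in> carrier_mat m m" "even_mat ?Z1" "?Z2 \<in> carrier_mat n n" "even_mat ?Z2"
      using P' E c even_mat_mult(2)[OF P'(1) E(1)] even_mat_mult(2)[OF E(1) P'(1)]
      by (auto intro!: even_mat_add(1))
    define p where "p = P' $$ (i, j)"
    have p: "gparity True p" using P' ji by (auto simp: p_def odd_mat_def)
    have P'E: "(P' * E) $$ (k, l) = (if l = i then P' $$ (k, j) * a else 0)" if "k < m" "l < m" for k l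
    proof -
      have "(P' * E) $$ (k, l) = (\<Sum>s<n. if s = j then (if l = i then P' $$ (k, j) * a else 0) else 0)"
        unfolding index_mult_mat_sum[OF P'(1) E(1) that] using that by (intro sum.cong) (auto simp: E_def)
      then show ?thesis using ji by simp
    qed
    have EP': "(E * P') $$ (k, l) = (if k = j then a * P' $$ (i, l) else 0)" if "k < n" "l < n" for k l
    proof -
      have "(E * P') $$ (k, l) = (\<Sum>s<m. if s = i then (if k = j then a * P' $$ (i, l) else 0) else 0)"
        unfolding index_mult_mat_sum[OF E(1) P'(1) that] using that by (intro sum.cong) (auto simp: E_def)
      then show ?thesis using ji by simp
    qed
    have inj: "x = y" if "of_geven x = of_geven y" for x y :: "'a geven" using that of_geven_inject by blast
    have "det (ge_mat ?Z1) = ge_mat ?Z1 $$ (i, i)"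
    proof (rule det_unit_off_column[of _ m])
      fix k l assume kl: "k < m" "l < m" "l \<noteq> i"
      then show "ge_mat ?Z1 $$ (k, l) = (if k = l then 1 else 0)"
        using of_geven_ge_mat[OF Z(2), of k l] P'E[of k l] P' E by (intro inj) (auto simp del: index_mult_mat(1))
    qed (use Z ji in auto)
    then have d1: "of_geven (det (ge_mat ?Z1)) = 1 + p * a"
      using of_geven_ge_mat[OF Z(2), of i i] P'E[of i i] P' E ji by (simp add: p_def del: index_mult_mat(1))
    have "det (ge_mat ?Z2) = ge_mat ?Z2 $$ (j, j)"
    proof (rule det_unit_off_row[of _ n])
      fix k l assume kl: "k < n" "l < n" "k \<noteq> j"
      then show "ge_mat ?Z2 $$ (k, l) = (if k = l then 1 else 0)"
        using of_geven_ge_mat[OF Z(4), of k l] EP'[of k l] P' E by (intro inj) (auto simp del: index_mult_mat(1))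
    qed (use Z ji in auto)
    then have d2: "of_geven (det (ge_mat ?Z2)) = 1 + a * p"
      using of_geven_ge_mat[OF Z(4), of j j] EP'[of j j] P' E ji by (simp add: p_def del: index_mult_mat(1))
    \<comment> \<open>The two determinants are 1 + p a and 1 + a p = 1 - p a, and the square of p a
      is zero. Oddness makes them inverse to each other, where commuting entries would make them
      equal.\<close>
    have ap: "a * p = - (p * a)" using supercommute[OF p a] by simp
    have "p * a * (p * a) = p * (a * p) * a" by (simp add: mult.assoc)
    also have "\<dots> = - (p * p * (a * a))" unfolding ap by (simp add: mult.assoc)
    finally have "p * a * (p * a) = 0" using odd_square_zero[OF p] by simp
    then have "(1 + p * a) * (1 + a * p) = 1" unfolding ap by (simp add: algebra_simps)
    then have Z12: "det (ge_mat ?Z1) * det (ge_mat ?Z2) = 1" using d1 d2 by (intro inj) simp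
    have "det (ge_mat (1\<^sub>m m + P * Q)) * det (ge_mat (1\<^sub>m n + Q * P))
        = (det (ge_mat X) * det (ge_mat Y)) * (det (ge_mat ?Z1) * det (ge_mat ?Z2))"
      unfolding 1 2 using X Y Z by (simp add: det_ge_mat_mult mult_ac)
    then show ?thesis using IH Z12 by (simp add: X_def Y_def)
  qed
qed

section \<open>Matrices of the elements of GL V\<close>

lemma sum_lessThan_split: "(\<Sum>k<m + n. f k) = (\<Sum>k<m. f k) + (\<Sum>k<n. f (m + k))" for n :: nat
  by (induction n) (auto simp: add.assoc)

text \<open>Coordinates are added one at a time; \<open>v k\<close> keeps the first \<open>k\<close>
  entries of \<open>x\<close>.\<close>

lemma GL_apply:
  fixes F :: "'a::comm_ring_1 grassmann vec \<Rightarrow> 'a grassmann vec"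
  assumes F: "F \<in> GL m n" and x: "x \<in> carrier_vec (m + n)" and i: "i < m + n"
  shows "F x $ i = (\<Sum>j<m + n. matrix_of (m + n) F $$ (i, j) * x $ j)"
proof -
  let ?d = "m + n"
  have add: "F (v + w) = F v + F w" if "v \<in> carrier_vec ?d" "w \<in> carrier_vec ?d" for v w
    using F that by (simp add: GL_def)
  have scale: "F (vec_rscale v a) = vec_rscale (F v) a" if "v \<in> carrier_vec ?d" for v a
    using F that by (simp add: GL_def)
  define v where "v k = vec ?d (\<lambda>i. if i < k then x $ i else 0)" for k
  have "F (v k) $ i = (\<Sum>j<k. matrix_of ?d F $$ (i, j) * x $ j)" if "k \<le> ?d" for k
    using that
  proof (induction k)
    case 0
    have v0: "v 0 + v 0 = v 0" by (rule eq_vecI) (auto simp: v_def)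
    have "F (v 0) = F (v 0) + F (v 0)" using add[of "v 0" "v 0"] v0 by (simp add: v_def)
    then have "F (v 0) $ i = F (v 0) $ i + F (v 0) $ i"
      using GL_carrier[OF F, of "v 0"] i by (metis carrier_vecD index_add_vec(1) v_def vec_carrier)
    then show ?case by simp
  next
    case (Suc k)
    have "v (Suc k) = v k + vec_rscale (unit_vec ?d k) (x $ k)"
      using Suc.prems by (intro eq_vecI) (auto simp: v_def vec_rscale_def unit_vec_def less_Suc_eq)
    moreover have "v k \<in> carrier_vec ?d" "vec_rscale (unit_vec ?d k) (x $ k) \<in> carrier_vec ?d"
      by (auto simp: v_def vec_rscale_def)
    ultimately have "F (v (Suc k)) = F (v k) + vec_rscale (F (unit_vec ?d k)) (x $ k)"
      using add scale by simp
    then show ?case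
      using Suc i GL_carrier[OF F, of "unit_vec ?d k"] by (simp add: vec_rscale_def matrix_of_def)
  qed
  moreover have "v ?d = x" using x by (intro eq_vecI) (auto simp: v_def)
  ultimately show ?thesis by (metis le_refl)
qed

lemma GL_right_inverse:
  assumes F: "F \<in> GL m n"
  obtains C where "C \<in> carrier_mat (m + n) (m + n)" "matrix_of (m + n) F * C = 1\<^sub>m (m + n)"
proof -
  let ?d = "m + n"
  define b where "b j = inv_into (carrier_vec ?d) F (unit_vec ?d j)" for j
  have img: "F ` carrier_vec ?d = carrier_vec ?d" using F by (simp add: GL_def bij_betw_def)
  have b: "b j \<in> carrier_vec ?d" "F (b j) = unit_vec ?d j" for j
    unfolding b_def using img by (auto intro!: inv_into_into f_inv_into_f)
  define C where "C = mat ?d ?d (\<lambda>(i, j). b j $ i)"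
  have "matrix_of ?d F * C = 1\<^sub>m ?d"
  proof (rule eq_matI)
    fix i j assume "i < dim_row (1\<^sub>m ?d :: 'a grassmann mat)" "j < dim_col (1\<^sub>m ?d :: 'a grassmann mat)"
    then have ij: "i < ?d" "j < ?d" by auto
    have "(matrix_of ?d F * C) $$ (i, j) = (\<Sum>k<?d. matrix_of ?d F $$ (i, k) * C $$ (k, j))"
      using ij by (intro index_mult_mat_sum) (auto simp: matrix_of_def C_def)
    also have "\<dots> = F (b j) $ i" using ij by (simp add: GL_apply[OF F b(1) ij(1)] C_def)
    finally show "(matrix_of ?d F * C) $$ (i, j) = 1\<^sub>m ?d $$ (i, j)" using ij by (simp add: b(2) unit_vec_def)
  qed (auto simp: matrix_of_def C_def)
  then show ?thesis using that[of C] by (simp add: C_def)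
qed

text \<open>The off-diagonal blocks are odd and have body zero. The body of the matrix is thus block
  diagonal, and the body of a right inverse supplies right inverses of both blocks over the
  field.\<close>

lemma GL_diagonal_blocks:
  fixes F :: "'a::field grassmann vec \<Rightarrow> 'a grassmann vec"
  assumes F: "F \<in> GL m n"
  shows "det (map_mat gbody (mat m m (\<lambda>(i, j). matrix_of (m + n) F $$ (i, j)))) \<noteq> 0"
    and "det (map_mat gbody (mat n n (\<lambda>(i, j). matrix_of (m + n) F $$ (i + m, j + m)))) \<noteq> 0"
proof -
  let ?d = "m + n"
  let ?A = "matrix_of ?d F"
  obtain C where C: "C \<in> carrier_mat ?d ?d" "?A * C = 1\<^sub>m ?d" by (rule GL_right_inverse[OF F])
  have A: "?A \<in> carrier_mat ?d ?d" by (simp add: matrix_of_def)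
  have AC: "(\<Sum>k<?d. gbody (?A $$ (i, k)) * gbody (C $$ (k, j))) = (if i = j then 1 else 0)"
    if "i < ?d" "j < ?d" for i j
  proof -
    have "gbody ((?A * C) $$ (i, j)) = (\<Sum>k<?d. gbody (?A $$ (i, k)) * gbody (C $$ (k, j)))"
      unfolding index_mult_mat_sum[OF A C(1) that] by (simp add: gbody_sum)
    moreover have "gbody ((?A * C) $$ (i, j)) = (if i = j then 1 else 0)" unfolding C(2) using that by simp
    ultimately show ?thesis by simp
  qed
  have A0: "gbody (?A $$ (i, j)) = 0" if "i < ?d" "j < ?d" "(m \<le> i) \<noteq> (m \<le> j)" for i j
    using GL_parity[OF F that(1,2)] that(3) by (intro gbody_odd) simp
  have 1: "det X \<noteq> 0" if "X * Y = 1\<^sub>m r" "X \<in> carrier_mat r r" "Y \<in> carrier_mat r r" for X Y :: "'a mat" and r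
    using det_mult[OF that(2,3)] that(1) by auto
  show "det (map_mat gbody (mat m m (\<lambda>(i, j). ?A $$ (i, j)))) \<noteq> 0"
  proof (rule 1)
    show "map_mat gbody (mat m m (\<lambda>(i, j). ?A $$ (i, j))) * mat m m (\<lambda>(i, j). gbody (C $$ (i, j))) = 1\<^sub>m m"
    proof (rule eq_matI)
      fix i j assume "i < dim_row (1\<^sub>m m :: 'a mat)" "j < dim_col (1\<^sub>m m :: 'a mat)"
      then have ij: "i < m" "j < m" by auto
      then show "(map_mat gbody (mat m m (\<lambda>(i, j). ?A $$ (i, j))) * mat m m (\<lambda>(i, j). gbody (C $$ (i, j)))) $$ (i, j)
          = 1\<^sub>m m $$ (i, j)"
        using AC[of i j] A0[of i] by (subst index_mult_mat_sum[of _ m m _ m]) (auto simp: sum_lessThan_split)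
    qed auto
  qed auto
  show "det (map_mat gbody (mat n n (\<lambda>(i, j). ?A $$ (i + m, j + m)))) \<noteq> 0"
  proof (rule 1)
    show "map_mat gbody (mat n n (\<lambda>(i, j). ?A $$ (i + m, j + m))) * mat n n (\<lambda>(i, j). gbody (C $$ (i + m, j + m))) = 1\<^sub>m n"
    proof (rule eq_matI)
      fix i j assume "i < dim_row (1\<^sub>m n :: 'a mat)" "j < dim_col (1\<^sub>m n :: 'a mat)"
      then have ij: "i < n" "j < n" by auto
      then show "(map_mat gbody (mat n n (\<lambda>(i, j). ?A $$ (i + m, j + m))) * mat n n (\<lambda>(i, j). gbody (C $$ (i + m, j + m)))) $$ (i, j)
          = 1\<^sub>m n $$ (i, j)"
        using AC[of "i + m" "j + m"] A0[of "i + m"]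
        by (subst index_mult_mat_sum[of _ n n _ n]) (auto simp: sum_lessThan_split add.commute)
    qed auto
  qed auto
qed

lemma inverse_mat_eq:
  assumes X: "X \<in> carrier_mat r r" and U: "U \<in> carrier_mat r r" "X * U = 1\<^sub>m r" "U * X = 1\<^sub>m r"
  shows "inverse_mat X = U"
  unfolding inverse_mat_def
proof (rule the_equality)
  show "U \<in> carrier_mat (dim_row X) (dim_row X) \<and> inverts_mat X U \<and> inverts_mat U X"
    using X U by (simp add: inverts_mat_def)
next
  fix Y assume "Y \<in> carrier_mat (dim_row X) (dim_row X) \<and> inverts_mat X Y \<and> inverts_mat Y X"
  then have Y: "Y \<in> carrier_mat r r" "Y * X = 1\<^sub>m r" using X by (auto simp: inverts_mat_def)
  have "Y = Y * (X * U)" using Y U by simp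
  also have "\<dots> = U" using assoc_mult_mat[OF Y(1) X U(1)] Y U by simp
  finally show "Y = U" .
qed

text \<open>With \<open>B = [[1, \<Xi>], [0, 1]] A\<close>, both sides express the Berezinian of \<open>B\<close>, through the Schur
  complements of its two diagonal blocks; the Schur complement of \<open>A22\<close> is not affected by \<open>\<Xi>\<close>.\<close>

lemma berezinian_schur:
  fixes A11 A12 A21 A22 \<Xi> :: "'a::field_char_0 grassmann mat"
  assumes A11: "A11 \<in> carrier_mat m m" "even_mat A11" and A12: "A12 \<in> carrier_mat m n" "odd_mat A12"
    and A21: "A21 \<in> carrier_mat n m" "odd_mat A21" and A22: "A22 \<in> carrier_mat n n" "even_mat A22"
    and \<Xi>: "\<Xi> \<in> carrier_mat m n" "odd_mat \<Xi>"
    and body: "det (map_mat gbody A11) \<noteq> 0" "det (map_mat gbody A22) \<noteq> 0"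
  obtains \<Xi>' where "\<Xi>' \<in> carrier_mat m n" "odd_mat \<Xi>'"
    "even_mat (A11 + \<Xi> * A21)" "even_mat (A22 - A21 * \<Xi>')"
    "(A11 + \<Xi> * A21) * \<Xi>' = A12 + \<Xi> * A22"
    "det (ge_mat (A11 - A12 * inverse_mat A22 * A21)) * det (ge_mat (inverse_mat A22))
      * det (ge_mat (A22 - A21 * \<Xi>')) = det (ge_mat (A11 + \<Xi> * A21))"
proof -
  define X where "X = A11 + \<Xi> * A21"
  define H where "H = A12 + \<Xi> * A22"
  have \<Xi>A: "\<Xi> * A21 \<in> carrier_mat m m" "even_mat (\<Xi> * A21)" "\<Xi> * A22 \<in> carrier_mat m n" "odd_mat (\<Xi> * A22)"
    using \<Xi> A21 A22 even_mat_mult(2)[OF \<Xi>(1) A21(1)] even_mat_mult(4)[OF \<Xi>(1) A22(1)] by auto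
  have X: "X \<in> carrier_mat m m" "even_mat X"
    unfolding X_def using \<Xi>A even_mat_add(1)[OF A11(1) \<Xi>A(1)] A11 by auto
  have H: "H \<in> carrier_mat m n" "odd_mat H"
    unfolding H_def using \<Xi>A even_mat_add(2)[OF A12(1) \<Xi>A(3)] A12 by auto
  \<comment> \<open>The correction to \<open>A11\<close> is a product of odd matrices and has body
    zero.\<close>
  have "map_mat gbody X = map_mat gbody A11"
  proof (rule eq_matI)
    fix i j assume "i < dim_row (map_mat gbody A11)" "j < dim_col (map_mat gbody A11)"
    then have ij: "i < m" "j < m" using A11 by auto
    have "gbody ((\<Xi> * A21) $$ (i, j)) = 0"
      unfolding index_mult_mat_sum[OF \<Xi>(1) A21(1) ij] gbody_sum
      using \<Xi> ij by (intro sum.neutral) (auto simp: odd_mat_def gbody_odd)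
    then show "map_mat gbody X $$ (i, j) = map_mat gbody A11 $$ (i, j)"
      using ij A11 \<Xi>A(1) \<Xi>(1) A21(1) by (simp add: X_def del: index_mult_mat(1))
  qed (use A11 X in auto)
  with body have bX: "det (map_mat gbody X) \<noteq> 0" by simp
  obtain U where U: "U \<in> carrier_mat m m" "even_mat U" "X * U = 1\<^sub>m m" "U * X = 1\<^sub>m m"
    by (rule even_matrix_inverse[OF X bX])
  obtain V where V: "V \<in> carrier_mat n n" "even_mat V" "A22 * V = 1\<^sub>m n" "V * A22 = 1\<^sub>m n"
    by (rule even_matrix_inverse[OF A22 body(2)])
  have inv: "inverse_mat A22 = V" by (rule inverse_mat_eq[OF A22(1) V(1,3,4)])
  define \<Xi>' where "\<Xi>' = U * H"
  have \<Xi>': "\<Xi>' \<in> carrier_mat m n" "odd_mat \<Xi>'"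
    unfolding \<Xi>'_def using U H even_mat_mult(3)[OF U(1) H(1)] by auto
  have X\<Xi>': "X * \<Xi>' = H" unfolding \<Xi>'_def using assoc_mult_mat[OF X(1) U(1) H(1), symmetric] U H by simp
  \<comment> \<open>With this \<open>P\<close> and the \<open>Q\<close> below, the Schur complement
    of \<open>A22\<close> is X (1 + P Q) and A22 - A21 Xi' is A22 (1 + Q P), so that
    \<open>det_one_plus_odd\<close> links the two.\<close>
  define P where "P = - \<Xi>'"
  have P: "P \<in> carrier_mat m n" "odd_mat P" using \<Xi>' by (auto simp: P_def intro: odd_mat_uminus)
  define Q where "Q = V * A21"
  have Q: "Q \<in> carrier_mat n m" "odd_mat Q"
    unfolding Q_def using V A21 even_mat_mult(3)[OF V(1) A21(1)] by auto
  have PQ: "P * Q \<in> carrier_mat m m" "even_mat (P * Q)" "Q * P \<in> carrier_mat n n" "even_mat (Q * P)"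
    using P Q even_mat_mult(2)[OF P(1) Q(1)] even_mat_mult(2)[OF Q(1) P(1)] by auto
  have XP: "X * P = - H" unfolding P_def using X \<Xi>' X\<Xi>' by (simp add: uminus_mult_right_mat)
  have A22Q: "A22 * Q = A21"
    unfolding Q_def using assoc_mult_mat[OF A22(1) V(1) A21(1), symmetric] V A21 by simp
  have "H * Q = A12 * Q + \<Xi> * A21"
    unfolding H_def using add_mult_distrib_mat[OF A12(1) \<Xi>A(3) Q(1)] assoc_mult_mat[OF \<Xi>(1) A22(1) Q(1)] A22Q by simp
  moreover have "X * (P * Q) = - (H * Q)"
    using assoc_mult_mat[OF X(1) P(1) Q(1), symmetric] XP H Q by (simp add: uminus_mult_left_mat)
  ultimately have "X * (1\<^sub>m m + P * Q) = X + - (A12 * Q + \<Xi> * A21)"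
    using mult_add_distrib_mat[OF X(1) one_carrier_mat PQ(1)] X by simp
  also have "\<dots> = A11 - A12 * Q"
  proof -
    have "a + b + - (c + b) = a - c" if "a \<in> carrier_mat m m" "b \<in> carrier_mat m m" "c \<in> carrier_mat m m"
      for a b c :: "'a grassmann mat"
      using that by (intro eq_matI) auto
    then show ?thesis unfolding X_def using A11 \<Xi>A(1) mult_carrier_mat[OF A12(1) Q(1)] by blast
  qed
  also have "A12 * Q = A12 * V * A21"
    unfolding Q_def using assoc_mult_mat[OF A12(1) V(1) A21(1)] by simp
  finally have S: "A11 - A12 * V * A21 = X * (1\<^sub>m m + P * Q)" by simp
  have "A22 * (Q * P) = A21 * P" using assoc_mult_mat[OF A22(1) Q(1) P(1), symmetric] A22Q by simp
  also have "\<dots> = - (A21 * \<Xi>')" unfolding P_def using A21 \<Xi>' by (simp add: uminus_mult_right_mat)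
  finally have "A22 * (1\<^sub>m n + Q * P) = A22 + - (A21 * \<Xi>')"
    using mult_add_distrib_mat[OF A22(1) one_carrier_mat PQ(3)] A22 by simp
  also have "\<dots> = A22 - A21 * \<Xi>'"
    using A22 A21 \<Xi>' by (intro eq_matI) (auto simp del: index_mult_mat(1))
  finally have M: "A22 - A21 * \<Xi>' = A22 * (1\<^sub>m n + Q * P)" by simp
  have Z: "1\<^sub>m m + P * Q \<in> carrier_mat m m" "even_mat (1\<^sub>m m + P * Q)"
    "1\<^sub>m n + Q * P \<in> carrier_mat n n" "even_mat (1\<^sub>m n + Q * P)"
    using PQ even_mat_add(1)[OF one_carrier_mat PQ(1)] even_mat_add(1)[OF one_carrier_mat PQ(3)] by auto
  have "det (ge_mat V) * det (ge_mat A22) = 1"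
    using det_ge_mat_mult[OF V(1) A22(1) V(2) A22(2)] V(4) ge_mat_one[of n, where 'a = 'a] by simp
  moreover have "det (ge_mat (1\<^sub>m m + P * Q)) * det (ge_mat (1\<^sub>m n + Q * P)) = 1"
    by (rule det_one_plus_odd[OF P Q])
  moreover have "det (ge_mat (A11 - A12 * V * A21)) * det (ge_mat V) * det (ge_mat (A22 - A21 * \<Xi>'))
      = det (ge_mat X) * (det (ge_mat V) * det (ge_mat A22)) * (det (ge_mat (1\<^sub>m m + P * Q)) * det (ge_mat (1\<^sub>m n + Q * P)))"
    unfolding S M det_ge_mat_mult[OF X(1) Z(1) X(2) Z(2)] det_ge_mat_mult[OF A22(1) Z(3) A22(2) Z(4)]
    by (simp add: mult_ac)
  ultimately have "det (ge_mat (A11 - A12 * V * A21)) * det (ge_mat V) * det (ge_mat (A22 - A21 * \<Xi>')) = det (ge_mat X)"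
    by simp
  moreover have "even_mat (A22 - A21 * \<Xi>')" unfolding M by (rule even_mat_mult(1)[OF A22(1) Z(3) A22(2) Z(4)])
  ultimately show ?thesis using that[of \<Xi>'] \<Xi>' X X\<Xi>' by (simp add: inv X_def H_def)
qed

definition bottom_row :: "nat \<Rightarrow> nat \<Rightarrow> (nat \<Rightarrow> nat \<Rightarrow> 'a::comm_ring_1 grassmann) \<Rightarrow> 'a grassmann" where
  "bottom_row m n \<xi> = prod_list (map (\<lambda>l. \<xi> l m) [0..<n])"

text \<open>In the expansion, choices that repeat an odd factor vanish and permutations contribute
  their signs: a linear substitution acts on the top exterior power by its determinant.\<close>

lemma prod_list_odd_transform:
  fixes z :: "nat \<Rightarrow> 'a::field_char_0 grassmann"
  assumes z: "\<And>l. gparity True (z l)" and M: "M \<in> carrier_mat n n"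
  shows "prod_list (map (\<lambda>l. \<Sum>l'<n. z l' * of_geven (M $$ (l', l))) [0..<n]) =
    of_geven (det M) * prod_list (map z [0..<n])"
proof -
  let ?X = "{0..<n} \<rightarrow>\<^sub>E {..<n}" and ?P = "{p. p permutes {0..<n}}"
  let ?f = "\<lambda>\<rho>. of_geven (\<Prod>l\<in>{0..<n}. M $$ (\<rho> l, l)) * prod_list (map (\<lambda>l. z (\<rho> l)) [0..<n])"
  have "prod_list (map (\<lambda>l. \<Sum>l'<n. z l' * of_geven (M $$ (l', l))) [0..<n]) =
      (\<Sum>\<rho>\<in>?X. prod_list (map (\<lambda>l. z (\<rho> l) * of_geven (M $$ (\<rho> l, l))) [0..<n]))"
    by (subst prod_list_sum_PiE) auto
  also have "\<dots> = (\<Sum>\<rho>\<in>?X. ?f \<rho>)"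
  proof (intro sum.cong refl)
    fix \<rho>
    show "prod_list (map (\<lambda>l. z (\<rho> l) * of_geven (M $$ (\<rho> l, l))) [0..<n]) = ?f \<rho>"
      using prod_list_mult_of_geven[of "[0..<n]" "\<lambda>l. z (\<rho> l)" "\<lambda>l. M $$ (\<rho> l, l)"] by simp
  qed
  also have "\<dots> = (\<Sum>\<rho>\<in>(\<lambda>p. restrict p {0..<n}) ` ?P. ?f \<rho>)"
  proof (rule sum.mono_neutral_right)
    show "finite ?X" by (intro finite_PiE) auto
    show "(\<lambda>p. restrict p {0..<n}) ` ?P \<subseteq> ?X"
    proof (rule image_subsetI, rule restrict_PiE_iff[THEN iffD2], rule ballI)
      show "p l \<in> {..<n}" if "p \<in> ?P" "l \<in> {0..<n}" for p l
        using permutes_in_image[of p "{0..<n}" l] that by simp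
    qed
    show "\<forall>\<rho>\<in>?X - (\<lambda>p. restrict p {0..<n}) ` ?P. ?f \<rho> = 0"
    proof
      fix \<rho> assume \<rho>: "\<rho> \<in> ?X - (\<lambda>p. restrict p {0..<n}) ` ?P"
      define p where "p l = (if l < n then \<rho> l else l)" for l
      have "\<not> inj_on p {0..<n}"
      proof
        assume "inj_on p {0..<n}"
        then have "bij_betw p {0..<n} {0..<n}"
          using \<rho> by (intro bij_betw_imageI endo_inj_surj) (auto simp: p_def)
        then have "p permutes {0..<n}" by (rule bij_imp_permutes) (simp add: p_def)
        moreover have "\<rho> = restrict p {0..<n}" using \<rho> by (auto simp: p_def restrict_def PiE_def extensional_def)
        ultimately show False using \<rho> by blast
      qed
      then have "\<not> distinct (map \<rho> [0..<n])" by (auto simp: distinct_map inj_on_def p_def)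
      then have "prod_list (map z (map \<rho> [0..<n])) = 0" using z by (rule_tac prod_list_odd_repeated)
      then show "?f \<rho> = 0" by (simp add: comp_def)
    qed
  qed
  also have "\<dots> = (\<Sum>p\<in>?P. ?f (restrict p {0..<n}))"
  proof (rule sum.reindex[unfolded comp_def], rule inj_onI, rule ext)
    fix p p' l assume p: "p \<in> ?P" "p' \<in> ?P" "restrict p {0..<n} = restrict p' {0..<n}"
    show "p l = p' l"
      using p(1,2) fun_cong[OF p(3), of l] permutes_not_in[of p "{0..<n}" l] permutes_not_in[of p' "{0..<n}" l]
      by (cases "l < n") auto
  qed
  also have "\<dots> = (\<Sum>p\<in>?P. of_geven (of_int (sign p) * (\<Prod>l = 0..<n. M\<^sup>T $$ (l, p l))) * prod_list (map z [0..<n]))"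
  proof (intro sum.cong refl)
    fix p assume p: "p \<in> ?P"
    have "map (\<lambda>l. z (restrict p {0..<n} l)) [0..<n] = map (\<lambda>l. z (p l)) [0..<n]" by simp
    then have "prod_list (map (\<lambda>l. z (restrict p {0..<n} l)) [0..<n]) = of_int (sign p) * prod_list (map z [0..<n])"
      using prod_list_permute_odd[of p "{0..<n}" n "\<lambda>_. True" z] p z
      by (simp add: subset_iff del: map_eq_conv)
    moreover have "(\<Prod>l\<in>{0..<n}. M $$ (restrict p {0..<n} l, l)) = (\<Prod>l = 0..<n. M\<^sup>T $$ (l, p l))"
      using p M permutes_in_image[of p "{0..<n}"] by (intro prod.cong) auto
    ultimately show "?f (restrict p {0..<n}) = of_geven (of_int (sign p) * (\<Prod>l = 0..<n. M\<^sup>T $$ (l, p l))) * prod_list (map z [0..<n])"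
      by (simp only: of_geven_of_int of_geven_hom mult.assoc[symmetric]
          mult_of_int_commute[of "sign p" "of_geven _", symmetric])
  qed
  also have "\<dots> = of_geven (det (M\<^sup>T)) * prod_list (map z [0..<n])"
    using M by (simp add: det_def'[of "M\<^sup>T" n] of_geven_sum sum_distrib_right)
  finally show ?thesis using det_transpose[OF M] by simp
qed

section \<open>Transformation under \<open>GL V\<close>\<close>

lemma ev_rowpt_transform:
  fixes y y' :: "nat \<Rightarrow> nat \<Rightarrow> 'a::comm_ring_1 grassmann"
  assumes g: "g \<in> carrier_mat r r" and x: "x \<in> W m n (replicate r q)"
    and pt: "point m y" "point m y'"
    and y': "\<And>v k. v < m + n \<Longrightarrow> k < r \<Longrightarrow> y' v k = (\<Sum>k'<r. y v k' * of_geven (g $$ (k', k)))"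
  shows "ev (rowpt (replicate r q) y') x = of_geven (det g ^ q) * ev (rowpt (replicate r q) y) x"
proof -
  let ?lam = "replicate r q"
  have L: "sum_list ?lam = r * q" by (simp add: sum_list_replicate)
  obtain t where t: "t \<in> tensor_power m n (sum_list ?lam)" "x = young_act m ?lam t" using x by (auto simp: W_def)
  have "colev ?lam y' t = colev ?lam (\<lambda>v k. \<Sum>k'<r. y v k' * of_geven (g $$ (k', k))) t"
    using y' by (intro colev_cong[OF t(1)]) auto
  also have "\<dots> = of_geven (det g ^ q) * colev ?lam y t"
    using t(1) unfolding L by (rule colev_row_transform[OF g])
  finally have c: "colev ?lam y' t = of_geven (det g ^ q) * colev ?lam y t" .
  show ?thesis
    unfolding t(2) ev_young_act_rowpt[OF pt(1) t(1)] ev_young_act_rowpt[OF pt(2) t(1)] c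
    by (simp only: mult.assoc[symmetric] of_geven_commute[of "det g ^ q" "of_nat _"])
qed

lemma ev_rowpt_gl_act:
  assumes F: "F \<in> GL m n" and y: "point m y" and t: "t \<in> tensor_power m n l"
  shows "ev (rowpt lam y) (gl_act m n F t) = ev (rowpt lam (transform (m + n) y (matrix_of (m + n) F))) t"
proof -
  have "transform (m + n) (rowpt lam y) X = rowpt lam (transform (m + n) y X)" for X
    by (intro ext) (simp add: transform_def rowpt_def)
  then show ?thesis using ev_gl_act[OF point_rowpt[OF y] t, of F lam] GL_carrier[OF F] by simp
qed

text \<open>The first \<open>m\<close> rows of the normalized point form (1, Xi); the matrix A turns
  them into (X, H) with X = A11 + Xi A21 and H = A12 + Xi A22. Extracting X as a row transformation
  leaves (1, Xi') with X Xi' = H. Row \<open>m\<close>, used for \<open>lam_g\<close> only, changes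
  from (0, xi_m) to (xi_m A21, xi_m A22); subtracting xi_m A21 times (1, Xi') leaves (0, xi_m M)
  with M = A22 - A21 Xi'. Hence the same \<open>\<xi>'\<close> and x = det X serve both diagrams,
  and mu = det M.\<close>

lemma gl_act_normal_point:
  fixes F :: "'a::field_char_0 grassmann vec \<Rightarrow> 'a grassmann vec"
  assumes F: "F \<in> GL m n" and \<xi>: "odd_matrix \<xi>"
  obtains \<xi>' x \<mu> where "odd_matrix \<xi>'"
    "\<And>t. t \<in> W m n (lam_h m n) \<Longrightarrow> ev (rowpt (lam_h m n) (normal_point m \<xi>)) (gl_act m n F t)
      = of_geven (x ^ (n + 1)) * ev (rowpt (lam_h m n) (normal_point m \<xi>')) t"
    "\<And>t. t \<in> W m n (lam_g m n) \<Longrightarrow> ev (rowpt (lam_g m n) (normal_point m \<xi>)) (gl_act m n F t)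
      = of_geven (x ^ n) * ev (rowpt (lam_g m n) (normal_point m \<xi>')) t"
    "bottom_row m n \<xi>' = of_geven \<mu> * bottom_row m n \<xi>"
    "berezinian m (matrix_of (m + n) F) * \<mu> = x"
proof -
  let ?d = "m + n"
  let ?A = "matrix_of ?d F"
  define A11 where "A11 = mat m m (\<lambda>(i, j). ?A $$ (i, j))"
  define A12 where "A12 = mat m n (\<lambda>(i, j). ?A $$ (i, j + m))"
  define A21 where "A21 = mat n m (\<lambda>(i, j). ?A $$ (i + m, j))"
  define A22 where "A22 = mat n n (\<lambda>(i, j). ?A $$ (i + m, j + m))"
  \<comment> \<open>The row index comes first here, whereas \<open>\<xi>\<close> takes the letter
    first.\<close>
  define \<Xi> where "\<Xi> = mat m n (\<lambda>(k, l). \<xi> l k)"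
  have dimA: "dim_row ?A = ?d" "dim_col ?A = ?d" by (simp_all add: matrix_of_def)
  have c: "A11 \<in> carrier_mat m m" "A12 \<in> carrier_mat m n" "A21 \<in> carrier_mat n m" "A22 \<in> carrier_mat n n"
    "\<Xi> \<in> carrier_mat m n" by (simp_all add: A11_def A12_def A21_def A22_def \<Xi>_def)
  have split: "split_block ?A m m = (A11, A12, A21, A22)"
    by (auto simp: split_block_def Let_def dimA A11_def A12_def A21_def A22_def intro!: cong_mat)
  have p: "even_mat A11" "odd_mat A12" "odd_mat A21" "even_mat A22" "odd_mat \<Xi>"
  proof -
    have "gparity False (?A $$ (i, j))" if "i < m" "j < m" for i j
      using GL_parity[OF F, of i j] that by simp
    moreover have "gparity True (?A $$ (i, j + m))" if "i < m" "j < n" for i j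
      using GL_parity[OF F, of i "j + m"] that by simp
    moreover have "gparity True (?A $$ (i + m, j))" if "i < n" "j < m" for i j
      using GL_parity[OF F, of "i + m" j] that by simp
    moreover have "gparity False (?A $$ (i + m, j + m))" if "i < n" "j < n" for i j
      using GL_parity[OF F, of "i + m" "j + m"] that by simp
    ultimately show "even_mat A11" "odd_mat A12" "odd_mat A21" "even_mat A22" "odd_mat \<Xi>"
      using \<xi> by (auto simp: even_mat_def odd_mat_def A11_def A12_def A21_def A22_def \<Xi>_def odd_matrix_def)
  qed
  have body: "det (map_mat gbody A11) \<noteq> 0" "det (map_mat gbody A22) \<noteq> 0"
    using GL_diagonal_blocks[OF F] by (simp_all add: A11_def A22_def)
  obtain \<Xi>' where \<Xi>': "\<Xi>' \<in> carrier_mat m n" "odd_mat \<Xi>'"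
    "even_mat (A11 + \<Xi> * A21)" "even_mat (A22 - A21 * \<Xi>')"
    "(A11 + \<Xi> * A21) * \<Xi>' = A12 + \<Xi> * A22"
    "det (ge_mat (A11 - A12 * inverse_mat A22 * A21)) * det (ge_mat (inverse_mat A22))
      * det (ge_mat (A22 - A21 * \<Xi>')) = det (ge_mat (A11 + \<Xi> * A21))"
    using berezinian_schur[OF c(1) p(1) c(2) p(2) c(3) p(3) c(4) p(4) c(5) p(5) body] by metis
  define X where "X = A11 + \<Xi> * A21"
  define M where "M = A22 - A21 * \<Xi>'"
  have X: "X \<in> carrier_mat m m" "even_mat X" and M: "M \<in> carrier_mat n n" "even_mat M"
    using \<Xi>' c mult_carrier_mat[OF c(3) \<Xi>'(1)] mult_carrier_mat[OF c(5,3)]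
    by (simp_all add: X_def M_def minus_carrier_mat)
  define x where "x = det (ge_mat X)"
  define \<mu> where "\<mu> = det (ge_mat M)"
  have ber: "berezinian m ?A * \<mu> = x"
    using \<Xi>'(6) by (simp add: berezinian_def split x_def \<mu>_def X_def M_def)
  define \<zeta> where "\<zeta> l = (\<Sum>l'<n. \<xi> l' m * M $$ (l', l))" for l
  \<comment> \<open>Entries beyond row \<open>m\<close> or beyond the last letter are set to 0,
    which counts as odd.\<close>
  define \<xi>' where "\<xi>' l k = (if k < m then if l < n then \<Xi>' $$ (k, l) else 0
    else if k = m \<and> l < n then \<zeta> l else 0)" for l k
  have oddM: "gparity True (\<xi> l' m * M $$ (l', l))" if "l' < n" "l < n" for l l'
    using gparity_mult[of True "\<xi> l' m" False "M $$ (l', l)"] \<xi> M that by (simp add: odd_matrix_def even_mat_def)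
  have \<xi>': "odd_matrix \<xi>'"
    using \<Xi>'(1,2) oddM by (auto simp: odd_matrix_def \<xi>'_def \<zeta>_def odd_mat_def intro!: gparity_sum)
  define y where "y = transform ?d (normal_point m \<xi>) ?A"
  have y: "point m y" unfolding y_def by (rule point_transform[OF point_normal_point[OF \<xi>] F])
  have yj: "y j k = (if k < m then ?A $$ (k, j) else 0) + (\<Sum>l<n. \<xi> l k * ?A $$ (l + m, j))" if "j < ?d" for j k
  proof -
    have "y j k = (\<Sum>i<m. normal_point m \<xi> i k * ?A $$ (i, j)) + (\<Sum>l<n. normal_point m \<xi> (m + l) k * ?A $$ (m + l, j))"
      using that by (simp add: y_def transform_def sum_lessThan_split)
    also have "(\<Sum>i<m. normal_point m \<xi> i k * ?A $$ (i, j)) = (\<Sum>i<m. if i = k then ?A $$ (k, j) else 0)"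
      by (intro sum.cong) (auto simp: normal_point_def)
    finally show ?thesis by (simp add: normal_point_def add.commute)
  qed
  have yX: "y j k = X $$ (k, j)" if "j < m" "k < m" for j k
  proof -
    have "X $$ (k, j) = A11 $$ (k, j) + (\<Xi> * A21) $$ (k, j)"
      using that c by (simp add: X_def del: index_mult_mat(1))
    also have "\<dots> = y j k"
      using that c yj[of j k] index_mult_mat_sum[OF c(5,3), of k j]
      by (simp del: index_mult_mat(1)) (simp add: A11_def A21_def \<Xi>_def)
    finally show ?thesis by simp
  qed
  have yH: "y (m + l) k = (\<Sum>k'<m. X $$ (k, k') * \<Xi>' $$ (k', l))" if "l < n" "k < m" for l k
  proof -
    have "(X * \<Xi>') $$ (k, l) = (A12 + \<Xi> * A22) $$ (k, l)" using \<Xi>'(5) by (simp add: X_def)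
    also have "\<dots> = ?A $$ (k, m + l) + (\<Sum>s<n. \<xi> s k * ?A $$ (s + m, m + l))"
      using that c index_mult_mat_sum[OF c(5,4), of k l]
      by (simp del: index_mult_mat(1)) (simp add: A12_def A22_def \<Xi>_def add.commute)
    also have "\<dots> = y (m + l) k" using that yj[of "m + l" k] by simp
    finally show ?thesis using index_mult_mat_sum[OF X(1) \<Xi>'(1), of k l] that by simp
  qed
  have Xev: "of_geven (to_geven (X $$ (k, j))) = X $$ (k, j)" if "k < m" "j < m" for k j
    using X that by (auto simp: even_mat_def of_geven_to_geven)
  have yev: "of_geven (to_geven (y j k)) = y j k" if "j < m" for j k
    using y that by (intro of_geven_to_geven) (metis not_le point_def)
  have comm: "a * b = b * a" if "gparity False a" for a b :: "'a grassmann" using geven_commute[OF that] .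
  have Xcomm: "X $$ (k, k') * b = b * X $$ (k, k')" if "k < m" "k' < m" for k k' b
    using X that by (intro comm) (auto simp: even_mat_def)
  show ?thesis
  proof (rule that[OF \<xi>' _ _ _ ber])
    fix t :: "'a tensor" assume t: "t \<in> W m n (lam_h m n)"
    have tp: "t \<in> tensor_power m n (sum_list (lam_h m n))" using t W_subset by blast
    \<comment> \<open>Transposed, because \<open>X\<close> has the index of the target row first and
      row transformations have it last.\<close>
    let ?g = "(ge_mat X)\<^sup>T"
    have "ev (rowpt (lam_h m n) y) t = of_geven (det ?g ^ (n + 1)) * ev (rowpt (lam_h m n) (normal_point m \<xi>')) t"
      unfolding lam_h_def
    proof (rule ev_rowpt_transform)
      show "?g \<in> carrier_mat m m" using X by simp
      show "t \<in> W m n (replicate m (n + 1))" using t by (simp add: lam_h_def)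
      show "point m y" by (rule y)
      show "point m (normal_point m \<xi>')" by (rule point_normal_point[OF \<xi>'])
      fix v k assume vk: "v < m + n" "k < m"
      show "y v k = (\<Sum>k'<m. normal_point m \<xi>' v k' * of_geven (?g $$ (k', k)))"
      proof (cases "v < m")
        case True
        have "(\<Sum>k'<m. normal_point m \<xi>' v k' * of_geven (?g $$ (k', k))) = (\<Sum>k'<m. if k' = v then X $$ (k, v) else 0)"
          using True vk X Xev by (intro sum.cong) (auto simp: normal_point_def)
        then show ?thesis using True vk yX by simp
      next
        case False
        define l where "l = v - m"
        have l: "v = m + l" "l < n" using False vk by (auto simp: l_def)
        have "(\<Sum>k'<m. normal_point m \<xi>' v k' * of_geven (?g $$ (k', k))) = (\<Sum>k'<m. X $$ (k, k') * \<Xi>' $$ (k', l))"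
          using l vk X Xev Xcomm by (intro sum.cong) (auto simp: normal_point_def \<xi>'_def)
        then show ?thesis using l vk yH by simp
      qed
    qed
    moreover have "det ?g = x" using X by (simp add: x_def det_transpose[of _ m])
    ultimately show "ev (rowpt (lam_h m n) (normal_point m \<xi>)) (gl_act m n F t)
      = of_geven (x ^ (n + 1)) * ev (rowpt (lam_h m n) (normal_point m \<xi>')) t"
      using ev_rowpt_gl_act[OF F point_normal_point[OF \<xi>] tp] by (simp add: y_def)
  next
    fix t :: "'a tensor" assume t: "t \<in> W m n (lam_g m n)"
    have tp: "t \<in> tensor_power m n (sum_list (lam_g m n))" using t W_subset by blast
    \<comment> \<open>The rows \<open>k' < m\<close> hold the values of the even letters, those in
      row \<open>m\<close> of the diagram included. The last row is a unit vector, so the new row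
      \<open>m\<close> enters with coefficient 1.\<close>
    define g where "g = mat (Suc m) (Suc m) (\<lambda>(k', k). if k' < m then to_geven (y k' k) else if k = m then 1 else 0)"
    have g: "g \<in> carrier_mat (Suc m) (Suc m)" by (simp add: g_def)
    have yM: "y (m + l) m = (\<Sum>k'<m. \<Xi>' $$ (k', l) * y k' m) + \<zeta> l" if l: "l < n" for l
    proof -
      have "(\<Sum>k'<m. \<Xi>' $$ (k', l) * y k' m) = (\<Sum>k'<m. y k' m * \<Xi>' $$ (k', l))"
        using y by (intro sum.cong refl comm[symmetric]) (auto simp: point_def, metis not_le)
      also have "\<dots> = (\<Sum>k'<m. \<Sum>s<n. \<xi> s m * (?A $$ (s + m, k') * \<Xi>' $$ (k', l)))"
        by (intro sum.cong refl) (simp add: yj sum_distrib_right mult.assoc)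
      also have "\<dots> = (\<Sum>s<n. \<xi> s m * (A21 * \<Xi>') $$ (s, l))"
      proof (subst sum.swap, intro sum.cong refl)
        fix s assume "s \<in> {..<n}"
        then show "(\<Sum>k'<m. \<xi> s m * (?A $$ (s + m, k') * \<Xi>' $$ (k', l))) = \<xi> s m * (A21 * \<Xi>') $$ (s, l)"
          using index_mult_mat_sum[OF c(3) \<Xi>'(1), of s l] l
          by (simp add: A21_def sum_distrib_left del: index_mult_mat(1))
      qed
      finally have "(\<Sum>k'<m. \<Xi>' $$ (k', l) * y k' m) + \<zeta> l
          = (\<Sum>s<n. \<xi> s m * ((A21 * \<Xi>') $$ (s, l) + M $$ (s, l)))"
        by (simp add: \<zeta>_def distrib_left sum.distrib)
      also have "\<dots> = (\<Sum>s<n. \<xi> s m * ?A $$ (s + m, m + l))"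
        using l c \<Xi>'(1) by (intro sum.cong refl) (simp add: M_def A22_def add.commute del: index_mult_mat(1))
      finally show ?thesis using yj[of "m + l" m] l by simp
    qed
    have "ev (rowpt (lam_g m n) y) t = of_geven (det g ^ n) * ev (rowpt (lam_g m n) (normal_point m \<xi>')) t"
      unfolding lam_g_def Suc_eq_plus1[symmetric]
    proof (rule ev_rowpt_transform[OF g])
      show "t \<in> W m n (replicate (Suc m) n)" using t by (simp add: lam_g_def)
      show "point m y" by (rule y)
      show "point m (normal_point m \<xi>')" by (rule point_normal_point[OF \<xi>'])
      fix v k assume vk: "v < m + n" "k < Suc m"
      have gm: "of_geven (g $$ (k', k)) = y k' k" if "k' < m" for k' using that vk yev by (simp add: g_def)
      have gl: "of_geven (g $$ (m, k)) = (if k = m then 1 else 0)" using vk by (simp add: g_def)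
      show "y v k = (\<Sum>k'<Suc m. normal_point m \<xi>' v k' * of_geven (g $$ (k', k)))"
      proof (cases "v < m")
        case True
        have "(\<Sum>k'<m. normal_point m \<xi>' v k' * of_geven (g $$ (k', k))) = (\<Sum>k'<m. if k' = v then y v k else 0)"
          using True vk gm by (intro sum.cong) (auto simp: normal_point_def)
        then show ?thesis using True by (simp add: normal_point_def)
      next
        case False
        define l where "l = v - m"
        have l: "v = m + l" "l < n" using False vk by (auto simp: l_def)
        have "(\<Sum>k'<m. normal_point m \<xi>' v k' * of_geven (g $$ (k', k))) = (\<Sum>k'<m. \<Xi>' $$ (k', l) * y k' k)"
          using l gm by (intro sum.cong) (auto simp: normal_point_def \<xi>'_def)
        moreover have "normal_point m \<xi>' v m = \<zeta> l" using l by (simp add: normal_point_def \<xi>'_def)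
        moreover have "(\<Sum>k'<m. \<Xi>' $$ (k', l) * y k' k) = y v k" if "k < m"
        proof -
          have "(\<Sum>k'<m. \<Xi>' $$ (k', l) * y k' k) = (\<Sum>k'<m. X $$ (k, k') * \<Xi>' $$ (k', l))"
            using that by (intro sum.cong refl) (simp add: yX Xcomm)
          then show ?thesis using yH[of l k] that l by simp
        qed
        ultimately show ?thesis using vk l yM gl by (cases "k = m") auto
      qed
    qed
    moreover have "det g = x"
    proof -
      \<comment> \<open>The values of the even letters in row \<open>m\<close> fall into an
        off-diagonal block and do not affect the determinant.\<close>
      define w where "w = mat 1 m (\<lambda>(_, k'). to_geven (y k' m))"
      have "g\<^sup>T = four_block_mat (ge_mat X) (0\<^sub>m m 1) w (1\<^sub>m 1)"
        using X yX by (intro eq_matI) (auto simp: g_def w_def less_Suc_eq)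
      then have "det (g\<^sup>T) = det (ge_mat X) * det (1\<^sub>m 1 :: 'a geven mat)"
        using X by (simp only:) (rule det_four_block_mat_upper_right_zero_col, auto simp: w_def)
      then show ?thesis using det_transpose[OF g] by (simp add: x_def)
    qed
    ultimately show "ev (rowpt (lam_g m n) (normal_point m \<xi>)) (gl_act m n F t)
      = of_geven (x ^ n) * ev (rowpt (lam_g m n) (normal_point m \<xi>')) t"
      using ev_rowpt_gl_act[OF F point_normal_point[OF \<xi>] tp] by (simp add: y_def)
  next
    have "bottom_row m n \<xi>' = prod_list (map (\<lambda>l. \<Sum>l'<n. \<xi> l' m * of_geven (ge_mat M $$ (l', l))) [0..<n])"
      unfolding bottom_row_def
      using M by (intro arg_cong[of _ _ prod_list] map_cong) (auto simp: \<xi>'_def \<zeta>_def even_mat_def of_geven_to_geven)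
    also have "\<dots> = of_geven \<mu> * bottom_row m n \<xi>"
      unfolding \<mu>_def bottom_row_def using \<xi> M by (intro prod_list_odd_transform) (auto simp: odd_matrix_def)
    finally show "bottom_row m n \<xi>' = of_geven \<mu> * bottom_row m n \<xi>" .
  qed
qed

section \<open>The isomorphism\<close>

lemma ev_canonical_tensor:
  assumes "shape m n lam" "S \<in> box_sets m n" "odd_matrix \<xi>"
  shows "ev (rowpt lam (normal_point m \<xi>)) (canonical_tensor m lam S)
    = of_nat (card (row_stabilizer lam) * kappa m n lam (fill m S)) * monomial m lam \<xi> S"
  unfolding canonical_tensor_def filling_tensor_def
    ev_young_act_rowpt[OF point_normal_point[OF assms(3)] fill_word_tensor_power[OF assms(1,2)]]
    colev_fill[OF assms]
  by (simp add: mult.assoc)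

lemma ev_combination:
  assumes "shape m n lam" "odd_matrix \<xi>"
  shows "ev (rowpt lam (normal_point m \<xi>)) (combination m n lam a) = (\<Sum>S\<in>box_sets m n.
    of_nat (card (row_stabilizer lam) * kappa m n lam (fill m S)) * monomial m lam \<xi> S * a S)"
  unfolding combination_def ev_sum ev_rscale
  by (intro sum.cong refl) (simp only: ev_canonical_tensor[OF assms(1) _ assms(2)])

lemma card_row_stabilizer_pos: "card (row_stabilizer lam) > 0"
proof -
  have "id \<in> row_stabilizer lam" by (simp add: row_stabilizer_def permutes_id)
  then show ?thesis by (auto simp: card_gt_0_iff)
qed

lemma combination_cong:
  "(\<And>S. S \<in> box_sets m n \<Longrightarrow> a S = b S) \<Longrightarrow> combination m n lam a = combination m n lam b"
  unfolding combination_def by (intro sum.cong) auto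

text \<open>The assumption concerns values at normalized points only, so that elements of
  \<open>W\<close> can be compared by evaluation; for equal tensors it gives the uniqueness of
  coordinates.\<close>

lemma combination_inject:
  fixes a b :: "(nat \<times> nat) set \<Rightarrow> 'a::field_char_0 grassmann"
  assumes lam: "shape m n lam" and S: "S \<in> box_sets m n"
    and eq: "\<And>\<xi>. odd_matrix \<xi> \<Longrightarrow> ev (rowpt lam (normal_point m \<xi>)) (combination m n lam a)
      = ev (rowpt lam (normal_point m \<xi>)) (combination m n lam b)"
  shows "a S = b S"
proof -
  let ?k = "\<lambda>S. card (row_stabilizer lam) * kappa m n lam (fill m S)"
  have "a S - b S = 0"
  proof (rule monomials_independent[OF lam _ _ S, of ?k "\<lambda>S. a S - b S"])
    show "?k S > 0" for S using card_row_stabilizer_pos kappa_pos by simp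
    fix \<xi> :: "nat \<Rightarrow> nat \<Rightarrow> 'a grassmann" assume "odd_matrix \<xi>"
    with eq[OF this] show "(\<Sum>S\<in>box_sets m n. of_nat (?k S) * monomial m lam \<xi> S * (a S - b S)) = 0"
      by (simp add: ev_combination[OF lam] right_diff_distrib sum_subtractf del: of_nat_mult)
  qed
  then show ?thesis by simp
qed

lemma prod_list_concat: "prod_list (concat xss) = prod_list (map prod_list xss)"
  by (induction xss) auto

lemma shape_h [simp]: "shape m n (lam_h m n)" and shape_g [simp]: "shape m n (lam_g m n)"
  by (simp_all add: shape_def)

text \<open>Passing from \<open>lam_h\<close> to \<open>lam_g\<close> drops the last column, whose
  even letters have value 1 in their own rows, and appends a row of odd letters. That row is read
  last, so its product stands on the right.\<close>

lemma monomial_lam_g: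
  assumes S: "S \<in> box_sets m n"
  shows "monomial m (lam_g m n) \<xi> S = monomial m (lam_h m n) \<xi> S * bottom_row m n \<xi>"
proof -
  let ?f = "\<lambda>b. normal_point m \<xi> (fill m S b) (fst b)"
  have row: "prod_list (map (\<lambda>j. ?f (i, j)) [0..<n + 1]) = prod_list (map (\<lambda>j. ?f (i, j)) [0..<n])" if "i < m" for i
    using S that by (auto simp: fill_def normal_point_def)
  have "prod_list (map (\<lambda>i. prod_list (map (\<lambda>j. ?f (i, j)) [0..<n + 1])) [0..<m])
      = prod_list (map (\<lambda>i. prod_list (map (\<lambda>j. ?f (i, j)) [0..<n])) [0..<m])"
    by (intro arg_cong[of _ _ prod_list] map_cong[OF refl] row) simp
  moreover have "prod_list (map (\<lambda>j. ?f (m, j)) [0..<n]) = bottom_row m n \<xi>"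
    unfolding bottom_row_def by (simp add: fill_def normal_point_def)
  ultimately show ?thesis
    unfolding monomial_def lam_g_def lam_h_def boxes_replicate
    by (simp add: map_concat prod_list_concat comp_def del: upt_Suc replicate_Suc) simp
qed

lemma gparity_monomial_lam_h:
  assumes S: "S \<in> box_sets m n" and \<xi>: "odd_matrix \<xi>"
  shows "gparity (odd (card S)) (monomial m (lam_h m n) \<xi> S)"
proof -
  have "{b. m \<le> fill m S b} \<inter> set (boxes (lam_h m n)) = S"
    using S by (auto simp: fill_def lam_h_def set_boxes_replicate split: if_splits)
  then have "length (filter (\<lambda>b. m \<le> fill m S b) (boxes (lam_h m n))) = card S"
    by (simp add: distinct_length_filter[OF distinct_boxes])
  then show ?thesis
    using gparity_prod_list[of "boxes (lam_h m n)" "\<lambda>b. m \<le> fill m S b" "\<lambda>b. normal_point m \<xi> (fill m S b) (fst b)"]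
      point_normal_point[OF \<xi>, of m] by (simp add: monomial_def point_def)
qed

lemma gparity_bottom_row: "odd_matrix \<xi> \<Longrightarrow> gparity (odd n) (bottom_row m n \<xi>)"
  using gparity_prod_list[of "[0..<n]" "\<lambda>_. True" "\<lambda>l. \<xi> l m"] by (simp add: bottom_row_def odd_matrix_def)

lemma rho_fill: "S \<in> box_sets m n \<Longrightarrow> rho m n (fill m S) = card S"
  unfolding rho_def by (rule arg_cong[of _ _ card]) (auto simp: fill_def split: if_splits)

definition scale_factor :: "nat \<Rightarrow> nat \<Rightarrow> (nat \<times> nat) set \<Rightarrow> 'a::field_char_0" where
  "scale_factor m n S = alpha m n (fill m S) (fill m S)"

lemma scale_factor_nonzero: "scale_factor m n S \<noteq> 0"
  using kappa_pos[of m n "lam_h m n" "fill m S"] kappa_pos[of m n "lam_g m n" "fill m S"]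
  by (simp add: scale_factor_def alpha_def)

text \<open>The tensor multiplied by b in the image of \<open>combination m n (lam_h m n) a\<close>.
  A canonical tensor is \<open>scale_factor\<close> times the normalized one, and this factor moves
  into the coordinates.\<close>

definition phi_coeff :: "nat \<Rightarrow> nat \<Rightarrow> ((nat \<times> nat) set \<Rightarrow> 'a::field_char_0 grassmann) \<Rightarrow> 'a tensor" where
  "phi_coeff m n a = combination m n (lam_g m n) (\<lambda>S. gconst (scale_factor m n S) * a S)"

text \<open>At normalized points the map of the theorem is multiplication by \<open>\<xi>\<^sub>1\<^sub>m \<cdots> \<xi>\<^sub>n\<^sub>m\<close> from the left,
  up to a positive factor; the sign in \<open>\<alpha>\<close> comes from moving this product past a monomial.\<close>

lemma ev_phi_coeff:
  fixes a :: "(nat \<times> nat) set \<Rightarrow> 'a::field_char_0 grassmann"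
  assumes \<xi>: "odd_matrix \<xi>"
  shows "of_nat (card (row_stabilizer (lam_h m n))) * ev (rowpt (lam_g m n) (normal_point m \<xi>)) (phi_coeff m n a)
    = of_nat (card (row_stabilizer (lam_g m n))) * (bottom_row m n \<xi> *
        ev (rowpt (lam_h m n) (normal_point m \<xi>)) (combination m n (lam_h m n) a))"
proof -
  let ?rh = "card (row_stabilizer (lam_h m n))" and ?rg = "card (row_stabilizer (lam_g m n))"
  let ?z = "bottom_row m n \<xi>"
  have nat_comm: "x * of_nat k = of_nat k * x" for x :: "'a grassmann" and k by (metis mult_of_nat_commute)
  have "of_nat ?rh * (of_nat (?rg * kappa m n (lam_g m n) (fill m S)) * monomial m (lam_g m n) \<xi> S
        * (gconst (scale_factor m n S) * a S))
      = of_nat ?rg * (?z * (of_nat (?rh * kappa m n (lam_h m n) (fill m S)) * monomial m (lam_h m n) \<xi> S * a S))"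
    if S: "S \<in> box_sets m n" for S
  proof -
    let ?kh = "kappa m n (lam_h m n) (fill m S)" and ?kg = "kappa m n (lam_g m n) (fill m S)"
    let ?M = "monomial m (lam_h m n) \<xi> S" and ?s = "scale_factor m n S :: 'a"
    have kg: "of_nat ?kg \<noteq> (0 :: 'a)" using kappa_pos[of m n "lam_g m n" "fill m S"] by simp
    \<comment> \<open>The denominator of \<open>alpha\<close> cancels the multiplicity for
      \<open>lam_g\<close> and leaves the signed multiplicity for \<open>lam_h\<close>.\<close>
    have "of_nat ?kg * gconst ?s = (gconst ((- 1) ^ (n * card S) * of_nat ?kh) :: 'a grassmann)"
      using kg by (simp add: scale_factor_def alpha_def rho_fill[OF S] flip: gconst_of_nat gconst_mult)
    also have "\<dots> = (- 1) ^ (n * card S) * of_nat ?kh"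
      by (simp add: gconst_mult gconst_of_nat minus_one_power_iff gconst_1 gconst_uminus)
    finally have k: "of_nat ?kg * gconst ?s = ((- 1) ^ (n * card S) * of_nat ?kh :: 'a grassmann)" .
    have sw: "?M * ?z = (- 1) ^ (n * card S) * (?z * ?M)"
      using supercommute[OF gparity_bottom_row[OF \<xi>, of n m] gparity_monomial_lam_h[OF S \<xi>]]
      by (auto simp: minus_one_power_iff)
    have "of_nat ?kg * (?M * ?z) * (gconst ?s * a S) = (of_nat ?kg * gconst ?s) * (?M * ?z) * a S"
      by (metis (no_types, opaque_lifting) gconst_commute mult.assoc)
    also have "\<dots> = of_nat ?kh * (?z * ?M) * a S"
      unfolding k sw by (simp add: minus_one_power_iff)
    finally have "of_nat ?kg * (?M * ?z) * (gconst ?s * a S) = of_nat ?kh * (?z * ?M) * a S" .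
    then have "of_nat ?rh * (of_nat ?rg * (of_nat ?kg * (?M * ?z) * (gconst ?s * a S)))
        = of_nat ?rh * (of_nat ?rg * (of_nat ?kh * (?z * ?M) * a S))" by simp
    moreover have "?z * (of_nat (?rh * ?kh) * ?M * a S) = of_nat (?rh * ?kh) * (?z * ?M) * a S"
      by (simp only: mult.assoc[symmetric] nat_comm)
    moreover have "of_nat i * (of_nat j * t) = of_nat j * (of_nat i * t)" for i j and t :: "'a grassmann"
      by (simp only: mult.assoc[symmetric] of_nat_mult[symmetric] mult.commute[of i j])
    ultimately show ?thesis
      unfolding monomial_lam_g[OF S] of_nat_mult by (simp only: mult.assoc)
  qed
  then show ?thesis
    unfolding phi_coeff_def ev_combination[OF shape_g \<xi>] ev_combination[OF shape_h \<xi>] sum_distrib_left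
    by (intro sum.cong refl)
qed

text \<open>Both sides lie in \<open>W\<close>, so values at a normalized \<open>\<xi>\<close>
  suffice, and the action moves both to the same \<open>\<xi>'\<close>. The left side acquires
  x^(n+1); the right side acquires Ber x^n, and \<open>bottom_row\<close> at \<open>\<xi>'\<close>
  adds mu. These factors agree because Ber mu = x.\<close>

lemma phi_coeff_gl_act:
  fixes a b :: "(nat \<times> nat) set \<Rightarrow> 'a::field_char_0 grassmann"
  assumes F: "F \<in> GL m n"
    and b: "gl_act m n F (combination m n (lam_h m n) a) = combination m n (lam_h m n) b"
  shows "phi_coeff m n b
    = rscale (gl_act m n F (phi_coeff m n a)) (of_geven (berezinian m (matrix_of (m + n) F)))"
proof -
  let ?h = "lam_h m n" and ?g = "lam_g m n"
  let ?rh = "card (row_stabilizer ?h)" and ?rg = "card (row_stabilizer ?g)"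
  let ?ber = "berezinian m (matrix_of (m + n) F)"
  have aW: "combination m n ?h a \<in> W m n ?h" by (rule combination_W[OF shape_h])
  have pW: "phi_coeff m n a \<in> W m n ?g" unfolding phi_coeff_def by (rule combination_W[OF shape_g])
  have rhs: "rscale (gl_act m n F (phi_coeff m n a)) (of_geven ?ber) \<in> W m n ?g"
    by (intro W_rscale gl_act_W F pW)
  then obtain c where c: "rscale (gl_act m n F (phi_coeff m n a)) (of_geven ?ber) = combination m n ?g c"
    by (rule W_combination[OF shape_g])
  have "ev (rowpt ?g (normal_point m \<xi>)) (phi_coeff m n b) = ev (rowpt ?g (normal_point m \<xi>)) (combination m n ?g c)"
    if \<xi>: "odd_matrix \<xi>" for \<xi> :: "nat \<Rightarrow> nat \<Rightarrow> 'a grassmann"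
  proof -
    obtain \<xi>' x \<mu> where *: "odd_matrix \<xi>'"
      "\<And>t. t \<in> W m n ?h \<Longrightarrow> ev (rowpt ?h (normal_point m \<xi>)) (gl_act m n F t)
        = of_geven (x ^ (n + 1)) * ev (rowpt ?h (normal_point m \<xi>')) t"
      "\<And>t. t \<in> W m n ?g \<Longrightarrow> ev (rowpt ?g (normal_point m \<xi>)) (gl_act m n F t)
        = of_geven (x ^ n) * ev (rowpt ?g (normal_point m \<xi>')) t"
      "bottom_row m n \<xi>' = of_geven \<mu> * bottom_row m n \<xi>" "?ber * \<mu> = x"
      using gl_act_normal_point[OF F \<xi>] by metis
    let ?H = "ev (rowpt ?h (normal_point m \<xi>')) (combination m n ?h a)"
    let ?z = "bottom_row m n \<xi>"
    have nat_comm: "y * of_nat k = of_nat k * y" for y :: "'a grassmann" and k by (metis mult_of_nat_commute)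
    \<comment> \<open>The factor \<open>?rh\<close> is carried along for the use of
      \<open>ev_phi_coeff\<close> and cancelled at the end.\<close>
    have "of_nat ?rh * ev (rowpt ?g (normal_point m \<xi>)) (combination m n ?g c)
        = of_nat ?rh * (of_geven (x ^ n) * ev (rowpt ?g (normal_point m \<xi>')) (phi_coeff m n a) * of_geven ?ber)"
      unfolding c[symmetric] ev_rscale *(3)[OF pW] ..
    also have "\<dots> = of_geven ?ber * (of_geven (x ^ n) * (of_nat ?rh * ev (rowpt ?g (normal_point m \<xi>')) (phi_coeff m n a)))"
      unfolding of_geven_commute[of ?ber] by (simp only: mult.assoc[symmetric] nat_comm)
    also have "\<dots> = of_geven ?ber * (of_geven (x ^ n) * (of_nat ?rg * (of_geven \<mu> * ?z * ?H)))"
      unfolding ev_phi_coeff[OF *(1)] *(4) ..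
    also have "\<dots> = of_nat ?rg * (of_geven (?ber * x ^ n * \<mu>) * (?z * ?H))"
      by (simp only: mult.assoc[symmetric] nat_comm of_geven_hom)
    also have "?ber * x ^ n * \<mu> = x ^ n * (?ber * \<mu>)" by (simp only: mult_ac)
    also have "\<dots> = x ^ (n + 1)" unfolding *(5) by simp
    also have "of_geven (x ^ (n + 1)) * (?z * ?H) = ?z * (of_geven (x ^ (n + 1)) * ?H)"
      by (simp only: mult.assoc[symmetric] of_geven_commute[of _ ?z])
    also have "of_geven (x ^ (n + 1)) * ?H = ev (rowpt ?h (normal_point m \<xi>)) (combination m n ?h b)"
      unfolding *(2)[OF aW, symmetric] b ..
    also have "of_nat ?rg * (?z * \<dots>) = of_nat ?rh * ev (rowpt ?g (normal_point m \<xi>)) (phi_coeff m n b)"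
      by (rule ev_phi_coeff[OF \<xi>, symmetric])
    finally show ?thesis
      using of_nat_grassmann_cancel card_row_stabilizer_pos by metis
  qed
  then have "gconst (scale_factor m n S) * b S = c S" if "S \<in> box_sets m n" for S
    unfolding phi_coeff_def
    by (rule combination_inject[OF shape_g that, where a = "\<lambda>S. gconst (scale_factor m n S) * b S" and b = c])
  then show ?thesis unfolding c unfolding phi_coeff_def by (rule combination_cong)
qed

section \<open>From canonical fillings to sets of odd boxes\<close>

lemma filling_tensor_cong:
  assumes "\<And>b. b \<in> set (boxes lam) \<Longrightarrow> p b = q b"
  shows "filling_tensor m lam p = filling_tensor m lam q"
proof -
  have "map p (boxes lam) = map q (boxes lam)" using assms by simp
  then show ?thesis unfolding filling_tensor_def by (simp only:)
qed

lemma kappa_cong: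
  assumes "\<And>b. b \<in> set (boxes lam) \<Longrightarrow> p b = q b"
  shows "kappa m n lam p = kappa m n lam q"
  unfolding kappa_def using assms by (intro prod.cong refl arg_cong[of _ _ fact] arg_cong[of _ _ card]) auto

text \<open>\<open>S\<close> collects the odd boxes of the small rectangle. Fillings are arbitrary
  outside their diagrams, so \<open>p\<close> and \<open>q\<close> are compared with
  \<open>fill m S\<close> on boxes only.\<close>

lemma canonical_pair:
  assumes p: "canonical m n (lam_h m n) p" and q: "canonical m n (lam_g m n) q" and pq: "same_rectangle m n p q"
  obtains S where "S \<in> box_sets m n"
    "h' m n p q = rscale (canonical_tensor m (lam_h m n) S) (gconst (1 / scale_factor m n S :: 'a::field_char_0))"
    "filling_tensor m (lam_g m n) q = (canonical_tensor m (lam_g m n) S :: 'a tensor)"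
proof -
  define S where "S = {(i, j). i < m \<and> j < n \<and> m \<le> p (i, j)}"
  have S: "S \<in> box_sets m n" by (auto simp: S_def)
  have ph: "p b = fill m S b" if "b \<in> set (boxes (lam_h m n))" for b
  proof -
    obtain i j where b: "b = (i, j)" by (cases b)
    then have "i < m" "j < n \<or> j = n" using that by (auto simp: lam_h_def set_boxes_replicate)
    moreover from this(1) have "\<forall>j<n. p (i, j) = i \<or> p (i, j) = m + j" "p (i, n) = i"
      using p by (auto simp: canonical_lam_h)
    ultimately show ?thesis by (cases "j < n"; cases "p (i, j) = i") (auto simp: b fill_def S_def)
  qed
  have qg: "q b = fill m S b" if "b \<in> set (boxes (lam_g m n))" for b
  proof -
    obtain i j where "b = (i, j)" by (cases b)
    then have b: "b = (i, j)" "i < m \<or> i = m" "j < n"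
      using that by (auto simp: lam_g_def set_boxes_replicate simp del: replicate_Suc)
    show ?thesis
    proof (cases "i < m")
      case True
      then have "q b = p b" using pq b by (simp add: same_rectangle_def)
      moreover have "b \<in> set (boxes (lam_h m n))" using True b by (simp add: lam_h_def set_boxes_replicate)
      ultimately show ?thesis using ph by simp
    next
      case False
      then show ?thesis using q b by (simp add: canonical_lam_g fill_def)
    qed
  qed
  have "rho m n p = rho m n (fill m S)"
    unfolding rho_def using ph by (intro arg_cong[of _ _ card]) (auto simp: lam_h_def set_boxes_replicate)
  then have "alpha m n p q = (scale_factor m n S :: 'a)"
    unfolding scale_factor_def alpha_def using kappa_cong[OF ph] kappa_cong[OF qg] by simp
  moreover have "filling_tensor m (lam_h m n) p = (canonical_tensor m (lam_h m n) S :: 'a tensor)"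
    "filling_tensor m (lam_g m n) q = (canonical_tensor m (lam_g m n) S :: 'a tensor)"
    unfolding canonical_tensor_def by (rule filling_tensor_cong, erule ph qg)+
  ultimately show ?thesis using that[OF S] by (simp add: h'_def)
qed

lemma fill_pair:
  assumes S: "S \<in> box_sets m n"
  shows "canonical m n (lam_h m n) (fill m S)" "canonical m n (lam_g m n) (fill m S)"
    "same_rectangle m n (fill m S) (fill m S)"
    "h' m n (fill m S) (fill m S) = rscale (canonical_tensor m (lam_h m n) S) (gconst (1 / scale_factor m n S))"
  using S canonical_fill[OF shape_h] canonical_fill[OF shape_g]
  by (auto simp: same_rectangle_def h'_def canonical_tensor_def scale_factor_def)

lemma gconst_scale_cancel:
  fixes a :: "'a::field_char_0 grassmann"
  shows "gconst (1 / scale_factor m n S) * (gconst (scale_factor m n S) * a) = a"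
    "gconst (scale_factor m n S) * (gconst (1 / scale_factor m n S) * a) = a"
proof -
  have "1 / scale_factor m n S * scale_factor m n S = (1 :: 'a)" using scale_factor_nonzero by simp
  then have "gconst (1 / scale_factor m n S) * gconst (scale_factor m n S) = (1 :: 'a grassmann)"
    by (simp only: gconst_mult[symmetric] gconst_1)
  then show "gconst (1 / scale_factor m n S) * (gconst (scale_factor m n S) * a) = a"
    "gconst (scale_factor m n S) * (gconst (1 / scale_factor m n S) * a) = a"
    using gconst_commute[of "1 / scale_factor m n S" "gconst (scale_factor m n S :: 'a)"]
    by (simp_all flip: mult.assoc)
qed

text \<open>The values on the normalized tensors and right linearity force the map on all
  combinations. Since these exhaust \<open>W\<close>, uniqueness follows, and all further properties
  can be read off in coordinates.\<close>

lemma extends_basis_map_combination: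
  fixes \<phi> :: "'a::field_char_0 tensor \<Rightarrow> 'a tensor bprod"
  assumes \<phi>: "extends_basis_map m n \<phi>"
  shows "\<phi> (combination m n (lam_h m n) a) = B (phi_coeff m n a)"
proof -
  let ?W = "W m n (lam_h m n)"
  have add: "\<phi> (x + y) = \<phi> x + \<phi> y" if "x \<in> ?W" "y \<in> ?W" for x y
    using \<phi> that by (simp add: extends_basis_map_def)
  have scale: "\<phi> (rscale x a) = b_rscale (\<phi> x) a" if "x \<in> ?W" for x a
    using \<phi> that by (simp add: extends_basis_map_def)
  have "\<phi> 0 = \<phi> 0 + \<phi> 0" using add[OF W_0 W_0] by simp
  then have 0: "\<phi> 0 = B 0" by (simp add: zero_bprod_def)
  have sum: "\<phi> (\<Sum>i\<in>I. f i) = B (\<Sum>i\<in>I. g i)"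
    if "finite I" "\<And>i. i \<in> I \<Longrightarrow> f i \<in> ?W" "\<And>i. i \<in> I \<Longrightarrow> \<phi> (f i) = B (g i)"
    for I :: "(nat \<times> nat) set set" and f g
    using that
  proof (induction I)
    case (insert i I)
    then show ?case using add[of "f i" "\<Sum>i\<in>I. f i"] W_sum[of I f m n "lam_h m n"] by simp
  qed (simp add: 0)
  show ?thesis
    unfolding phi_coeff_def combination_def
  proof (rule sum)
    fix S assume S: "S \<in> box_sets m n"
    let ?t = "canonical_tensor m (lam_h m n) S" and ?s = "scale_factor m n S"
    have t: "?t \<in> ?W" by (rule canonical_tensor_W[OF shape_h S])
    then show "rscale ?t (a S) \<in> ?W" by (rule W_rscale)
    have "\<phi> (rscale ?t (gconst (1 / ?s))) = B (canonical_tensor m (lam_g m n) S)"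
      using \<phi> fill_pair[OF S] unfolding extends_basis_map_def canonical_tensor_def by metis
    moreover have "rscale ?t (a S) = rscale (rscale ?t (gconst (1 / ?s))) (gconst ?s * a S)"
      by (simp add: rscale_rscale gconst_scale_cancel)
    ultimately show "\<phi> (rscale ?t (a S)) = B (rscale (canonical_tensor m (lam_g m n) S) (gconst ?s * a S))"
      using scale[OF W_rscale[OF t]] by simp
  qed simp
qed

text \<open>Both equations say that the coordinates agree, because \<open>scale_factor\<close> is
  invertible. One direction makes the map well defined, the other makes it injective.\<close>

lemma phi_coeff_inject:
  fixes a b :: "(nat \<times> nat) set \<Rightarrow> 'a::field_char_0 grassmann"
  shows "phi_coeff m n a = phi_coeff m n b \<longleftrightarrow> combination m n (lam_h m n) a = combination m n (lam_h m n) b"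
proof
  assume eq: "phi_coeff m n a = phi_coeff m n b"
  show "combination m n (lam_h m n) a = combination m n (lam_h m n) b"
  proof (rule combination_cong)
    fix S assume S: "S \<in> box_sets m n"
    have "gconst (scale_factor m n S) * a S = gconst (scale_factor m n S) * b S"
      by (rule combination_inject[OF shape_g S, where a = "\<lambda>S. gconst (scale_factor m n S) * a S"
            and b = "\<lambda>S. gconst (scale_factor m n S) * b S"])
        (use eq in \<open>simp add: phi_coeff_def\<close>)
    then show "a S = b S" by (metis gconst_scale_cancel(1))
  qed
next
  assume eq: "combination m n (lam_h m n) a = combination m n (lam_h m n) b"
  show "phi_coeff m n a = phi_coeff m n b"
    unfolding phi_coeff_def
  proof (rule combination_cong)
    fix S assume S: "S \<in> box_sets m n"
    have "a S = b S" by (rule combination_inject[OF shape_h S]) (simp add: eq)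
    then show "gconst (scale_factor m n S) * a S = gconst (scale_factor m n S) * b S" by simp
  qed
qed

lemma phi_coeff_surj:
  fixes z :: "'a::field_char_0 tensor"
  assumes "z \<in> W m n (lam_g m n)"
  obtains a where "z = phi_coeff m n a"
proof -
  obtain c where c: "z = combination m n (lam_g m n) c" by (rule W_combination[OF shape_g assms])
  have "z = phi_coeff m n (\<lambda>S. gconst (1 / scale_factor m n S) * c S)"
    unfolding c phi_coeff_def by (simp add: gconst_scale_cancel)
  then show ?thesis by (rule that)
qed

lemma phi_coeff_add: "phi_coeff m n a + phi_coeff m n b = phi_coeff m n (\<lambda>S. a S + b S)"
  by (simp add: phi_coeff_def combination_add distrib_left)

lemma phi_coeff_rscale: "rscale (phi_coeff m n a) c = phi_coeff m n (\<lambda>S. a S * c)"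
  by (simp add: phi_coeff_def combination_rscale mult.assoc)

lemma phi_coeff_W: "phi_coeff m n a \<in> W m n (lam_g m n)"
  unfolding phi_coeff_def by (rule combination_W[OF shape_g])

lemma extends_basis_map_exists:
  "\<exists>\<phi> :: 'a::field_char_0 tensor \<Rightarrow> 'a tensor bprod. extends_basis_map m n \<phi>"
proof -
  let ?h = "lam_h m n"
  \<comment> \<open>By \<open>phi_coeff_inject\<close> the result does not depend on the chosen
    coordinates. Outside \<open>W\<close> the value is \<open>undefined\<close>, as extensionality
    demands.\<close>
  define \<phi> :: "'a tensor \<Rightarrow> 'a tensor bprod" where
    "\<phi> x = (if x \<in> W m n ?h then B (phi_coeff m n (SOME a. x = combination m n ?h a)) else undefined)" for x
  have \<phi>: "\<phi> (combination m n ?h a) = B (phi_coeff m n a)" for a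
  proof -
    define x where "x = combination m n ?h a"
    have "x = combination m n ?h (SOME a. x = combination m n ?h a)"
      by (rule someI[of _ a]) (simp add: x_def)
    then have "phi_coeff m n a = phi_coeff m n (SOME a. x = combination m n ?h a)"
      unfolding phi_coeff_inject by (simp add: x_def)
    then show ?thesis using combination_W[OF shape_h, of m n a] by (simp add: \<phi>_def x_def)
  qed
  have "extends_basis_map m n \<phi>"
    unfolding extends_basis_map_def
  proof (intro conjI ballI allI impI)
    show "\<phi> \<in> W m n ?h \<rightarrow>\<^sub>E B ` W m n (lam_g m n)"
    proof (rule PiE_I)
      fix x :: "'a tensor" assume "x \<in> W m n ?h"
      then show "\<phi> x \<in> B ` W m n (lam_g m n)" by (simp add: \<phi>_def phi_coeff_W)
    qed (simp add: \<phi>_def)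
  next
    fix x y :: "'a tensor" assume "x \<in> W m n ?h" "y \<in> W m n ?h"
    then obtain a b where "x = combination m n ?h a" "y = combination m n ?h b"
      by (metis W_combination[OF shape_h])
    then show "\<phi> (x + y) = \<phi> x + \<phi> y" by (simp add: combination_add \<phi> phi_coeff_add)
  next
    fix x :: "'a tensor" and c assume "x \<in> W m n ?h"
    then obtain a where "x = combination m n ?h a" by (rule W_combination[OF shape_h])
    then show "\<phi> (rscale x c) = b_rscale (\<phi> x) c" by (simp add: combination_rscale \<phi> phi_coeff_rscale)
  next
    fix p q assume "canonical m n ?h p \<and> canonical m n (lam_g m n) q \<and> same_rectangle m n p q"
    then obtain S where S: "S \<in> box_sets m n"
      "h' m n p q = rscale (canonical_tensor m ?h S) (gconst (1 / scale_factor m n S) :: 'a grassmann)"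
      "filling_tensor m (lam_g m n) q = (canonical_tensor m (lam_g m n) S :: 'a tensor)"
      by (metis canonical_pair)
    \<comment> \<open>The coordinates of the normalized tensor; \<open>scale_factor\<close> turns
      them into unit coordinates for \<open>lam_g\<close>.\<close>
    let ?c = "\<lambda>S'. if S' = S then gconst (1 / scale_factor m n S) else 0 :: 'a grassmann"
    have "phi_coeff m n ?c = combination m n (lam_g m n) (\<lambda>S'. if S' = S then 1 else 0)"
      unfolding phi_coeff_def using gconst_scale_cancel(2)[of m n S 1] by (intro combination_cong) auto
    then show "\<phi> (h' m n p q) = B (filling_tensor m (lam_g m n) q)"
      unfolding S(2,3) using \<phi>[of ?c]
        combination_single[OF S(1), of ?h "gconst (1 / scale_factor m n S) :: 'a grassmann"]
        combination_single[OF S(1), of "lam_g m n" "1 :: 'a grassmann"] by simp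
  qed
  then show ?thesis by blast
qed

theorem theorem2p1:
  fixes m n :: nat
  shows "(\<exists>!\<phi> :: 'k::field_char_0 tensor \<Rightarrow> 'k tensor bprod. extends_basis_map m n \<phi>)
    \<and> (\<forall>\<phi> :: 'k tensor \<Rightarrow> 'k tensor bprod. extends_basis_map m n \<phi> \<longrightarrow>
         bij_betw \<phi> (W m n (lam_h m n)) (B ` W m n (lam_g m n))
         \<and> (\<forall>F \<in> GL m n. \<forall>x \<in> W m n (lam_h m n). \<phi> (gl_act m n F x) = b_act m n F (\<phi> x)))"
proof (intro conjI allI impI ballI)
  let ?h = "lam_h m n"
  note comb = W_combination[OF shape_h]
  show "\<exists>!\<phi> :: 'k tensor \<Rightarrow> 'k tensor bprod. extends_basis_map m n \<phi>"
  proof (rule ex_ex1I[OF extends_basis_map_exists])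
    fix \<phi> \<psi> :: "'k tensor \<Rightarrow> 'k tensor bprod"
    assume e: "extends_basis_map m n \<phi>" "extends_basis_map m n \<psi>"
    show "\<phi> = \<psi>"
    proof (rule PiE_ext[of _ "W m n ?h" "\<lambda>_. B ` W m n (lam_g m n)"])
      fix x :: "'k tensor" assume "x \<in> W m n ?h"
      then obtain a where "x = combination m n ?h a" by (rule comb)
      then show "\<phi> x = \<psi> x" by (simp add: extends_basis_map_combination e)
    qed (use e in \<open>simp_all add: extends_basis_map_def\<close>)
  qed
  fix \<phi> :: "'k tensor \<Rightarrow> 'k tensor bprod"
  assume \<phi>: "extends_basis_map m n \<phi>"
  note \<phi>_comb = extends_basis_map_combination[OF \<phi>]
  show "bij_betw \<phi> (W m n ?h) (B ` W m n (lam_g m n))"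
  proof (rule bij_betw_imageI)
    show "inj_on \<phi> (W m n ?h)"
    proof (rule inj_onI)
      fix x y :: "'k tensor" assume "x \<in> W m n ?h" "y \<in> W m n ?h" "\<phi> x = \<phi> y"
      moreover from this obtain a b where "x = combination m n ?h a" "y = combination m n ?h b" by (metis comb)
      ultimately show "x = y" by (simp add: \<phi>_comb phi_coeff_inject)
    qed
    show "\<phi> ` W m n ?h = B ` W m n (lam_g m n)"
    proof (intro equalityI subsetI)
      fix u assume "u \<in> \<phi> ` W m n ?h"
      then show "u \<in> B ` W m n (lam_g m n)" using \<phi> by (auto simp: extends_basis_map_def)
    next
      fix u :: "'k tensor bprod" assume "u \<in> B ` W m n (lam_g m n)"
      then obtain z where z: "z \<in> W m n (lam_g m n)" "u = B z" by blast
      obtain a where "z = phi_coeff m n a" by (rule phi_coeff_surj[OF z(1)])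
      then have "u = \<phi> (combination m n ?h a)" by (simp add: z(2) \<phi>_comb)
      then show "u \<in> \<phi> ` W m n ?h" using combination_W[OF shape_h] by blast
    qed
  qed
  fix F :: "'k grassmann vec \<Rightarrow> 'k grassmann vec" and x :: "'k tensor"
  assume F: "F \<in> GL m n" and x: "x \<in> W m n ?h"
  obtain a where a: "x = combination m n ?h a" by (rule comb[OF x])
  obtain b where b: "gl_act m n F x = combination m n ?h b" by (rule comb[OF gl_act_W[OF F x]])
  show "\<phi> (gl_act m n F x) = b_act m n F (\<phi> x)"
    using phi_coeff_gl_act[OF F b[unfolded a]] b by (simp add: a \<phi>_comb)
qed

end
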